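(* Let $\Sigma\subset\mathbb{B}^3$ be an embedded minimal free boundary surface and let $\gamma\subset\partial\Sigma$ be a connected component of the boundary of $\Sigma$. Assume that there exists a collar $\Gamma\subset\Sigma$ over $\gamma$ on which the set $\{x^T,Ax^T\}$ is linearly dependent (at every point of $\Gamma$). Then $\Sigma$ is, up to a rotation about the origin, either the equatorial disk $\mathbb{D}$ or the critical catenoid $\mathbb{K}$.
   Context: $\mathbb{B}^3\subset\mathbb{R}^3$ is the unit ball centered at the origin. $\Sigma$ is compact, connected and oriented, with $\partial\Sigma\subset\partial\mathbb{B}^3=\mathbb{S}^2$; free boundary means that $\Sigma$ meets $\mathbb{S}^2$ orthogonally along $\partial\Sigma$. $N$ is a unit normal field on $\Sigma$, $A=-(\overline{\nabla}N)^T$ is the shape operator ($\overline\nabla$ the flat connection of $\mathbb{R}^3$), $x$ is the position vector and $x^T$ its orthogonal projection onto $T\Sigma$. A collar over $\gamma$ is a set $\{p\in\Sigma:\ \mathrm{dist}(p,\gamma)<\varepsilon\}$ for some $\varepsilon>0$, where $\mathrm{dist}$ is the intrinsic distance of $\Sigma$. The equatorial disk $\mathbb{D}$ is the intersection of $\mathbb{B}^3$ with a plane through the origin. The critical catenoid is $\mathbb{K}=\{\frac{1}{t_0\cosh t_0}(\cosh t\cos\theta,\cosh t\sin\theta,t):\ |t|\le t_0,\ \theta\in\mathbb{R}\}$, where $t_0>0$ is the unique positive solution of $t_0\tanh t_0=1$; it is the piece of a catenoid centered at the origin that meets $\mathbb{S}^2$ orthogonally. *)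

theory Defs
  imports "HOL-Analysis.Analysis"
begin

primrec Ck_on ::
  "nat \<Rightarrow> ('a::euclidean_space \<Rightarrow> 'b::real_normed_vector) \<Rightarrow> 'a set \<Rightarrow> bool"
where
  "Ck_on 0 = (\<lambda>f U. continuous_on U f)"
| "Ck_on (Suc k) = (\<lambda>f U. (\<forall>x\<in>U. f differentiable (at x)) \<and>
      (\<forall>v. Ck_on k (\<lambda>x. frechet_derivative f (at x) v) U))"

text \<open>On a set that is not open, smoothness means: locally the restriction of a smooth map
  defined on an open set.\<close>

definition smooth_on ::
  "('a::euclidean_space) set \<Rightarrow> ('a \<Rightarrow> 'b::real_normed_vector) \<Rightarrow> bool"
where
  "smooth_on S f \<longleftrightarrow> (\<forall>p\<in>S. \<exists>W g. open W \<and> p \<in> W \<and>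
      (\<forall>k. Ck_on k g W) \<and> (\<forall>x\<in>S \<inter> W. g x = f x))"

definition half_plane :: "(real^2) set" where
  "half_plane = {u. u $ 2 \<ge> 0}"

text \<open>A local parametrization is defined and smooth on an open subset \<open>U\<close> of the plane, but only its
  restriction to \<open>U \<inter> half_plane\<close> parametrizes the surface. Near an interior point of the surface
  one takes \<open>U\<close> inside the open half plane.\<close>

definition local_param ::
  "(real^3) set \<Rightarrow> (real^2) set \<Rightarrow> (real^2 \<Rightarrow> real^3) \<Rightarrow> bool"
where
  "local_param S U \<phi> \<longleftrightarrow>
     open U \<and> smooth_on U \<phi> \<and>
     (\<forall>u\<in>U. inj (frechet_derivative \<phi> (at u))) \<and>
     openin (top_of_set S) (\<phi> ` (U \<inter> half_plane)) \<and>
     (\<exists>\<psi>. homeomorphism (U \<inter> half_plane) (\<phi> ` (U \<inter> half_plane)) \<phi> \<psi>)"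

definition embedded_surface :: "(real^3) set \<Rightarrow> bool" where
  "embedded_surface S \<longleftrightarrow>
     (\<forall>p\<in>S. \<exists>U \<phi>. local_param S U \<phi> \<and> p \<in> \<phi> ` (U \<inter> half_plane))"

definition surface_boundary :: "(real^3) set \<Rightarrow> (real^3) set" where
  "surface_boundary S =
     {p. \<exists>U \<phi> u. local_param S U \<phi> \<and> u \<in> U \<and> u $ 2 = 0 \<and> \<phi> u = p}"

text \<open>At boundary points this is the full tangent plane, not only a half plane.\<close>

definition tangent_plane :: "(real^3) set \<Rightarrow> real^3 \<Rightarrow> (real^3) set" where
  "tangent_plane S p =
     {v. \<exists>U \<phi> u. local_param S U \<phi> \<and> u \<in> U \<inter> half_plane \<and> \<phi> u = p \<and>
         v \<in> range (frechet_derivative \<phi> (at u))}"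

definition unit_normal_field :: "(real^3) set \<Rightarrow> (real^3 \<Rightarrow> real^3) \<Rightarrow> bool" where
  "unit_normal_field S N \<longleftrightarrow> smooth_on S N \<and>
     (\<forall>p\<in>S. norm (N p) = 1 \<and> (\<forall>v\<in>tangent_plane S p. N p \<bullet> v = 0))"

text \<open>Orthogonal projection onto the plane with unit normal \<open>n\<close>.\<close>

definition tangential :: "real^3 \<Rightarrow> real^3 \<Rightarrow> real^3" where
  "tangential n v = v - (v \<bullet> n) *\<^sub>R n"

text \<open>The derivative of \<open>N\<close> within \<open>S\<close> is determined only on the tangent plane, so
  \<open>shape_operator S N p v\<close> is meaningful only for \<open>v\<close> tangent to \<open>S\<close> at \<open>p\<close>.\<close>

definition shape_operator ::
  "(real^3) set \<Rightarrow> (real^3 \<Rightarrow> real^3) \<Rightarrow> real^3 \<Rightarrow> real^3 \<Rightarrow> real^3"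
where
  "shape_operator S N p v =
     - tangential (N p) (frechet_derivative N (at p within S) v)"

text \<open>The trace of the shape operator on the tangent plane, computed as the trace of its extension
  to the whole space by zero in the normal direction.\<close>

definition mean_curvature ::
  "(real^3) set \<Rightarrow> (real^3 \<Rightarrow> real^3) \<Rightarrow> real^3 \<Rightarrow> real"
where
  "mean_curvature S N p =
     trace (matrix (\<lambda>v. shape_operator S N p (tangential (N p) v)))"

definition minimal_surface :: "(real^3) set \<Rightarrow> (real^3 \<Rightarrow> real^3) \<Rightarrow> bool" where
  "minimal_surface S N \<longleftrightarrow> (\<forall>p\<in>S. mean_curvature S N p = 0)"

text \<open>The unit normal of the sphere at \<open>p\<close> is \<open>p\<close>, so the two surfaces meet orthogonally at \<open>p\<close>
  iff their normals \<open>N p\<close> and \<open>p\<close> are orthogonal.\<close>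

definition free_boundary :: "(real^3) set \<Rightarrow> (real^3 \<Rightarrow> real^3) \<Rightarrow> bool" where
  "free_boundary S N \<longleftrightarrow> S \<subseteq> cball 0 1 \<and> surface_boundary S \<subseteq> sphere 0 1 \<and>
     (\<forall>p\<in>surface_boundary S. orthogonal (N p) p)"

text \<open>Linear dependence of the family \<open>(v, w)\<close>; \<open>dependent {v, w}\<close> would fail to hold for
  \<open>v = w \<noteq> 0\<close>.\<close>

definition linearly_dependent_pair :: "'a::real_vector \<Rightarrow> 'a \<Rightarrow> bool" where
  "linearly_dependent_pair v w \<longleftrightarrow>
     (\<exists>a b. (a \<noteq> 0 \<or> b \<noteq> 0) \<and> a *\<^sub>R v + b *\<^sub>R w = 0)"

definition curve_length :: "(real \<Rightarrow> real^3) \<Rightarrow> real" where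
  "curve_length c = integral {0..1} (\<lambda>t. norm (vector_derivative c (at t)))"

text \<open>The derivative of a \<^const>\<open>valid_path\<close> may be unbounded near the finitely many exceptional
  parameters; integrability of the speed excludes curves of infinite length, for which
  \<open>curve_length\<close> would be \<open>0\<close>.\<close>

definition curve_in :: "(real^3) set \<Rightarrow> real^3 \<Rightarrow> real^3 \<Rightarrow> (real \<Rightarrow> real^3) \<Rightarrow> bool" where
  "curve_in S p q c \<longleftrightarrow> valid_path c \<and>
     (\<lambda>t. norm (vector_derivative c (at t))) integrable_on {0..1} \<and>
     path_image c \<subseteq> S \<and> pathstart c = p \<and> pathfinish c = q"

definition intrinsic_dist :: "(real^3) set \<Rightarrow> real^3 \<Rightarrow> real^3 \<Rightarrow> real" where
  "intrinsic_dist S p q = (INF c\<in>{c. curve_in S p q c}. curve_length c)"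

definition collar :: "(real^3) set \<Rightarrow> (real^3) set \<Rightarrow> real \<Rightarrow> (real^3) set" where
  "collar S \<gamma> \<epsilon> = {p\<in>S. (INF q\<in>\<gamma>. intrinsic_dist S p q) < \<epsilon>}"

definition equatorial_disk :: "(real^3) set" where
  "equatorial_disk = cball 0 1 \<inter> {x. x $ 3 = 0}"

definition t0 :: real where
  "t0 = (THE t. t > 0 \<and> t * tanh t = 1)"

lemma t0_exists_unique: "\<exists>!t::real. t > 0 \<and> t * tanh t = 1"
proof -
  have "exp (-4::real) < 1/3"
    using exp_ge_add_one_self[of "4::real"] by (simp add: exp_minus field_simps)
  then have "tanh (2::real) \<ge> 1/2"
    by (simp add: tanh_real_altdef pos_le_divide_eq add_pos_pos)
  then have "\<exists>t\<ge>0. t \<le> 2 \<and> t * tanh t = (1::real)"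
    by (intro IVT') (auto intro!: continuous_intros)
  then obtain t :: real where t: "t \<ge> 0" "t * tanh t = 1"
    by blast
  have mono: "a * tanh a < b * tanh b" if "0 < a" "a < b" for a b :: real
    using that by (intro mult_strict_mono) auto
  show ?thesis
  proof (rule ex1I[of _ t])
    show "t > 0 \<and> t * tanh t = 1"
      using t by (cases "t = 0") auto
    show "s = t" if "s > 0 \<and> s * tanh s = 1" for s
      using that t mono[of s t] mono[of t s] by (cases "t = 0"; cases s t rule: linorder_cases) auto
  qed
qed

lemma t0: "t0 > 0" "t0 * tanh t0 = 1"
  using theI'[OF t0_exists_unique] unfolding t0_def by blast+

definition critical_catenoid :: "(real^3) set" where
  "critical_catenoid =
     {(1 / (t0 * cosh t0)) *\<^sub>R vector [cosh t * cos \<theta>, cosh t * sin \<theta>, t] | t \<theta>. \<bar>t\<bar> \<le> t0}"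

end

(*
Along the boundary component the position vector x is tangent to the surface and is a principal
direction, say with d N = mu on x and d N = - mu on the tangent of the boundary. Linear dependence of x^T and
A x^T on a collar makes the support function x . N locally a function of |x|, which forces mu to be locally
constant along the boundary; then E = - mu x - N is constant there. If mu = 0, the boundary is locally a great
circle and N = - E on it; otherwise it is a circle about E, and the surface has the Cauchy data of a catenoid with
axis e = E / |E|.

Uniqueness for this Cauchy problem uses no general theory of elliptic equations. Since H = 0, the 1-form
(N x dX) . e is closed, and x . e together with a primitive of it gives a conformal coordinate zeta wherever
(N . e)^2 < 1. With respect to zeta the stereographic Gauss map g is holomorphic, hence so is
Q = g exp (c zeta), and log |Q| = artanh (N . e) + c (x . e). The Cauchy data give d Q = 0 on the boundary arc, so Q
extends by a constant across the arc to a function that is still complex differentiable, and Q is constant near the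
boundary. The maximum modulus principle propagates constancy of |Q| over the whole surface.

If artanh (N . e) + c (x . e) is constant, then d N is determined by N, and the surface lies in a plane (c = 0) or in a
catenoid with axis e. Finally invariance of domain shows that it is a full disk, or the piece of the
catenoid between two free boundary circles; these can only lie symmetrically about the origin.
*)
theory Submission
  imports Defs "HOL-Complex_Analysis.Conformal_Mappings"
begin

section \<open>Calculus of smooth maps\<close>

text \<open>The potential artanh (N . e) + c (x . e) is propagated instead of Q because Q does not
  exist on the whole surface: the primitive in its exponent is only local, whereas the real part of
  zeta is x . e. The potential is modelled on the catenoid of neck radius 1 / |c|, on which N . e =
  - tanh tau for tau = c (x . e) - k. The obstacle that shapes the proof is the boundary. A chart is
  smooth across its straight edge, but beyond the edge it is an arbitrary continuation that
  satisfies no geometric identity. Identities are therefore stated and differentiated on half discs,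
  while inverse functions and open images are taken on full discs. This is why nearly every object
  below lives on a disc and has its geometric meaning only on one half of it.\<close>

lemma Ck_on_cong:
  assumes "open U" "\<And>x. x \<in> U \<Longrightarrow> f x = g x" "Ck_on k f U"
  shows "Ck_on k g U"
  using assms(2,3)
proof (induction k arbitrary: f g)
  case 0
  then show ?case by (simp cong: continuous_on_cong)
next
  case (Suc k)
  have eq: "frechet_derivative f (at x) = frechet_derivative g (at x)" if "x \<in> U" for x
    using Suc.prems assms(1) that by (intro frechet_derivative_transform_within_open[of _ _ U]) auto
  have "g differentiable at x" if "x \<in> U" for x
    using Suc.prems(2) that assms(1) Suc.prems(1)
    by (metis Ck_on.simps(2) differentiable_def has_derivative_transform_within_open)
  moreover have "Ck_on k (\<lambda>x. frechet_derivative g (at x) v) U" for v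
    by (rule Suc.IH[of "\<lambda>x. frechet_derivative f (at x) v"]) (use eq Suc.prems(2) in auto)
  ultimately show ?case by simp
qed

lemma Ck_on_subset: "Ck_on k f U \<Longrightarrow> V \<subseteq> U \<Longrightarrow> Ck_on k f V"
  by (induction k arbitrary: f) (auto intro: continuous_on_subset)

lemma Ck_on_Suc_imp: "Ck_on (Suc k) f U \<Longrightarrow> Ck_on k f U"
proof (induction k arbitrary: f)
  case 0
  then show ?case
    by (auto intro!: continuous_at_imp_continuous_on differentiable_imp_continuous_within)
qed simp

lemma Ck_on_Suc_I:
  assumes "open U" "\<And>x. x \<in> U \<Longrightarrow> (f has_derivative f' x) (at x)"
    and "\<And>v. Ck_on k (\<lambda>x. f' x v) U"
  shows "Ck_on (Suc k) f U"
proof -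
  have "frechet_derivative f (at x) = f' x" if "x \<in> U" for x
    using assms(2)[OF that] by (metis frechet_derivative_at)
  then have "Ck_on k (\<lambda>x. frechet_derivative f (at x) v) U" for v
    by (intro Ck_on_cong[OF assms(1) _ assms(3)[of v]]) simp
  with assms(2) show ?thesis by (auto simp: differentiable_def)
qed

lemma Ck_on_Suc_D:
  assumes "Ck_on (Suc k) f U" "x \<in> U"
  shows "(f has_derivative frechet_derivative f (at x)) (at x)"
  using assms by (simp add: frechet_derivative_works)

lemma Ck_on_bounded_linear:
  assumes "open U" "bounded_linear h" "Ck_on k f U"
  shows "Ck_on k (\<lambda>x. h (f x)) U"
  using assms(3)
proof (induction k arbitrary: f)
  case 0
  then show ?case using assms(2) by (auto intro: bounded_linear.continuous_on)
next
  case (Suc k)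
  show ?case
  proof (rule Ck_on_Suc_I[OF assms(1)])
    show "((\<lambda>x. h (f x)) has_derivative (\<lambda>v. h (frechet_derivative f (at x) v))) (at x)"
      if "x \<in> U" for x
      using bounded_linear.has_derivative[OF assms(2) Ck_on_Suc_D[OF Suc.prems that]] .
    show "Ck_on k (\<lambda>x. h (frechet_derivative f (at x) v)) U" for v
      using Suc.prems by (intro Suc.IH) auto
  qed
qed

lemma Ck_on_const [simp]:
  assumes "open U" shows "Ck_on k (\<lambda>x. c) U"
proof (induction k arbitrary: c)
  case (Suc k)
  show ?case
    by (rule Ck_on_Suc_I[OF assms, where f' = "\<lambda>x v. 0"]) (use Suc in auto)
qed simp

lemma Ck_on_add:
  assumes "open U" "Ck_on k f U" "Ck_on k g U"
  shows "Ck_on k (\<lambda>x. f x + g x) U"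
  using assms(2,3)
proof (induction k arbitrary: f g)
  case (Suc k)
  show ?case
    by (rule Ck_on_Suc_I[OF assms(1) has_derivative_add[OF Ck_on_Suc_D[OF Suc.prems(1)]
        Ck_on_Suc_D[OF Suc.prems(2)]]]) (use Suc in auto)
qed (auto intro: continuous_on_add)

lemma Ck_on_sum:
  assumes "open U" "finite I" "\<And>i. i \<in> I \<Longrightarrow> Ck_on k (f i) U"
  shows "Ck_on k (\<lambda>x. \<Sum>i\<in>I. f i x) U"
  using assms(2,3)
  by (induction I rule: finite_induct) (auto intro: Ck_on_add assms(1) simp: Ck_on_const[OF assms(1)])

lemma Ck_on_scaleR:
  fixes f :: "'a::euclidean_space \<Rightarrow> real"
  assumes "open U" "Ck_on k f U" "Ck_on k g U"
  shows "Ck_on k (\<lambda>x. f x *\<^sub>R g x) U"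
  using assms(2,3)
proof (induction k arbitrary: f g)
  case (Suc k)
  show ?case
  proof (rule Ck_on_Suc_I[OF assms(1) has_derivative_scaleR[OF Ck_on_Suc_D[OF Suc.prems(1)]
        Ck_on_Suc_D[OF Suc.prems(2)]]])
    show "Ck_on k (\<lambda>x. f x *\<^sub>R frechet_derivative g (at x) v + frechet_derivative f (at x) v *\<^sub>R g x) U" for v
      by (intro Ck_on_add Suc.IH assms(1) Ck_on_Suc_imp[OF Suc.prems(1)] Ck_on_Suc_imp[OF Suc.prems(2)])
        (use Suc.prems in auto)
  qed auto
qed (auto intro: continuous_on_scaleR)

text \<open>\<open>Ck_on\<close> speaks of derivatives in a fixed direction, whereas in the chain
  rule the derivative of \<open>g\<close> is applied to a vector that moves with the point.
  Expanding that vector in the basis leaves sums of products to which the induction hypothesis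
  applies.\<close>

lemma Ck_on_compose:
  fixes g :: "'b::euclidean_space \<Rightarrow> 'c::real_normed_vector"
  assumes "open U" "open W" "f ` U \<subseteq> W" "Ck_on k f U" "Ck_on k g W"
  shows "Ck_on k (\<lambda>x. g (f x)) U"
  using assms(4,5)
proof (induction k arbitrary: g)
  case 0
  then show ?case using assms(3) by (auto intro: continuous_on_compose2)
next
  case (Suc k)
  define f' where "f' x = frechet_derivative f (at x)" for x
  define g' where "g' x = frechet_derivative g (at x)" for x
  have f': "(f has_derivative f' x) (at x)" if "x \<in> U" for x
    unfolding f'_def using Ck_on_Suc_D[OF Suc.prems(1) that] .
  have g': "(g has_derivative g' (f x)) (at (f x))" if "x \<in> U" for x
    unfolding g'_def using Ck_on_Suc_D[OF Suc.prems(2)] assms(3) that by auto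
  show ?case
  proof (rule Ck_on_Suc_I[OF assms(1)])
    fix x assume x: "x \<in> U"
    have "((\<lambda>x. g (f x)) has_derivative (\<lambda>v. g' (f x) (f' x v))) (at x)"
      using diff_chain_at[OF f'[OF x] g'[OF x]] by (simp add: o_def)
    moreover have "(\<lambda>v. g' (f x) (f' x v)) = (\<lambda>v. \<Sum>i\<in>Basis. (f' x v \<bullet> i) *\<^sub>R g' (f x) i)"
    proof
      fix v
      have lin: "linear (g' (f x))" using g'[OF x] by (rule has_derivative_linear)
      have "g' (f x) (f' x v) = g' (f x) (\<Sum>i\<in>Basis. (f' x v \<bullet> i) *\<^sub>R i)"
        by (simp add: euclidean_representation)
      then show "g' (f x) (f' x v) = (\<Sum>i\<in>Basis. (f' x v \<bullet> i) *\<^sub>R g' (f x) i)"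
        using lin by (simp add: linear_sum linear_cmul)
    qed
    ultimately show "((\<lambda>x. g (f x)) has_derivative (\<lambda>v. \<Sum>i\<in>Basis. (f' x v \<bullet> i) *\<^sub>R g' (f x) i)) (at x)"
      by simp
  next
    fix v
    have "Ck_on k (\<lambda>x. f' x v \<bullet> i) U" for i
      unfolding f'_def using Suc.prems(1) by (intro Ck_on_bounded_linear[OF assms(1) bounded_linear_inner_left]) auto
    moreover have "Ck_on k (\<lambda>x. g' (f x) i) U" for i
      using Suc.prems by (intro Suc.IH Ck_on_Suc_imp[OF Suc.prems(1)]) (auto simp: g'_def)
    ultimately show "Ck_on k (\<lambda>x. \<Sum>i\<in>Basis. (f' x v \<bullet> i) *\<^sub>R g' (f x) i) U"
      by (intro Ck_on_sum Ck_on_scaleR assms(1)) auto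
  qed
qed

section \<open>Symmetry of second derivatives\<close>

lemma second_difference_mean_value:
  fixes g :: "'a::real_normed_vector \<Rightarrow> real"
  assumes g': "\<And>x. x \<in> ball u d \<Longrightarrow> (g has_derivative g' x) (at x)"
    and g'': "\<And>x v. x \<in> ball u d \<Longrightarrow> ((\<lambda>x. g' x v) has_derivative g'' x v) (at x)"
    and h: "h > 0" "h * (norm v + norm w) < d"
  shows "\<exists>p\<in>ball u d. g (u + h *\<^sub>R v + h *\<^sub>R w) - g (u + h *\<^sub>R v) - g (u + h *\<^sub>R w) + g u = h\<^sup>2 * g'' p v w"
proof -
  have inb: "u + s *\<^sub>R v + t *\<^sub>R w \<in> ball u d" if "0 \<le> s" "s \<le> h" "0 \<le> t" "t \<le> h" for s t
  proof -
    have "norm (s *\<^sub>R v + t *\<^sub>R w) \<le> s * norm v + t * norm w"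
      using that by (metis abs_of_nonneg norm_scaleR norm_triangle_ineq)
    also have "\<dots> \<le> h * norm v + h * norm w"
      using that by (intro add_mono mult_right_mono) auto
    also have "\<dots> < d" using h by (simp add: distrib_left)
    finally have "norm (- (s *\<^sub>R v + t *\<^sub>R w)) < d" by (simp only: norm_minus_cancel)
    moreover have "- (s *\<^sub>R v + t *\<^sub>R w) = u - (u + s *\<^sub>R v + t *\<^sub>R w)" by simp
    ultimately show ?thesis by (simp only: mem_ball dist_norm)
  qed
  \<comment> \<open>The double difference is \<open>k h - k 0\<close>. The mean value theorem is
    used for \<open>k\<close> along \<open>v\<close>, then for \<open>g'\<close> along
    \<open>w\<close>.\<close>
  define k where "k s = g (u + s *\<^sub>R v + h *\<^sub>R w) - g (u + s *\<^sub>R v)" for s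
  have "\<exists>\<xi>. 0 < \<xi> \<and> \<xi> < h \<and> k h - k 0 = (h - 0) *
      (g' (u + \<xi> *\<^sub>R v + h *\<^sub>R w) v - g' (u + \<xi> *\<^sub>R v) v)"
  proof (rule MVT2[OF h(1)])
    fix s assume s: "0 \<le> s" "s \<le> h"
    have "((\<lambda>s. g (u + s *\<^sub>R v + h *\<^sub>R w)) has_derivative (\<lambda>x. g' (u + s *\<^sub>R v + h *\<^sub>R w) (x *\<^sub>R v))) (at s)"
      using inb[OF s, of h] h(1)
      by (intro has_derivative_compose[OF _ g']) (auto intro!: derivative_eq_intros)
    moreover have "((\<lambda>s. g (u + s *\<^sub>R v)) has_derivative (\<lambda>x. g' (u + s *\<^sub>R v) (x *\<^sub>R v))) (at s)"
      using inb[OF s, of 0] h(1)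
      by (intro has_derivative_compose[OF _ g']) (auto intro!: derivative_eq_intros)
    ultimately have "(k has_derivative (\<lambda>x. g' (u + s *\<^sub>R v + h *\<^sub>R w) (x *\<^sub>R v) - g' (u + s *\<^sub>R v) (x *\<^sub>R v))) (at s)"
      unfolding k_def by (rule has_derivative_diff)
    moreover have "g' y (x *\<^sub>R v) = x * g' y v" if "y \<in> ball u d" for x y
      using linear_cmul[OF has_derivative_linear[OF g'[OF that]]] by simp
    ultimately have "(k has_derivative (\<lambda>x. x * g' (u + s *\<^sub>R v + h *\<^sub>R w) v - x * g' (u + s *\<^sub>R v) v)) (at s)"
      using inb[OF s, of h] inb[OF s, of 0] h(1) by simp
    then show "(k has_real_derivative g' (u + s *\<^sub>R v + h *\<^sub>R w) v - g' (u + s *\<^sub>R v) v) (at s)"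
      unfolding has_field_derivative_def
      by (rule has_derivative_eq_rhs) (auto simp: algebra_simps)
  qed
  then obtain \<xi> where \<xi>: "0 < \<xi>" "\<xi> < h"
    "k h - k 0 = h * (g' (u + \<xi> *\<^sub>R v + h *\<^sub>R w) v - g' (u + \<xi> *\<^sub>R v) v)" by auto
  have "\<exists>\<eta>. 0 < \<eta> \<and> \<eta> < h \<and> g' (u + \<xi> *\<^sub>R v + h *\<^sub>R w) v - g' (u + \<xi> *\<^sub>R v + 0 *\<^sub>R w) v
     = (h - 0) * g'' (u + \<xi> *\<^sub>R v + \<eta> *\<^sub>R w) v w"
  proof (rule MVT2[OF h(1)])
    fix t assume t: "0 \<le> t" "t \<le> h"
    have i: "u + \<xi> *\<^sub>R v + t *\<^sub>R w \<in> ball u d" using inb t \<xi> by auto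
    have "((\<lambda>t. g' (u + \<xi> *\<^sub>R v + t *\<^sub>R w) v) has_derivative (\<lambda>x. g'' (u + \<xi> *\<^sub>R v + t *\<^sub>R w) v (x *\<^sub>R w))) (at t)"
      using i by (intro has_derivative_compose[OF _ g'']) (auto intro!: derivative_eq_intros)
    then show "((\<lambda>t. g' (u + \<xi> *\<^sub>R v + t *\<^sub>R w) v) has_real_derivative g'' (u + \<xi> *\<^sub>R v + t *\<^sub>R w) v w) (at t)"
      using linear_cmul[OF has_derivative_linear[OF g''[OF i]]]
      by (simp add: has_field_derivative_def mult.commute[of _ "g'' _ _ _"])
  qed
  then obtain \<eta> where \<eta>: "0 < \<eta>" "\<eta> < h"
    "g' (u + \<xi> *\<^sub>R v + h *\<^sub>R w) v - g' (u + \<xi> *\<^sub>R v) v = h * g'' (u + \<xi> *\<^sub>R v + \<eta> *\<^sub>R w) v w" by auto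
  show ?thesis
  proof (rule bexI)
    show "u + \<xi> *\<^sub>R v + \<eta> *\<^sub>R w \<in> ball u d" using inb \<xi> \<eta> by simp
    show "g (u + h *\<^sub>R v + h *\<^sub>R w) - g (u + h *\<^sub>R v) - g (u + h *\<^sub>R w) + g u
        = h\<^sup>2 * g'' (u + \<xi> *\<^sub>R v + \<eta> *\<^sub>R w) v w"
      using \<xi>(3) \<eta>(3) by (simp add: k_def power2_eq_square)
  qed
qed

text \<open>The double difference over a small parallelogram does not depend on the order of
  \<open>v\<close> and \<open>w\<close>, yet equals \<open>h\<^sup>2\<close> times either mixed
  derivative at some nearby point. If the two values at \<open>u\<close> differed, continuity would
  keep them apart nearby.\<close>

lemma symmetric_second_derivative_real:
  fixes g :: "'a::real_normed_vector \<Rightarrow> real"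
  assumes "open U" "u \<in> U"
    and g': "\<And>x. x \<in> U \<Longrightarrow> (g has_derivative g' x) (at x)"
    and g'': "\<And>x v. x \<in> U \<Longrightarrow> ((\<lambda>x. g' x v) has_derivative g'' x v) (at x)"
    and cont: "\<And>v w. continuous_on U (\<lambda>x. g'' x v w)"
  shows "g'' u v w = g'' u w v"
proof (rule ccontr)
  assume ne: "g'' u v w \<noteq> g'' u w v"
  define e where "e = \<bar>g'' u v w - g'' u w v\<bar> / 2"
  have e: "e > 0" using ne by (simp add: e_def)
  have "\<exists>d>0. \<forall>x. dist x u < d \<longrightarrow> dist (g'' x v w) (g'' u v w) < e" for v w
  proof -
    have "isCont (\<lambda>x. g'' x v w) u"
      using cont[of v w] assms(1,2) by (simp add: continuous_on_eq_continuous_at)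
    then show ?thesis using e by (simp add: continuous_at_eps_delta)
  qed
  then obtain d1 d2 where d: "d1 > 0" "d2 > 0"
    "\<And>x. dist x u < d1 \<Longrightarrow> dist (g'' x v w) (g'' u v w) < e"
    "\<And>x. dist x u < d2 \<Longrightarrow> dist (g'' x w v) (g'' u w v) < e" by metis
  obtain d3 where d3: "d3 > 0" "ball u d3 \<subseteq> U" using assms(1,2) open_contains_ball by blast
  define d where "d = min d1 (min d2 d3)"
  have dpos: "d > 0" and sub: "ball u d \<subseteq> U" using d d3 by (auto simp: d_def)
  define h where "h = d / (2 * (norm v + norm w + 1))"
  have npos: "0 \<le> norm v" "0 \<le> norm w" by auto
  then have pos: "0 < norm v + norm w + 1" by linarith
  have h: "h > 0" using dpos pos by (simp add: h_def)
  have "norm v + norm w < 2 * (norm v + norm w + 1)" using pos by (simp add: field_simps)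
  then have "h * (norm v + norm w) < h * (2 * (norm v + norm w + 1))"
    using h by (intro mult_strict_left_mono)
  also have "\<dots> = d" unfolding h_def using pos by simp
  finally have hd: "h * (norm v + norm w) < d" .
  have hd': "h * (norm w + norm v) < d" using hd by (simp add: add.commute)
  obtain p where p: "p \<in> ball u d"
    "g (u + h *\<^sub>R v + h *\<^sub>R w) - g (u + h *\<^sub>R v) - g (u + h *\<^sub>R w) + g u = h\<^sup>2 * g'' p v w"
    using second_difference_mean_value[of u d g g' g'' h v w] g' g'' sub h hd by blast
  obtain q where q: "q \<in> ball u d"
    "g (u + h *\<^sub>R w + h *\<^sub>R v) - g (u + h *\<^sub>R w) - g (u + h *\<^sub>R v) + g u = h\<^sup>2 * g'' q w v"
    using second_difference_mean_value[of u d g g' g'' h w v] g' g'' sub h hd' by blast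
  have "h\<^sup>2 * g'' p v w = h\<^sup>2 * g'' q w v"
  proof -
    have "g (u + h *\<^sub>R w + h *\<^sub>R v) = g (u + h *\<^sub>R v + h *\<^sub>R w)"
      by (simp add: add.assoc add.commute[of "h *\<^sub>R v"])
    then show ?thesis using p(2) q(2) by linarith
  qed
  then have "g'' p v w = g'' q w v" using h by simp
  moreover have "\<bar>g'' p v w - g'' u v w\<bar> < e" "\<bar>g'' q w v - g'' u w v\<bar> < e"
    using d(3)[of p] d(4)[of q] p(1) q(1) by (auto simp: d_def dist_commute dist_real_def)
  ultimately show False unfolding e_def by (simp add: abs_if split: if_splits)
qed

lemma symmetric_second_derivative:
  fixes f :: "'a::real_normed_vector \<Rightarrow> 'b::euclidean_space"
  assumes "open U" "u \<in> U"
    and f': "\<And>x. x \<in> U \<Longrightarrow> (f has_derivative f' x) (at x)"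
    and f'': "\<And>x v. x \<in> U \<Longrightarrow> ((\<lambda>x. f' x v) has_derivative f'' x v) (at x)"
    and cont: "\<And>v w. continuous_on U (\<lambda>x. f'' x v w)"
  shows "f'' u v w = f'' u w v"
proof (rule euclidean_eqI)
  fix b :: 'b assume "b \<in> Basis"
  show "f'' u v w \<bullet> b = f'' u w v \<bullet> b"
    by (rule symmetric_second_derivative_real[OF assms(1,2), where g = "\<lambda>x. f x \<bullet> b" and g' = "\<lambda>x v. f' x v \<bullet> b"])
       (auto intro!: has_derivative_inner_left f' f'' continuous_intros cont)
qed

text \<open>Poincare lemma for a form that is C1 on the disc but closed only on the star-shaped
  subset \<open>D\<close>. Integration along segments from \<open>u0\<close> gives a C1 function on
  all of \<open>B\<close>; its differential is \<open>\<omega>\<close> at points whose segment stays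
  in \<open>D\<close>.\<close>

lemma radial_primitive:
  fixes u0 :: "'a::euclidean_space" and \<omega> :: "'a \<Rightarrow> 'a \<Rightarrow> real"
  assumes B: "B = ball u0 r"
    and lin: "\<And>u. u \<in> B \<Longrightarrow> linear (\<omega> u)"
    and der: "\<And>u v. u \<in> B \<Longrightarrow> ((\<lambda>u. \<omega> u v) has_derivative \<omega>' u v) (at u)"
    and cont: "\<And>v w. continuous_on B (\<lambda>u. \<omega>' u v w)"
    and D: "D \<subseteq> B" "\<And>u t. u \<in> D \<Longrightarrow> 0 \<le> t \<Longrightarrow> t \<le> 1 \<Longrightarrow> u0 + t *\<^sub>R (u - u0) \<in> D"
    and closed: "\<And>u v w. u \<in> D \<Longrightarrow> \<omega>' u v w = \<omega>' u w v"
  obtains P P' where "\<And>u. u \<in> B \<Longrightarrow> (P has_derivative P' u) (at u)"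
    "\<And>v. continuous_on B (\<lambda>u. P' u v)" "\<And>u v. u \<in> D \<Longrightarrow> P' u v = \<omega> u v"
proof -
  define c where "c u t = u0 + t *\<^sub>R (u - u0)" for u and t :: real
  have cB: "c u t \<in> B" if "u \<in> B" "t \<in> cbox 0 1" for u t
  proof -
    have "t * norm (u - u0) \<le> 1 * norm (u - u0)"
      using that by (intro mult_right_mono) auto
    then show ?thesis using that
      unfolding B c_def by (auto simp: dist_norm norm_minus_commute)
  qed
  have c_cont: "continuous_on (B \<times> cbox 0 1) (\<lambda>(u, t). c u t)"
    by (auto simp: c_def split_beta intro!: continuous_intros)
  have \<omega>_cont: "continuous_on B (\<lambda>u. \<omega> u v)" for v
    using der by (auto intro!: continuous_at_imp_continuous_on has_derivative_continuous)
  have \<omega>c_cont: "continuous_on (B \<times> cbox 0 1) (\<lambda>p. \<omega> (c (fst p) (snd p)) v)" for v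
    using c_cont cB by (intro continuous_on_compose2[OF \<omega>_cont]) (auto simp: split_beta)
  have \<omega>'c_cont: "continuous_on (B \<times> cbox 0 1) (\<lambda>p. \<omega>' (c (fst p) (snd p)) v w)" for v w
    using c_cont cB by (intro continuous_on_compose2[OF cont]) (auto simp: split_beta)
  \<comment> \<open>\<open>k u\<close> is the form pulled back to the segment from \<open>u0\<close>
    to \<open>u\<close>; \<open>k'\<close> is its derivative in the end point.\<close>
  define k where "k u t = (\<Sum>i\<in>Basis. ((u - u0) \<bullet> i) * \<omega> (c u t) i)" for u t
  define k' where "k' u t w = (\<Sum>i\<in>Basis. (w \<bullet> i) * \<omega> (c u t) i + ((u - u0) \<bullet> i) * (t * \<omega>' (c u t) i w))" for u t w
  have k'_der: "((\<lambda>u. k u t) has_derivative k' u t) (at u)" if "u \<in> B" "t \<in> cbox 0 1" for u t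
  proof -
    have "((\<lambda>u. \<omega> (c u t) i) has_derivative (\<lambda>w. \<omega>' (c u t) i (t *\<^sub>R w))) (at u)" for i
      by (rule has_derivative_compose[of "\<lambda>u. c u t" _ u UNIV "\<lambda>u. \<omega> u i", OF _ der[OF cB[OF that]]])
         (auto simp: c_def intro!: derivative_eq_intros)
    moreover have "(\<lambda>w. \<omega>' (c u t) i (t *\<^sub>R w)) = (\<lambda>w. t * \<omega>' (c u t) i w)" for i
      using linear_cmul[OF has_derivative_linear[OF der[OF cB[OF that]]]] by auto
    ultimately have *: "((\<lambda>u. \<omega> (c u t) i) has_derivative (\<lambda>w. t * \<omega>' (c u t) i w)) (at u)" for i
      by simp
    have "((\<lambda>u. ((u - u0) \<bullet> i)) has_derivative (\<lambda>w. w \<bullet> i)) (at u)" for i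
      by (auto intro!: derivative_eq_intros)
    from has_derivative_mult[OF this *] show ?thesis
      unfolding k_def k'_def
      by (intro has_derivative_sum) (simp add: add.commute)
  qed
  have bl: "bounded_linear (k' u t)" if "u \<in> B" "t \<in> cbox 0 1" for u t
    using k'_der[OF that] by (rule has_derivative_bounded_linear)
  \<comment> \<open>\<open>leibniz_rule\<close> asks for the derivative as a bounded linear function
    that depends continuously on both variables; continuity is checked on basis vectors.\<close>
  define K where "K u t = Blinfun (k' u t)" for u t
  have K: "blinfun_apply (K u t) = k' u t" if "u \<in> B" "t \<in> cbox 0 1" for u t
    unfolding K_def using bl[OF that] by (rule bounded_linear_Blinfun_apply)
  have k'_cont: "continuous_on (B \<times> cbox 0 1) (\<lambda>p. k' (fst p) (snd p) w)" for w
    unfolding k'_def by (intro continuous_intros \<omega>c_cont \<omega>'c_cont)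
  have K_cont: "continuous_on (B \<times> cbox 0 1) (\<lambda>(u, t). K u t)"
  proof (rule continuous_on_blinfun_componentwise)
    fix i :: 'a
    show "continuous_on (B \<times> cbox 0 1) (\<lambda>p. blinfun_apply (case p of (u, t) \<Rightarrow> K u t) i)"
      using k'_cont[of i] by (rule continuous_on_eq) (auto simp: K)
  qed
  have k_cont: "continuous_on (cbox 0 1) (k u)" if "u \<in> B" for u
  proof -
    have "continuous_on (cbox 0 1) (\<lambda>t. \<omega> (c u t) v)" for v
      using that by (intro continuous_on_compose2[OF \<omega>c_cont, of _ "\<lambda>t. (u, t)", simplified]) (auto intro!: continuous_intros)
    then show ?thesis unfolding k_def by (intro continuous_intros)
  qed
  define P where "P u = integral (cbox 0 1) (k u)" for u
  define P' where "P' u w = integral (cbox 0 1) (\<lambda>t. k' u t w)" for u w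
  have oB: "open B" "convex B" by (auto simp: B)
  have Kint: "K u integrable_on cbox 0 1" if "u \<in> B" for u
    using that by (intro integrable_continuous continuous_on_compose2[OF K_cont, of _ "\<lambda>t. (u, t)", simplified])
      (auto intro!: continuous_intros)
  have P'eq: "blinfun_apply (integral (cbox 0 1) (K u)) w = P' u w" if "u \<in> B" for u w
    unfolding P'_def using Kint[OF that] K[OF that]
    by (subst blinfun_apply_integral) (auto intro!: integral_cong)
  show ?thesis
  proof
    fix u assume u: "u \<in> B"
    have "((\<lambda>u. integral (cbox 0 1) (k u)) has_derivative blinfun_apply (integral (cbox 0 1) (K u))) (at u within B)"
    proof (rule leibniz_rule[OF _ _ K_cont u oB(2)])
      show "((\<lambda>x. k x t) has_derivative blinfun_apply (K x t)) (at x within B)"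
        if "x \<in> B" "t \<in> cbox 0 1" for x t
        using k'_der[OF that] K[OF that] by (simp add: has_derivative_at_withinI)
      show "k x integrable_on cbox 0 1" if "x \<in> B" for x
        using k_cont[OF that] by (rule integrable_continuous)
    qed
    moreover have "blinfun_apply (integral (cbox 0 1) (K u)) = P' u" using P'eq[OF u] by (rule ext)
    ultimately show "(P has_derivative P' u) (at u)"
      using oB u unfolding P_def[abs_def] by (simp add: at_within_open[of u B])
  next
    fix v
    show "continuous_on B (\<lambda>u. P' u v)"
      unfolding P'_def
      by (rule integral_continuous_on_param) (use k'_cont in \<open>simp add: split_beta\<close>)
  next
    fix u v assume u: "u \<in> D"
    have uB: "u \<in> B" using u D by auto
    \<comment> \<open>On \<open>D\<close> closedness turns the integrand into the derivative of
      \<open>t * \<omega> (c u t) v\<close> in \<open>t\<close>, so the integral is the value at t =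
      1.\<close>
    have "((\<lambda>t. k' u t v) has_integral (1 *\<^sub>R \<omega> (c u 1) v - 0 *\<^sub>R \<omega> (c u 0) v)) {0..1}"
    proof (rule fundamental_theorem_of_calculus)
      fix t :: real assume t: "t \<in> {0..1}"
      then have t': "t \<in> cbox 0 1" by simp
      have cD: "c u t \<in> D" using D(2)[OF u] t by (simp add: c_def)
      have lin': "linear (\<omega>' (c u t) v)" using has_derivative_linear[OF der[OF cB[OF uB t']]] .
      have "((\<lambda>t. \<omega> (c u t) v) has_derivative (\<lambda>h. \<omega>' (c u t) v (h *\<^sub>R (u - u0)))) (at t)"
        by (rule has_derivative_compose[of "\<lambda>t. c u t" _ t UNIV "\<lambda>u. \<omega> u v", OF _ der[OF cB[OF uB t']]])
           (auto simp: c_def intro!: derivative_eq_intros)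
      then have *: "((\<lambda>t. \<omega> (c u t) v) has_real_derivative \<omega>' (c u t) v (u - u0)) (at t)"
        using linear_cmul[OF lin'] by (simp add: has_field_derivative_def mult.commute[of _ "\<omega>' _ _ _"])
      have "((\<lambda>t. t * \<omega> (c u t) v) has_real_derivative \<omega> (c u t) v + t * \<omega>' (c u t) v (u - u0)) (at t)"
        by (auto intro!: derivative_eq_intros *)
      moreover have "k' u t v = \<omega> (c u t) v + t * \<omega>' (c u t) v (u - u0)"
      proof -
        have l: "linear (\<omega> (c u t))" using lin cB[OF uB t'] by simp
        have "\<omega> (c u t) v = \<omega> (c u t) (\<Sum>i\<in>Basis. (v \<bullet> i) *\<^sub>R i)" by (simp add: euclidean_representation)
        also have "\<dots> = (\<Sum>i\<in>Basis. (v \<bullet> i) * \<omega> (c u t) i)"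
          using l by (simp add: linear_sum linear_cmul)
        finally have 1: "\<omega> (c u t) v = (\<Sum>i\<in>Basis. (v \<bullet> i) * \<omega> (c u t) i)" .
        have "\<omega>' (c u t) v (u - u0) = \<omega>' (c u t) v (\<Sum>i\<in>Basis. ((u - u0) \<bullet> i) *\<^sub>R i)"
          by (simp add: euclidean_representation)
        also have "\<dots> = (\<Sum>i\<in>Basis. ((u - u0) \<bullet> i) * \<omega>' (c u t) v i)"
          using lin' by (simp add: linear_sum linear_cmul)
        also have "\<dots> = (\<Sum>i\<in>Basis. ((u - u0) \<bullet> i) * \<omega>' (c u t) i v)"
          using closed[OF cD] by simp
        finally have 2: "\<omega>' (c u t) v (u - u0) = (\<Sum>i\<in>Basis. ((u - u0) \<bullet> i) * \<omega>' (c u t) i v)" .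
        show ?thesis unfolding k'_def 1 2
          by (simp add: sum.distrib sum_distrib_left mult.left_commute)
      qed
      ultimately show "((\<lambda>t. t *\<^sub>R \<omega> (c u t) v) has_vector_derivative k' u t v) (at t within {0..1})"
        by (simp add: has_real_derivative_iff_has_vector_derivative[symmetric] has_field_derivative_at_within)
    qed auto
    then show "P' u v = \<omega> u v"
      by (simp add: P'_def c_def integral_unique)
  qed
qed

section \<open>Trace-free symmetric maps and stereographic projection\<close>

unbundle cross3_syntax

lemma cross3_cramer:
  fixes a b c w :: "real^3"
  shows "(a \<bullet> (b \<times> c)) *\<^sub>R w = (w \<bullet> (b \<times> c)) *\<^sub>R a + (w \<bullet> (c \<times> a)) *\<^sub>R b + (w \<bullet> (a \<times> b)) *\<^sub>R c"
  by (simp add: vec_eq_iff forall_3 cross3_simps)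

text \<open>The trace is the derivative of the determinant: \<open>L\<close> acts as a derivation on
  the triple product.\<close>

lemma trace_cross3:
  fixes L :: "real^3 \<Rightarrow> real^3"
  assumes "linear L"
  shows "trace (matrix L) * ((x \<times> y) \<bullet> z) = (L x \<times> y) \<bullet> z + (x \<times> L y) \<bullet> z + (x \<times> y) \<bullet> L z"
proof -
  define A where "A = matrix L"
  have "L v = A *v v" for v using assms by (simp add: A_def)
  moreover have "trace A * ((x \<times> y) \<bullet> z) = ((A *v x) \<times> y) \<bullet> z + (x \<times> (A *v y)) \<bullet> z + (x \<times> y) \<bullet> (A *v z)"
    by (simp add: trace_def matrix_vector_mult_def cross3_simps)
  ultimately show ?thesis by (simp add: A_def)
qed

text \<open>With \<open>n\<close> as third vector in the trace formula, a trace-free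
  \<open>L\<close> that kills \<open>n\<close> is skew for the area form of the plane orthogonal to
  \<open>n\<close>. Symmetry turns this into anticommutation with the quarter turn
  \<open>n \<times> _\<close>.\<close>

lemma traceless_symmetric_anticommutes:
  fixes L :: "real^3 \<Rightarrow> real^3"
  assumes "linear L" "trace (matrix L) = 0" "L n = 0" and sym: "\<And>x y. L x \<bullet> y = x \<bullet> L y"
  shows "L (n \<times> w) = - (n \<times> L w)"
proof -
  have "y \<bullet> (n \<times> L w + L (n \<times> w)) = 0" for y
  proof -
    have "y \<bullet> (n \<times> L w) = (L w \<times> y) \<bullet> n" by (simp add: cross3_simps)
    moreover have "y \<bullet> L (n \<times> w) = (w \<times> L y) \<bullet> n"
      using sym[of y "n \<times> w"] by (simp add: cross3_simps)
    ultimately show ?thesis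
      using trace_cross3[OF assms(1), of w y n] assms(2,3) by (simp add: inner_add_right)
  qed
  then have "n \<times> L w + L (n \<times> w) = 0" by (metis inner_eq_zero_iff)
  then show ?thesis by (simp add: eq_neg_iff_add_eq_0 add.commute)
qed

text \<open>\<open>tangential n e\<close> and \<open>n \<times> e\<close> are orthogonal, both of
  squared length \<open>1 - (n \<bullet> e)\<^sup>2\<close>. Leaving that factor on the left keeps
  the formula valid where n is e or -e.\<close>

lemma tangent_expansion:
  fixes n e w :: "real^3"
  assumes "norm n = 1" "norm e = 1" "w \<bullet> n = 0"
  shows "(1 - (n \<bullet> e)\<^sup>2) *\<^sub>R w = (w \<bullet> e) *\<^sub>R tangential n e + (w \<bullet> (n \<times> e)) *\<^sub>R (n \<times> e)"
proof -
  have 1: "n \<bullet> n = 1" "e \<bullet> e = 1" using assms by (simp_all add: dot_square_norm)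
  have 2: "e \<times> (n \<times> e) = n - (n \<bullet> e) *\<^sub>R e" "(n \<times> e) \<times> n = e - (n \<bullet> e) *\<^sub>R n"
    using 1 by (simp_all add: Lagrange cross_skew[of "n \<times> e"] inner_commute)
  show ?thesis
    using cross3_cramer[of n e "n \<times> e" w] assms(3) 1
    unfolding 2 by (simp add: tangential_def inner_diff_right inner_commute power2_eq_square
        scaleR_diff_right algebra_simps)
qed

lemma cross_tangential: "norm n = 1 \<Longrightarrow> n \<times> tangential n e = n \<times> e"
  by (simp add: tangential_def Cross3.right_diff_distrib cross_mult_right)

lemma tangential_inner_self:
  assumes "norm n = 1" "norm e = 1"
  shows "tangential n e \<bullet> e = 1 - (n \<bullet> e)\<^sup>2" "tangential n e \<bullet> n = 0"
  using assms by (simp_all add: tangential_def inner_diff_left dot_square_norm inner_commute[of e n] power2_eq_square)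

lemma tangential_eq: "w \<bullet> n = 0 \<Longrightarrow> tangential n w = w"
  by (simp add: tangential_def)

text \<open>The complex-linear coordinate on the plane orthogonal to \<open>n\<close>, oriented so that
  rotation by \<open>n \<times> _\<close> is multiplication by \<open>-\<i>\<close>.\<close>

definition plane_coord :: "real^3 \<Rightarrow> real^3 \<Rightarrow> real^3 \<Rightarrow> complex" where
  "plane_coord n e w = Complex (w \<bullet> e) (- (w \<bullet> (n \<times> e)))"

text \<open>\<open>T\<close> and \<open>plane_coord n e\<close> are complex linear for the same
  complex structure of the plane, so they are proportional. The factor is read off at
  \<open>tangential n e\<close>, where the coordinate is
  \<open>1 - (n \<bullet> e)\<^sup>2\<close>.\<close>

lemma conformal_factor:
  fixes T :: "real^3 \<Rightarrow> complex"
  assumes "linear T" "norm n = 1" "norm e = 1" "w \<bullet> n = 0"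
    and T: "\<And>w. w \<bullet> n = 0 \<Longrightarrow> T (n \<times> w) = - \<i> * T w"
  shows "of_real (1 - (n \<bullet> e)\<^sup>2) * T w = T (tangential n e) * plane_coord n e w"
proof -
  have "T ((1 - (n \<bullet> e)\<^sup>2) *\<^sub>R w) = (w \<bullet> e) *\<^sub>R T (tangential n e) + (w \<bullet> (n \<times> e)) *\<^sub>R T (n \<times> e)"
    using tangent_expansion[OF assms(2-4)] assms(1) by (simp add: linear_add linear_cmul)
  moreover have "T (n \<times> e) = - \<i> * T (tangential n e)"
    using T[of "tangential n e"] assms(2,3) by (simp add: cross_tangential tangential_inner_self)
  moreover have "T ((1 - (n \<bullet> e)\<^sup>2) *\<^sub>R w) = of_real (1 - (n \<bullet> e)\<^sup>2) * T w"
    unfolding linear_cmul[OF assms(1)] by (simp add: scaleR_conv_of_real)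
  ultimately have "of_real (1 - (n \<bullet> e)\<^sup>2) * T w =
      (w \<bullet> e) *\<^sub>R T (tangential n e) + (w \<bullet> (n \<times> e)) *\<^sub>R (- \<i> * T (tangential n e))" by simp
  also have "\<dots> = T (tangential n e) * plane_coord n e w"
    by (simp add: plane_coord_def complex_eq_iff algebra_simps)
  finally show ?thesis .
qed

lemma plane_coord_eq_0:
  assumes "norm n = 1" "norm e = 1" "w \<bullet> n = 0" "(n \<bullet> e)\<^sup>2 \<noteq> 1" "plane_coord n e w = 0"
  shows "w = 0"
  using tangent_expansion[OF assms(1-3)] assms(4,5) by (simp add: plane_coord_def complex_eq_iff)

text \<open>Anticommutation gives \<open>n \<times> e\<close> the opposite eigenvalue, which
  determines \<open>L\<close> on the plane. Eliminating \<open>n \<times> e\<close> by the expansion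
  leaves a formula in \<open>w\<close>, \<open>n\<close> and \<open>e\<close>, from which surfaces
  of constant potential are integrated.\<close>

lemma anticommuting_eigen:
  fixes L :: "real^3 \<Rightarrow> real^3"
  assumes "linear L" "norm n = 1" "norm e = 1" "w \<bullet> n = 0" "(n \<bullet> e)\<^sup>2 \<noteq> 1"
    and L: "\<And>w. L (n \<times> w) = - (n \<times> L w)"
    and eig: "L (tangential n e) = - (c * (1 - (n \<bullet> e)\<^sup>2)) *\<^sub>R tangential n e"
  shows "L w = (c * (1 - (n \<bullet> e)\<^sup>2)) *\<^sub>R w - (2 * c * (w \<bullet> e)) *\<^sub>R tangential n e"
proof -
  define d where "d = 1 - (n \<bullet> e)\<^sup>2"
  have d: "d \<noteq> 0" using assms(5) by (simp add: d_def)
  note ex = tangent_expansion[OF assms(2-4), folded d_def]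
  have "L (n \<times> e) = (c * d) *\<^sub>R (n \<times> e)"
    using L[of "tangential n e"] eig assms(2) by (simp add: cross_tangential cross_mult_right d_def)
  then have "d *\<^sub>R L w = (w \<bullet> e) *\<^sub>R (- (c * d) *\<^sub>R tangential n e) + (w \<bullet> (n \<times> e)) *\<^sub>R (c * d) *\<^sub>R (n \<times> e)"
    using arg_cong[OF ex, of L] assms(1) eig by (simp add: linear_add linear_cmul d_def)
  also have "\<dots> = d *\<^sub>R (- (c * (w \<bullet> e)) *\<^sub>R tangential n e + c *\<^sub>R ((w \<bullet> (n \<times> e)) *\<^sub>R (n \<times> e)))"
    by (simp add: algebra_simps)
  also have "(w \<bullet> (n \<times> e)) *\<^sub>R (n \<times> e) = d *\<^sub>R w - (w \<bullet> e) *\<^sub>R tangential n e"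
    using ex by simp
  finally have "L w = - (c * (w \<bullet> e)) *\<^sub>R tangential n e + c *\<^sub>R (d *\<^sub>R w - (w \<bullet> e) *\<^sub>R tangential n e)"
    using d by simp
  also have "\<dots> = (c * d) *\<^sub>R w - (2 * c * (w \<bullet> e)) *\<^sub>R tangential n e"
    by (simp add: vec_eq_iff algebra_simps)
  finally show ?thesis by (simp add: d_def)
qed

section \<open>Oriented frames and stereographic projection\<close>

definition oriented_frame :: "real^3 \<Rightarrow> real^3 \<Rightarrow> real^3 \<Rightarrow> bool" where
  "oriented_frame e1 e2 e3 \<longleftrightarrow> e1 \<bullet> e1 = 1 \<and> e2 \<bullet> e2 = 1 \<and> e3 \<bullet> e3 = 1 \<and>
     e1 \<bullet> e2 = 0 \<and> e1 \<bullet> e3 = 0 \<and> e2 \<bullet> e3 = 0 \<and> e1 \<times> e2 = e3"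

lemma oriented_frame_exists:
  assumes "norm e = 1"
  obtains R :: "real^3^3" where "rotation_matrix R" "R *v axis 3 1 = e"
    "oriented_frame (R *v axis 1 1) (R *v axis 2 1) e"
proof -
  obtain R :: "real^3^3" where R: "rotation_matrix R" "R *v axis 3 1 = e"
    using rotation_matrix_exists_basis[of e 3] assms by auto
  then have "orthogonal_transformation ((*v) R)"
    by (simp add: rotation_matrix_def orthogonal_transformation_matrix)
  then have in_eq: "(R *v x) \<bullet> (R *v y) = x \<bullet> y" for x y
    by (simp add: orthogonal_transformation_def)
  have "(R *v axis 1 1) \<times> (R *v axis 2 1) = e"
    using R by (simp add: cross_rotation_matrix cross_basis)
  then have "oriented_frame (R *v axis 1 1) (R *v axis 2 1) e"
    unfolding oriented_frame_def R(2)[symmetric] in_eq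
    by (simp add: inner_axis_axis)
  with R that show thesis by blast
qed

lemma oriented_frame_cross:
  assumes "oriented_frame e1 e2 e3"
  shows "e1 \<times> e2 = e3" "e2 \<times> e3 = e1" "e3 \<times> e1 = e2"
proof -
  show 12: "e1 \<times> e2 = e3" using assms by (simp add: oriented_frame_def)
  show "e2 \<times> e3 = e1" "e3 \<times> e1 = e2"
    using assms unfolding 12[symmetric] oriented_frame_def
    by (simp_all add: Lagrange cross_skew[of "e1 \<times> e2"] inner_commute)
qed

lemma oriented_frame_expansion:
  assumes "oriented_frame e1 e2 e3"
  shows "x = (x \<bullet> e1) *\<^sub>R e1 + (x \<bullet> e2) *\<^sub>R e2 + (x \<bullet> e3) *\<^sub>R e3"
  using cross3_cramer[of e1 e2 e3 x] assms oriented_frame_cross[OF assms]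
  by (simp add: oriented_frame_def)

lemma oriented_frame_inner:
  assumes "oriented_frame e1 e2 e3"
  shows "x \<bullet> y = (x \<bullet> e1) * (y \<bullet> e1) + (x \<bullet> e2) * (y \<bullet> e2) + (x \<bullet> e3) * (y \<bullet> e3)"
proof -
  have "y \<bullet> x = y \<bullet> ((x \<bullet> e1) *\<^sub>R e1 + (x \<bullet> e2) *\<^sub>R e2 + (x \<bullet> e3) *\<^sub>R e3)"
    using oriented_frame_expansion[OF assms, of x] by simp
  then show ?thesis by (simp add: inner_add_right inner_commute[of x y])
qed

lemma oriented_frame_inner_cross:
  assumes "oriented_frame e1 e2 e3"
  shows "(x \<times> y) \<bullet> e1 = (x \<bullet> e2) * (y \<bullet> e3) - (x \<bullet> e3) * (y \<bullet> e2)"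
    "(x \<times> y) \<bullet> e2 = (x \<bullet> e3) * (y \<bullet> e1) - (x \<bullet> e1) * (y \<bullet> e3)"
    "(x \<times> y) \<bullet> e3 = (x \<bullet> e1) * (y \<bullet> e2) - (x \<bullet> e2) * (y \<bullet> e1)"
  using dot_cross[of x y e2 e3] dot_cross[of x y e3 e1] dot_cross[of x y e1 e2]
    oriented_frame_cross[OF assms] by simp_all

text \<open>Complex conjugate of stereographic projection from \<open>e3\<close>; the conjugate makes the
  Gauss map of a minimal surface holomorphic with respect to \<^const>\<open>plane_coord\<close>.\<close>

definition stereo :: "real^3 \<Rightarrow> real^3 \<Rightarrow> real^3 \<Rightarrow> real^3 \<Rightarrow> complex" where
  "stereo e1 e2 e3 n = Complex (n \<bullet> e1) (- (n \<bullet> e2)) / of_real (1 - n \<bullet> e3)"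

definition stereo_deriv :: "real^3 \<Rightarrow> real^3 \<Rightarrow> real^3 \<Rightarrow> real^3 \<Rightarrow> real^3 \<Rightarrow> complex" where
  "stereo_deriv e1 e2 e3 n y = (Complex (y \<bullet> e1) (- (y \<bullet> e2)) * of_real (1 - n \<bullet> e3) +
     Complex (n \<bullet> e1) (- (n \<bullet> e2)) * of_real (y \<bullet> e3)) / of_real ((1 - n \<bullet> e3)\<^sup>2)"

lemma has_derivative_stereo:
  assumes "(N has_derivative N') (at u)" "N u \<bullet> e3 \<noteq> 1"
  shows "((\<lambda>u. stereo e1 e2 e3 (N u)) has_derivative (\<lambda>v. stereo_deriv e1 e2 e3 (N u) (N' v))) (at u)"
proof -
  have C: "Complex a b = of_real a + \<i> * of_real b" for a b by (simp add: complex_eq_iff)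
  have "1 - N u \<bullet> e3 \<noteq> 0" using assms(2) by simp
  then have ne: "complex_of_real (1 - N u \<bullet> e3) \<noteq> 0" using of_real_eq_0_iff by blast

  have num: "((\<lambda>u. Complex (N u \<bullet> e1) (- (N u \<bullet> e2))) has_derivative (\<lambda>v. Complex (N' v \<bullet> e1) (- (N' v \<bullet> e2)))) (at u)"
    unfolding C by (auto intro!: derivative_eq_intros assms(1))
  have den: "((\<lambda>u. complex_of_real (1 - N u \<bullet> e3)) has_derivative (\<lambda>v. - of_real (N' v \<bullet> e3))) (at u)"
    by (auto intro!: derivative_eq_intros assms(1))
  show ?thesis
    unfolding stereo_def stereo_deriv_def
    by (rule has_derivative_eq_rhs[OF has_derivative_divide'[OF num den ne]])
       (simp add: fun_eq_iff power2_eq_square)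
qed

lemma linear_stereo_deriv: "linear (stereo_deriv e1 e2 e3 n)"
proof -
  have C: "Complex a b = of_real a + \<i> * of_real b" for a b by (simp add: complex_eq_iff)
  show ?thesis
    by (rule linearI)
       (simp_all add: stereo_deriv_def C inner_add_left scaleR_conv_of_real[where 'a = complex]
         add_divide_distrib[symmetric], simp_all add: algebra_simps)
qed

text \<open>Stereographic projection is conformal. The factor \<i> is opposite to that of
  \<open>plane_coord\<close>; the second change of sign comes from the shape operator, which
  anticommutes with the quarter turn. Together they make the Gauss map holomorphic.\<close>

lemma stereo_deriv_cross:
  assumes "oriented_frame e1 e2 e3" "norm n = 1" "y \<bullet> n = 0"
  shows "stereo_deriv e1 e2 e3 n (n \<times> y) = \<i> * stereo_deriv e1 e2 e3 n y"
proof -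
  define a b c p q r where abc: "a = n \<bullet> e1" "b = n \<bullet> e2" "c = n \<bullet> e3" "p = y \<bullet> e1" "q = y \<bullet> e2" "r = y \<bullet> e3"
  have 1: "a * a + b * b + c * c = 1"
    using oriented_frame_inner[OF assms(1), of n n] assms(2) by (simp add: abc dot_square_norm)
  have 2: "p * a + q * b + r * c = 0"
    using oriented_frame_inner[OF assms(1), of y n] assms(3) by (simp add: abc)
  have "(b * r - c * q) * (1 - c) + a * (a * q - b * p) = q * (1 - c) + b * r"
    using 1 2 by algebra
  moreover have "(c * p - a * r) * (1 - c) + b * (a * q - b * p) = - (p * (1 - c) + a * r)"
    using 1 2 by algebra
  ultimately have "Complex (b * r - c * q) (- (c * p - a * r)) * of_real (1 - c) + Complex a (- b) * of_real (a * q - b * p)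
     = \<i> * (Complex p (- q) * of_real (1 - c) + Complex a (- b) * of_real r)"
    by (simp add: complex_eq_iff algebra_simps)
  then show ?thesis
    unfolding stereo_deriv_def oriented_frame_inner_cross[OF assms(1)] abc[symmetric]
    by simp
qed

text \<open>Moving \<open>n\<close> along its meridian at the rate \<open>tangential n e3\<close>
  changes the projection with logarithmic derivative 1. This is what an exponential factor can
  cancel.\<close>

lemma stereo_deriv_axis:
  assumes "oriented_frame e1 e2 e3" "norm n = 1" "n \<bullet> e3 \<noteq> 1"
  shows "stereo_deriv e1 e2 e3 n (tangential n e3) = stereo e1 e2 e3 n"
proof -
  define a b c where abc: "a = n \<bullet> e1" "b = n \<bullet> e2" "c = n \<bullet> e3"
  have c: "1 - c \<noteq> 0" using assms(3) by (simp add: abc)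
  have 1: "tangential n e3 \<bullet> e1 = - c * a" "tangential n e3 \<bullet> e2 = - c * b" "tangential n e3 \<bullet> e3 = 1 - c\<^sup>2"
    using assms(1) by (simp_all add: tangential_def oriented_frame_def inner_diff_left abc
        inner_commute[of e3 e1] inner_commute[of e3 e2] inner_commute[of e3 n] power2_eq_square)
  have "Complex (- c * a) (- (- c * b)) * of_real (1 - c) + Complex a (- b) * of_real (1 - c\<^sup>2)
      = Complex a (- b) * of_real (1 - c)"
    by (simp add: complex_eq_iff power2_eq_square algebra_simps)
  moreover have "complex_of_real ((1 - c)\<^sup>2) = of_real (1 - c) * of_real (1 - c)"
    by (simp add: power2_eq_square)
  moreover have "complex_of_real (1 - c) \<noteq> 0" using c of_real_eq_0_iff by blast
  ultimately show ?thesis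
    unfolding stereo_deriv_def stereo_def 1 abc[symmetric] by simp
qed

text \<open>Mercator's formula: with z = \<open>n \<bullet> e3\<close> the modulus is
  \<open>sqrt ((1 + z) / (1 - z))\<close>, and its logarithm is artanh z.\<close>

lemma norm_stereo:
  assumes "oriented_frame e1 e2 e3" "norm n = 1" "\<bar>n \<bullet> e3\<bar> < 1"
  shows "cmod (stereo e1 e2 e3 n) = exp (artanh (n \<bullet> e3))"
proof -
  define a b c where abc: "a = n \<bullet> e1" "b = n \<bullet> e2" "c = n \<bullet> e3"
  have c: "\<bar>c\<bar> < 1" using assms(3) by (simp add: abc)
  have 1: "a\<^sup>2 + b\<^sup>2 = (1 + c) * (1 - c)"
    using oriented_frame_inner[OF assms(1), of n n] assms(2)
    by (simp add: abc dot_square_norm power2_eq_square algebra_simps)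
  have "cmod (stereo e1 e2 e3 n) = sqrt ((1 + c) * (1 - c)) / (1 - c)"
    unfolding stereo_def abc[symmetric] using 1 c
    by (simp add: norm_divide complex_norm del: of_real_diff)
  also have "\<dots> = sqrt ((1 + c) / (1 - c))"
    using c by (simp add: real_sqrt_mult real_sqrt_divide real_div_sqrt divide_simps)
  also have "\<dots> = exp (artanh c)"
  proof -
    have "exp (artanh c) = exp (ln ((1 + c) / (1 - c)) / 2)" by (simp add: artanh_def)
    also have "\<dots> = sqrt ((1 + c) / (1 - c))"
      using c by (simp add: ln_sqrt[symmetric])
    finally show ?thesis by simp
  qed
  finally show ?thesis by (simp add: abc)
qed

section \<open>Minimal surface charts and conjugate coordinates\<close>

lemma half_plane_shift: "u \<in> half_plane \<Longrightarrow> t \<ge> 0 \<Longrightarrow> u + t *\<^sub>R axis k 1 \<in> half_plane"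
  by (simp add: half_plane_def axis_def)

lemma convex_half_plane: "convex half_plane"
  using convex_halfspace_ge[of 0 "axis 2 1 :: real^2"] by (simp add: half_plane_def inner_axis inner_commute)

text \<open>From every point of a half disc, its edge included, one can move a little in both
  positive coordinate directions, and this determines a derivative.\<close>

lemma half_disc_derivative_unique:
  fixes f :: "real^2 \<Rightarrow> 'b::real_normed_vector"
  assumes f: "(f has_derivative f') (at u within ball u0 r \<inter> half_plane)"
    "(f has_derivative f'') (at u within ball u0 r \<inter> half_plane)"
    and u: "u \<in> ball u0 r \<inter> half_plane"
  shows "f' = f''"
proof -
  let ?D = "ball u0 r \<inter> half_plane"
  show "f' = f''"
    using f
  proof (rule frechet_derivative_unique_within)
    fix i :: "real^2" and e :: real
    assume i: "i \<in> Basis" and e: "e > 0"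
    obtain k where k: "i = axis k 1" using i by (auto simp: Basis_vec_def)
    define d where "d = min (e / 2) ((r - dist u0 u) / 2)"
    have d: "d > 0" "d < e" "d < r - dist u0 u" using e u by (auto simp: d_def min_def)
    have "dist u0 (u + d *\<^sub>R i) \<le> dist u0 u + dist u (u + d *\<^sub>R i)" by (rule dist_triangle)
    also have "dist u (u + d *\<^sub>R i) = d" using d i by (simp add: dist_norm)
    finally have "u + d *\<^sub>R i \<in> ?D" using d u half_plane_shift[of u d k] by (auto simp: k)
    with d show "\<exists>d. 0 < \<bar>d\<bar> \<and> \<bar>d\<bar> < e \<and> u + d *\<^sub>R i \<in> ?D" by (intro exI[of _ d]) auto
  qed
qed

text \<open>Identities hold on the half disc but are differentiated with the derivatives of the full
  disc. This transfers the information, on the edge as well.\<close>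

lemma half_disc_derivative_zero:
  fixes f :: "real^2 \<Rightarrow> 'b::real_normed_vector"
  assumes f: "(f has_derivative f') (at u)" and u: "u \<in> ball u0 r \<inter> half_plane"
    and const: "\<And>x. x \<in> ball u0 r \<inter> half_plane \<Longrightarrow> f x = c"
  shows "f' v = 0"
proof -
  have "(f has_derivative (\<lambda>v. 0)) (at u within ball u0 r \<inter> half_plane)"
    by (rule has_derivative_transform[OF u, of _ "\<lambda>_. c"]) (use const in auto)
  from half_disc_derivative_unique[OF has_derivative_at_withinI[OF f] this u]
  show ?thesis by simp
qed

lemma unit_field_derivative_tangent:
  fixes n :: "real^2 \<Rightarrow> 'b::real_inner"
  assumes n': "(n has_derivative n') (at u)" and u: "u \<in> ball u0 r \<inter> half_plane"
    and unit: "\<And>x. x \<in> ball u0 r \<inter> half_plane \<Longrightarrow> norm (n x) = 1"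
  shows "n' v \<bullet> n u = 0"
proof -
  have "((\<lambda>u. n u \<bullet> n u) has_derivative (\<lambda>v. n u \<bullet> n' v + n' v \<bullet> n u)) (at u)"
    using n' by (intro has_derivative_inner) auto
  from half_disc_derivative_zero[OF this u, of 1 v] unit
  show ?thesis by (simp add: dot_square_norm inner_commute)
qed

lemma half_disc_limit:
  fixes f :: "real^2 \<Rightarrow> real"
  assumes "isCont f u" "u \<in> ball u0 r \<inter> half_plane"
    and const: "\<And>x. x \<in> ball u0 r \<Longrightarrow> x $ 2 > 0 \<Longrightarrow> f x = k"
  shows "f u = k"
proof -
  have lim: "((\<lambda>t. u + t *\<^sub>R axis 2 1) \<longlongrightarrow> u) (at_right 0)"
    by (auto intro!: tendsto_eq_intros)
  then have "((\<lambda>t. f (u + t *\<^sub>R axis 2 1)) \<longlongrightarrow> f u) (at_right 0)"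
    using assms(1) isCont_tendsto_compose by blast
  moreover have "\<forall>\<^sub>F t in at_right 0. u + t *\<^sub>R axis 2 1 \<in> ball u0 r"
    using lim assms(2) by (intro topological_tendstoD) auto
  then have "\<forall>\<^sub>F t in at_right 0. f (u + t *\<^sub>R axis 2 1) = k"
    using eventually_at_right_less[of 0]
    by eventually_elim (rule const, use assms(2) in \<open>auto simp: half_plane_def axis_def\<close>)
  then have "((\<lambda>t. f (u + t *\<^sub>R axis 2 1)) \<longlongrightarrow> k) (at_right 0)"
    by (rule tendsto_eventually)
  ultimately show ?thesis using tendsto_unique trivial_limit_at_right_real by blast
qed

lemma cross_parallel_normal:
  fixes a b n :: "real^3"
  assumes "norm n = 1" "a \<bullet> n = 0" "b \<bullet> n = 0"
  shows "a \<times> b = ((a \<times> b) \<bullet> n) *\<^sub>R n"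
proof -
  have "n \<times> (a \<times> b) = 0" using assms by (simp add: Lagrange inner_commute)
  then have "n \<times> (n \<times> (a \<times> b)) = 0" by simp
  then show ?thesis using assms(1) by (simp add: Lagrange[of n n] dot_square_norm inner_commute)
qed

text \<open>\<open>has_derivative_locally_injective\<close> wants the derivative continuous in
  operator norm. A sum over the basis bounds that norm by directional derivatives, whose continuity
  is the form in which C1 is known here.\<close>

lemma locally_injective_of_C1:
  fixes f :: "'a::euclidean_space \<Rightarrow> 'b::euclidean_space"
  assumes "open S" "a \<in> S" and f': "\<And>x. x \<in> S \<Longrightarrow> (f has_derivative f' x) (at x)"
    and cont: "\<And>v. continuous_on S (\<lambda>x. f' x v)" and inj: "inj (f' a)"
  obtains r where "r > 0" "ball a r \<subseteq> S" "inj_on f (ball a r)"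
proof -
  have bl: "bounded_linear (f' x)" if "x \<in> S" for x
    using f'[OF that] by (rule has_derivative_bounded_linear)
  obtain g' where g': "linear g'" "g' \<circ> f' a = id"
    using linear_injective_left_inverse[OF bounded_linear.linear[OF bl[OF assms(2)]] inj] by blast
  show thesis
  proof (rule has_derivative_locally_injective[of a S g' f' f])
    fix e :: real assume e: "e > 0"
    define h where "h x = (\<Sum>i\<in>Basis. norm (f' x i - f' a i))" for x
    have "continuous_on S h" unfolding h_def by (intro continuous_intros cont)
    then have "isCont h a" using assms by (simp add: continuous_on_eq_continuous_at)
    then obtain d1 where d1: "d1 > 0" "\<And>x. dist x a < d1 \<Longrightarrow> dist (h x) (h a) < e"
      unfolding continuous_at_eps_delta using e by metis
    obtain d2 where d2: "d2 > 0" "ball a d2 \<subseteq> S" using assms open_contains_ball by blast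
    have "onorm (\<lambda>v. f' x v - f' a v) < e" if "dist a x < min d1 d2" for x
    proof -
      have "onorm (\<lambda>v. f' x v - f' a v) \<le> h x"
        unfolding h_def using d2(2) that assms(2)
        by (intro onorm_componentwise bounded_linear_sub bl) auto
      also have "h x < e" using d1(2)[of x] that by (simp add: h_def dist_real_def dist_commute)
      finally show ?thesis .
    qed
    with d1 d2 show "\<exists>d>0. \<forall>x. dist a x < d \<longrightarrow> onorm (\<lambda>v. f' x v - f' a v) < e"
      by (intro exI[of _ "min d1 d2"]) auto
  qed (use assms g' that in \<open>auto simp: linear_conv_bounded_linear\<close>)
qed

lemma inj_linear_surj:
  fixes f :: "'a::euclidean_space \<Rightarrow> 'b::euclidean_space"
  assumes "linear f" "inj f" "DIM('a) = DIM('b)"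
  shows "range f = UNIV"
proof -
  have "dim (range f) = DIM('b)"
    using assms by (simp add: dim_image_eq)
  then have "span (range f) = UNIV" by (simp add: dim_eq_full)
  moreover have "span (range f) = range f"
    using assms(1) by (simp add: linear_subspace_image subspace_UNIV)
  ultimately show ?thesis by simp
qed

text \<open>Only the derivatives at the single point \<open>u\<close> enter, so this serves also on
  the boundary arc, beyond which \<open>\<zeta>\<close> has no geometric meaning.\<close>

lemma holomorphic_in_coordinate:
  fixes \<zeta> Q :: "real^2 \<Rightarrow> complex"
  assumes V: "open V" "u \<in> V" and h: "homeomorphism V (\<zeta> ` V) \<zeta> h" and op: "open (\<zeta> ` V)"
    and \<zeta>': "(\<zeta> has_derivative \<zeta>') (at u)" "inj \<zeta>'"
    and Q': "(Q has_derivative (\<lambda>v. m * \<zeta>' v)) (at u)"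
  shows "((\<lambda>z. Q (h z)) has_field_derivative m) (at (\<zeta> u))"
proof -
  have lin: "linear \<zeta>'" using \<zeta>'(1) by (rule has_derivative_linear)
  obtain g' where g': "linear g'" "g' \<circ> \<zeta>' = id"
    using linear_injective_left_inverse[OF lin \<zeta>'(2)] by blast
  have hu: "h (\<zeta> u) = u" using h V(2) by (simp add: homeomorphism_apply1)
  have inv: "\<zeta>' (g' z) = z" for z
  proof -
    obtain v where "z = \<zeta>' v" using inj_linear_surj[OF lin \<zeta>'(2)] by (auto simp: surj_def)
    then show ?thesis using g'(2) by (metis comp_apply id_apply)
  qed
  have "(h has_derivative g') (at (\<zeta> u))"
  proof (rule has_derivative_inverse_basic[where f = \<zeta> and f' = \<zeta>' and T = "\<zeta> ` V"])
    show "continuous (at (\<zeta> u)) h"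
      using homeomorphism_cont2[OF h] op V(2) by (simp add: continuous_on_eq_continuous_at)
  qed (use \<zeta>' hu g' op V(2) h in \<open>auto simp: linear_conv_bounded_linear homeomorphism_apply1\<close>)
  then have "((\<lambda>z. Q (h z)) has_derivative (\<lambda>z. m * \<zeta>' (g' z))) (at (\<zeta> u))"
    using has_derivative_compose[of h g' "\<zeta> u" UNIV Q] Q' by (simp add: hu)
  then show ?thesis by (simp add: has_field_derivative_def inv)
qed

text \<open>Regularity is asked on the whole disc, geometry only on its half: beyond the straight
  edge \<open>\<phi>\<close> and \<open>n\<close> are arbitrary continuations. Minimality appears in
  \<open>shape\<close>, as a trace-free extension of the differential of the normal to the whole
  space.\<close>

locale surface_chart =
  fixes \<phi> n :: "real^2 \<Rightarrow> real^3" and \<phi>' n' :: "real^2 \<Rightarrow> real^2 \<Rightarrow> real^3"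
    and \<phi>'' n'' :: "real^2 \<Rightarrow> real^2 \<Rightarrow> real^2 \<Rightarrow> real^3" and u0 :: "real^2" and r :: real
  assumes r: "r > 0" and u0: "u0 \<in> half_plane"
    and \<phi>': "\<And>u. u \<in> ball u0 r \<Longrightarrow> (\<phi> has_derivative \<phi>' u) (at u)"
    and \<phi>'': "\<And>u v. u \<in> ball u0 r \<Longrightarrow> ((\<lambda>u. \<phi>' u v) has_derivative \<phi>'' u v) (at u)"
    and \<phi>''_cont: "\<And>v w. continuous_on (ball u0 r) (\<lambda>u. \<phi>'' u v w)"
    and n': "\<And>u. u \<in> ball u0 r \<Longrightarrow> (n has_derivative n' u) (at u)"
    and n'': "\<And>u v. u \<in> ball u0 r \<Longrightarrow> ((\<lambda>u. n' u v) has_derivative n'' u v) (at u)"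
    and n''_cont: "\<And>v w. continuous_on (ball u0 r) (\<lambda>u. n'' u v w)"
    and unit: "\<And>u. u \<in> ball u0 r \<inter> half_plane \<Longrightarrow> norm (n u) = 1"
    and tang: "\<And>u v. u \<in> ball u0 r \<inter> half_plane \<Longrightarrow> \<phi>' u v \<bullet> n u = 0"
    and inj: "\<And>u. u \<in> ball u0 r \<inter> half_plane \<Longrightarrow> inj (\<phi>' u)"
    and shape: "\<And>u. u \<in> ball u0 r \<inter> half_plane \<Longrightarrow>
      \<exists>L. linear L \<and> trace (matrix L) = 0 \<and> L (n u) = 0 \<and> (\<forall>v. L (\<phi>' u v) = n' u v)"
begin

abbreviation "B \<equiv> ball u0 r"
abbreviation "D \<equiv> ball u0 r \<inter> half_plane"

lemma u0_D: "u0 \<in> D" using r u0 by simp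

lemma \<phi>''_sym: "u \<in> B \<Longrightarrow> \<phi>'' u v w = \<phi>'' u w v"
  using symmetric_second_derivative[of B u \<phi> \<phi>' \<phi>'' v w] \<phi>' \<phi>'' \<phi>''_cont by auto

lemma n''_sym: "u \<in> B \<Longrightarrow> n'' u v w = n'' u w v"
  using symmetric_second_derivative[of B u n n' n'' v w] n' n'' n''_cont by auto

lemma linear_\<phi>': "u \<in> B \<Longrightarrow> linear (\<phi>' u)"
  using \<phi>' has_derivative_linear by blast

lemma n'_tang:
  assumes "u \<in> D" shows "n' u v \<bullet> n u = 0"
  using unit_field_derivative_tangent[OF n' assms unit] assms by blast

lemma tang_derivative:
  assumes "u \<in> D" shows "\<phi>'' u v w \<bullet> n u + \<phi>' u v \<bullet> n' u w = 0"
proof -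
  have "((\<lambda>u. \<phi>' u v \<bullet> n u) has_derivative (\<lambda>w. \<phi>' u v \<bullet> n' u w + \<phi>'' u v w \<bullet> n u)) (at u)"
    using n' \<phi>'' assms by (intro has_derivative_inner) auto
  from half_disc_derivative_zero[OF this assms, of 0 w] tang show ?thesis by simp
qed

lemma second_form_sym:
  assumes "u \<in> D" shows "\<phi>' u v \<bullet> n' u w = \<phi>' u w \<bullet> n' u v"
  using tang_derivative[OF assms, of v w] tang_derivative[OF assms, of w v] \<phi>''_sym[of u v w] assms
  by auto

lemma tangent_surj:
  assumes "u \<in> D" "x \<bullet> n u = 0"
  obtains v where "x = \<phi>' u v"
proof -
  have lin: "linear (\<phi>' u)" using linear_\<phi>' assms by blast
  have "n u \<noteq> 0" using unit[OF assms(1)] by auto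
  then have "dim {x. n u \<bullet> x = 0} = 2" by (simp add: dim_hyperplane)
  moreover have "dim (range (\<phi>' u)) = 2"
    using lin inj[OF assms(1)] by (simp add: dim_image_eq)
  moreover have "range (\<phi>' u) \<subseteq> {x. n u \<bullet> x = 0}" using tang[OF assms(1)] by (auto simp: inner_commute)
  moreover have "subspace (range (\<phi>' u))" using lin by (simp add: linear_subspace_image)
  ultimately have "range (\<phi>' u) = {x. n u \<bullet> x = 0}"
    by (intro subspace_dim_equal subspace_hyperplane) auto
  then show thesis using assms(2) that by (auto simp: inner_commute)
qed

text \<open>The differential of the normal, hence minus the shape operator, extended by zero in the
  normal direction. As an endomorphism of the whole space it can be combined with the cross
  product.\<close>

definition "shape_op u = (SOME L. linear L \<and> trace (matrix L) = 0 \<and> L (n u) = 0 \<and> (\<forall>v. L (\<phi>' u v) = n' u v))"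

lemma
  assumes "u \<in> D"
  shows linear_shape_op: "linear (shape_op u)" and trace_shape_op: "trace (matrix (shape_op u)) = 0"
    and shape_op_normal: "shape_op u (n u) = 0" and shape_op_\<phi>': "shape_op u (\<phi>' u v) = n' u v"
  using someI_ex[OF shape[OF assms]] unfolding shape_op_def by blast+

lemma shape_op_tang:
  assumes "u \<in> D" shows "shape_op u x \<bullet> n u = 0"
proof -
  have "n u \<bullet> n u = 1" using unit[OF assms] by (simp add: dot_square_norm)
  then obtain v where v: "x - (x \<bullet> n u) *\<^sub>R n u = \<phi>' u v"
    using tangent_surj[OF assms, of "x - (x \<bullet> n u) *\<^sub>R n u"] by (auto simp: inner_diff_left)
  have "shape_op u (x - (x \<bullet> n u) *\<^sub>R n u) = shape_op u x"
    using linear_shape_op[OF assms] shape_op_normal[OF assms] by (simp add: linear_diff linear_cmul)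
  then show ?thesis using n'_tang[OF assms] v shape_op_\<phi>'[OF assms] by metis
qed

lemma shape_op_sym:
  assumes "u \<in> D" shows "shape_op u x \<bullet> y = x \<bullet> shape_op u y"
proof -
  have 1: "n u \<bullet> n u = 1" using unit[OF assms] by (simp add: dot_square_norm)
  obtain v where v: "x - (x \<bullet> n u) *\<^sub>R n u = \<phi>' u v"
    using tangent_surj[OF assms, of "x - (x \<bullet> n u) *\<^sub>R n u"] 1 by (auto simp: inner_diff_left)
  obtain w where w: "y - (y \<bullet> n u) *\<^sub>R n u = \<phi>' u w"
    using tangent_surj[OF assms, of "y - (y \<bullet> n u) *\<^sub>R n u"] 1 by (auto simp: inner_diff_left)
  have *: "shape_op u (z - (z \<bullet> n u) *\<^sub>R n u) = shape_op u z" for z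
    using linear_shape_op[OF assms] shape_op_normal[OF assms] by (simp add: linear_diff linear_cmul)
  have x: "shape_op u x = n' u v" using *[of x] v shape_op_\<phi>'[OF assms] by simp
  have y: "shape_op u y = n' u w" using *[of y] w shape_op_\<phi>'[OF assms] by simp
  have "shape_op u x \<bullet> y = n' u v \<bullet> (y - (y \<bullet> n u) *\<^sub>R n u)"
    using n'_tang[OF assms] by (simp add: x inner_diff_right)
  also have "\<dots> = (x - (x \<bullet> n u) *\<^sub>R n u) \<bullet> n' u w"
    unfolding v w using second_form_sym[OF assms, of v w] by (simp add: inner_commute)
  also have "\<dots> = x \<bullet> shape_op u y"
    using n'_tang[OF assms, of w] by (simp add: y inner_diff_left inner_commute[of "n u"])
  finally show ?thesis .
qed

lemma shape_op_cross:
  assumes "u \<in> D" shows "shape_op u (n u \<times> w) = - (n u \<times> shape_op u w)"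
  using traceless_symmetric_anticommutes[OF linear_shape_op trace_shape_op shape_op_normal shape_op_sym]
    assms by blast

text \<open>Both products are normal to the surface, and their normal components add up to the trace
  of \<open>shape_op\<close> times the area form. This is closedness of the vector-valued form N x
  dX.\<close>

lemma mean_curvature_vector_zero:
  assumes "u \<in> D" shows "n' u v \<times> \<phi>' u w + \<phi>' u v \<times> n' u w = 0"
proof -
  have "(n' u v \<times> \<phi>' u w) \<bullet> n u + (\<phi>' u v \<times> n' u w) \<bullet> n u = 0"
    using trace_cross3[OF linear_shape_op[OF assms], of "\<phi>' u v" "\<phi>' u w" "n u"]
    by (simp add: trace_shape_op[OF assms] shape_op_normal[OF assms] shape_op_\<phi>'[OF assms])
  then show ?thesis
    using cross_parallel_normal[OF unit[OF assms], of "n' u v" "\<phi>' u w"]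
      cross_parallel_normal[OF unit[OF assms], of "\<phi>' u v" "n' u w"] n'_tang[OF assms] tang[OF assms]
    by (metis scaleR_add_left scaleR_zero_left)
qed

text \<open>On the half disc the imaginary part is a height function of the conjugate minimal
  surface. Radial integration makes \<open>\<zeta>\<close> C1 on the whole disc, so that it can be
  inverted around a point of the edge.\<close>

lemma conjugate_coordinate:
  obtains \<zeta> :: "real^2 \<Rightarrow> complex" and \<zeta>'
  where "\<And>u. u \<in> B \<Longrightarrow> (\<zeta> has_derivative \<zeta>' u) (at u)" "\<And>v. continuous_on B (\<lambda>u. \<zeta>' u v)"
    "\<And>u v. u \<in> D \<Longrightarrow> \<zeta>' u v = plane_coord (n u) e (\<phi>' u v)" "\<And>u. Re (\<zeta> u) = \<phi> u \<bullet> e"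
proof -
  define \<omega> where "\<omega> u v = (n u \<times> \<phi>' u v) \<bullet> e" for u v
  define \<omega>' where "\<omega>' u v w = (n u \<times> \<phi>'' u v w + n' u w \<times> \<phi>' u v) \<bullet> e" for u v w
  have cont: "continuous_on B \<phi>" "continuous_on B n" "continuous_on B (\<lambda>u. \<phi>' u v)" "continuous_on B (\<lambda>u. n' u v)" for v
    using \<phi>' n' \<phi>'' n'' by (auto intro!: continuous_at_imp_continuous_on has_derivative_continuous)
  have bb: "bounded_bilinear (\<lambda>x y::real^3. x \<times> y)"
    using bilinear_cross bilinear_conv_bounded_bilinear by blast
  obtain P P' where P: "\<And>u. u \<in> B \<Longrightarrow> (P has_derivative P' u) (at u)"
    "\<And>v. continuous_on B (\<lambda>u. P' u v)" "\<And>u v. u \<in> D \<Longrightarrow> P' u v = \<omega> u v"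
  proof (rule radial_primitive[of B u0 r \<omega> \<omega>' D])
    show "linear (\<omega> u)" if "u \<in> B" for u
      using linear_\<phi>'[OF that] by (intro linearI) (simp_all add: \<omega>_def linear_add linear_cmul
          cross_add_right cross_mult_right inner_add_left)
    show "((\<lambda>u. \<omega> u v) has_derivative \<omega>' u v) (at u)" if "u \<in> B" for u v
      unfolding \<omega>_def \<omega>'_def
      by (intro has_derivative_inner_left bounded_bilinear.FDERIV[OF bb] n' \<phi>'' that)
    show "continuous_on B (\<lambda>u. \<omega>' u v w)" for v w
      unfolding \<omega>'_def by (intro continuous_intros continuous_on_cross cont \<phi>''_cont)
    show "u0 + t *\<^sub>R (u - u0) \<in> D" if "u \<in> D" "0 \<le> t" "t \<le> 1" for u t
    proof -
      have "convex D" by (intro convex_Int convex_ball convex_half_plane)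
      then have "(1 - t) *\<^sub>R u0 + t *\<^sub>R u \<in> D" using u0_D that by (intro convexD_alt) auto
      then show ?thesis by (simp add: algebra_simps)
    qed
    \<comment> \<open>The second derivatives of \<open>\<phi>\<close> cancel by symmetry; what is
      left is the vanishing of the mean curvature vector.\<close>
    show "\<omega>' u v w = \<omega>' u w v" if "u \<in> D" for u v w
      using mean_curvature_vector_zero[OF that, of w v] \<phi>''_sym[of u v w] that
      by (simp add: \<omega>'_def cross_skew[of "\<phi>' u w"] flip: inner_diff_left) 
  qed auto
  define \<zeta> where "\<zeta> u = of_real (\<phi> u \<bullet> e) + \<i> * of_real (P u)" for u
  define \<zeta>' where "\<zeta>' u v = of_real (\<phi>' u v \<bullet> e) + \<i> * of_real (P' u v)" for u v
  show thesis
  proof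
    show "(\<zeta> has_derivative \<zeta>' u) (at u)" if "u \<in> B" for u
      unfolding \<zeta>_def \<zeta>'_def
      by (intro has_derivative_add has_derivative_mult_right has_derivative_of_real has_derivative_inner_left
          \<phi>'[OF that] P(1)[OF that])
    show "continuous_on B (\<lambda>u. \<zeta>' u v)" for v
      unfolding \<zeta>'_def by (intro continuous_intros cont P)
    show "\<zeta>' u v = plane_coord (n u) e (\<phi>' u v)" if "u \<in> D" for u v
    proof -
      have "(n u \<times> \<phi>' u v) \<bullet> e = - (\<phi>' u v \<bullet> (n u \<times> e))" by (simp add: cross3_simps)
      then show ?thesis by (simp add: \<zeta>'_def P(3)[OF that] \<omega>_def plane_coord_def complex_eq_iff)
    qed
    show "Re (\<zeta> u) = \<phi> u \<bullet> e" for u by (simp add: \<zeta>_def)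
  qed
qed

end

section \<open>Unique continuation\<close>

context surface_chart
begin

text \<open>The Weierstrass-type function \<open>Q\<close>: on a catenoid with axis \<open>e3\<close> it is constant for a suitable \<open>c\<close>.\<close>

lemma gauss_map_chart:
  assumes frame: "oriented_frame e1 e2 e3" and small: "\<bar>n u0 \<bullet> e3\<bar> < 1"
  obtains s \<zeta> \<zeta>' h Q m where
    "0 < s" "s \<le> r" "\<And>u. u \<in> ball u0 s \<Longrightarrow> \<bar>n u \<bullet> e3\<bar> < 1"
    "homeomorphism (ball u0 s) (\<zeta> ` ball u0 s) \<zeta> h"
    "\<And>W. open W \<Longrightarrow> W \<subseteq> ball u0 s \<Longrightarrow> open (\<zeta> ` W)"
    "\<And>u. u \<in> ball u0 s \<inter> half_plane \<Longrightarrow> (\<zeta> has_derivative \<zeta>' u) (at u)"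
    "\<And>u. u \<in> ball u0 s \<inter> half_plane \<Longrightarrow> inj (\<zeta>' u)"
    "\<And>u. u \<in> ball u0 s \<inter> half_plane \<Longrightarrow> (Q has_derivative (\<lambda>v. m u * \<zeta>' u v)) (at u)"
    "\<And>u. u \<in> ball u0 s \<inter> half_plane \<Longrightarrow>
       shape_op u (tangential (n u) e3) = - (c * (1 - (n u \<bullet> e3)\<^sup>2)) *\<^sub>R tangential (n u) e3 \<Longrightarrow> m u = 0"
    "\<And>u. u \<in> ball u0 s \<inter> half_plane \<Longrightarrow> cmod (Q u) = exp (artanh (n u \<bullet> e3) + c * (\<phi> u \<bullet> e3))"
proof -
  have ne: "norm e3 = 1" using frame by (simp add: oriented_frame_def norm_eq_sqrt_inner)
  obtain \<zeta> :: "real^2 \<Rightarrow> complex" and \<zeta>' where \<zeta>: "\<And>u. u \<in> B \<Longrightarrow> (\<zeta> has_derivative \<zeta>' u) (at u)"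
    "\<And>v. continuous_on B (\<lambda>u. \<zeta>' u v)"
    "\<And>u v. u \<in> D \<Longrightarrow> \<zeta>' u v = plane_coord (n u) e3 (\<phi>' u v)" "\<And>u. Re (\<zeta> u) = \<phi> u \<bullet> e3"
    using conjugate_coordinate[of e3] by metis
  have inj_\<zeta>': "inj (\<zeta>' u)" if "u \<in> D" "\<bar>n u \<bullet> e3\<bar> < 1" for u
  proof (subst linear_injective_0)
    show "linear (\<zeta>' u)" using \<zeta>(1) that has_derivative_linear by blast
    have "v = 0" if "\<zeta>' u v = 0" for v
    proof -
      have "(n u \<bullet> e3)\<^sup>2 \<noteq> 1" using \<open>\<bar>n u \<bullet> e3\<bar> < 1\<close> by (auto simp: power2_eq_1_iff)
      then have "\<phi>' u v = 0"
        using plane_coord_eq_0[OF unit[OF \<open>u \<in> D\<close>] ne tang[OF \<open>u \<in> D\<close>]] that \<zeta>(3)[OF \<open>u \<in> D\<close>] by simp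
      then show ?thesis
        using inj[OF \<open>u \<in> D\<close>] linear_\<phi>' \<open>u \<in> D\<close> linear_injective_0 by blast
    qed
    then show "\<forall>v. \<zeta>' u v = 0 \<longrightarrow> v = 0" by blast
  qed
  obtain s1 where s1: "s1 > 0" "ball u0 s1 \<subseteq> B" "inj_on \<zeta> (ball u0 s1)"
    using locally_injective_of_C1[of B u0 \<zeta> \<zeta>'] \<zeta>(1,2) inj_\<zeta>'[OF u0_D small] r by auto
  have n_cont: "continuous_on B n"
    using n' by (auto intro!: continuous_at_imp_continuous_on has_derivative_continuous)
  then have "isCont (\<lambda>u. \<bar>n u \<bullet> e3\<bar>) u0"
    using r by (intro continuous_intros) (auto simp: continuous_on_eq_continuous_at)
  then obtain s2 where s2: "s2 > 0" "\<And>u. dist u u0 < s2 \<Longrightarrow> dist \<bar>n u \<bullet> e3\<bar> \<bar>n u0 \<bullet> e3\<bar> < 1 - \<bar>n u0 \<bullet> e3\<bar>"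
    unfolding continuous_at_eps_delta using small by (metis diff_gt_0_iff_gt)
  define s where "s = min s1 (min s2 r)"
  have s: "0 < s" "s \<le> s1" "s \<le> s2" "s \<le> r" using s1 s2 r by (auto simp: s_def)
  have sub: "ball u0 s \<subseteq> B" using s by auto
  have subD: "u \<in> D" if "u \<in> ball u0 s \<inter> half_plane" for u using that sub by auto
  have abs: "\<bar>n u \<bullet> e3\<bar> < 1" if "u \<in> ball u0 s" for u
    using s2(2)[of u] that s by (auto simp: dist_commute dist_real_def)
  have injs: "inj_on \<zeta> (ball u0 s)" using s1(3) s by (auto intro: inj_on_subset)
  have cont_\<zeta>: "continuous_on B \<zeta>"
    using \<zeta>(1) by (auto intro!: continuous_at_imp_continuous_on has_derivative_continuous)
  obtain h where h: "homeomorphism (ball u0 s) (\<zeta> ` ball u0 s) \<zeta> h"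
    using invariance_of_domain_homeomorphism[OF open_ball continuous_on_subset[OF cont_\<zeta> sub] _ injs] by auto
  have op: "open (\<zeta> ` W)" if "open W" "W \<subseteq> ball u0 s" for W
    using that sub injs
    by (intro invariance_of_domain_gen) (auto intro: continuous_on_subset[OF cont_\<zeta>] inj_on_subset)
  \<comment> \<open>On a catenoid the logarithmic derivative of the Gauss map in
    \<open>\<zeta>\<close> is the constant - c, which the exponential compensates.\<close>
  define Q where "Q u = stereo e1 e2 e3 (n u) * exp (of_real c * \<zeta> u)" for u
  \<comment> \<open>The derivative of \<open>Q\<close> in \<open>\<zeta>\<close>: by
    \<open>conformal_factor\<close> it can be computed in the one direction
    \<open>tangential (n u) e3\<close>, where \<open>plane_coord\<close> has the value
    \<open>1 - (n u \<bullet> e3)\<^sup>2\<close>.\<close>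
  define m where "m u = (stereo_deriv e1 e2 e3 (n u) (shape_op u (tangential (n u) e3)) / of_real (1 - (n u \<bullet> e3)\<^sup>2)
      + of_real c * stereo e1 e2 e3 (n u)) * exp (of_real c * \<zeta> u)" for u
  have Q': "(Q has_derivative (\<lambda>v. m u * \<zeta>' u v)) (at u)" if u: "u \<in> ball u0 s \<inter> half_plane" for u
  proof -
    note uD = subD[OF u]
    have n1: "n u \<bullet> e3 \<noteq> 1" "(n u \<bullet> e3)\<^sup>2 \<noteq> 1" using abs[of u] u by (auto simp: power2_eq_1_iff)
    then have ne0: "complex_of_real (1 - (n u \<bullet> e3)\<^sup>2) \<noteq> 0"
      using of_real_eq_0_iff[of "1 - (n u \<bullet> e3)\<^sup>2", where 'a = complex] by linarith
    have "of_real (1 - (n u \<bullet> e3)\<^sup>2) * stereo_deriv e1 e2 e3 (n u) (shape_op u (\<phi>' u v))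
      = stereo_deriv e1 e2 e3 (n u) (shape_op u (tangential (n u) e3)) * plane_coord (n u) e3 (\<phi>' u v)" for v
    proof (rule conformal_factor[OF _ unit[OF uD] ne tang[OF uD]])
      show "linear (\<lambda>w. stereo_deriv e1 e2 e3 (n u) (shape_op u w))"
        using linear_compose[OF linear_shape_op[OF uD] linear_stereo_deriv] by (simp add: o_def)
      show "stereo_deriv e1 e2 e3 (n u) (shape_op u (n u \<times> w)) = - \<i> * stereo_deriv e1 e2 e3 (n u) (shape_op u w)" for w
        using stereo_deriv_cross[OF frame unit[OF uD] shape_op_tang[OF uD], of w]
        by (simp add: shape_op_cross[OF uD] linear_neg[OF linear_stereo_deriv])
    qed
    then have *: "stereo_deriv e1 e2 e3 (n u) (n' u v)
      = stereo_deriv e1 e2 e3 (n u) (shape_op u (tangential (n u) e3)) / of_real (1 - (n u \<bullet> e3)\<^sup>2) * \<zeta>' u v" for v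
      using ne0 by (simp add: shape_op_\<phi>'[OF uD] \<zeta>(3)[OF uD] field_simps del: of_real_diff)
    have "((\<lambda>u. exp (of_real c * \<zeta> u)) has_derivative (\<lambda>v. (of_real c * \<zeta>' u v) * exp (of_real c * \<zeta> u))) (at u)"
    proof -
      have "((\<lambda>u. of_real c * \<zeta> u) has_derivative (\<lambda>v. of_real c * \<zeta>' u v)) (at u)"
        using \<zeta>(1)[of u] uD by (intro has_derivative_mult_right) auto
      from has_derivative_compose[OF this DERIV_exp[unfolded has_field_derivative_def]]
      show ?thesis by (simp add: mult.commute)
    qed
    from has_derivative_mult[OF has_derivative_stereo[of n "n' u" u e3 e1 e2] this]
    have "(Q has_derivative (\<lambda>v. stereo e1 e2 e3 (n u) * ((of_real c * \<zeta>' u v) * exp (of_real c * \<zeta> u))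
        + stereo_deriv e1 e2 e3 (n u) (n' u v) * exp (of_real c * \<zeta> u))) (at u)"
      using n' uD n1 by (simp add: Q_def[abs_def])
    then show ?thesis
      by (rule has_derivative_eq_rhs) (simp add: fun_eq_iff * m_def algebra_simps)
  qed
  have m0: "m u = 0" if u: "u \<in> ball u0 s \<inter> half_plane"
    and eq: "shape_op u (tangential (n u) e3) = - (c * (1 - (n u \<bullet> e3)\<^sup>2)) *\<^sub>R tangential (n u) e3" for u
  proof -
    have n1: "n u \<bullet> e3 \<noteq> 1" "(n u \<bullet> e3)\<^sup>2 \<noteq> 1" using abs[of u] u by (auto simp: power2_eq_1_iff)
    have ne0: "complex_of_real (1 - (n u \<bullet> e3)\<^sup>2) \<noteq> 0"
      using n1 of_real_eq_0_iff[of "1 - (n u \<bullet> e3)\<^sup>2", where 'a = complex] by linarith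
    have "stereo_deriv e1 e2 e3 (n u) (shape_op u (tangential (n u) e3))
        = - (c * (1 - (n u \<bullet> e3)\<^sup>2)) *\<^sub>R stereo e1 e2 e3 (n u)"
      unfolding eq linear_cmul[OF linear_stereo_deriv] stereo_deriv_axis[OF frame unit[OF subD[OF u]] n1(1)] ..
    also have "\<dots> = - of_real c * of_real (1 - (n u \<bullet> e3)\<^sup>2) * stereo e1 e2 e3 (n u)"
      by (simp add: scaleR_conv_of_real)
    finally show ?thesis using ne0 by (simp add: m_def del: of_real_diff)
  qed
  have norm_Q: "cmod (Q u) = exp (artanh (n u \<bullet> e3) + c * (\<phi> u \<bullet> e3))"
    if u: "u \<in> ball u0 s \<inter> half_plane" for u
    using norm_stereo[OF frame unit[OF subD[OF u]] abs[of u]] u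
    by (simp add: Q_def norm_mult norm_exp_eq_Re \<zeta>(4) exp_add)
  show thesis
    by (rule that[OF s(1) s(4) abs h op \<zeta>(1) inj_\<zeta>' Q' m0 norm_Q]) (use sub abs in auto)
qed

lemma upper_half_disc:
  assumes "0 < s"
  shows "open (ball u0 s \<inter> {u. u $ 2 > 0})" "connected (ball u0 s \<inter> {u. u $ 2 > 0})"
    "ball u0 s \<inter> {u. u $ 2 > 0} \<noteq> {}"
proof -
  show "open (ball u0 s \<inter> {u. u $ 2 > 0})"
    by (intro open_Int open_ball open_halfspace_component_gt_cart)
  have "convex {u :: real^2. u $ 2 > 0}"
    using convex_halfspace_gt[of 0 "axis 2 1 :: real^2"] by (simp add: inner_axis inner_commute)
  then show "connected (ball u0 s \<inter> {u. u $ 2 > 0})"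
    by (intro convex_connected convex_Int convex_ball)
  have "u0 + (s / 2) *\<^sub>R axis 2 1 \<in> ball u0 s \<inter> {u. u $ 2 > 0}"
    using assms u0 by (auto simp: half_plane_def dist_norm axis_def norm_axis_1[unfolded axis_def])
  then show "ball u0 s \<inter> {u. u $ 2 > 0} \<noteq> {}" by blast
qed

lemma potential_continuous:
  assumes "u \<in> B" "\<bar>n u \<bullet> e3\<bar> < 1"
  shows "isCont (\<lambda>u. artanh (n u \<bullet> e3) + c * (\<phi> u \<bullet> e3)) u"
proof -
  have "isCont \<phi> u" "isCont n u"
    using has_derivative_continuous[OF \<phi>'[OF assms(1)]] has_derivative_continuous[OF n'[OF assms(1)]] .
  moreover have "isCont artanh (n u \<bullet> e3)"
    using assms(2) by (intro isCont_artanh) auto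
  ultimately show ?thesis
    using isCont_o2[of u "\<lambda>u. n u \<bullet> e3" artanh]
    by (intro isCont_add isCont_mult continuous_const continuous_inner) auto
qed

text \<open>Constancy of the potential on \<open>W\<close> controls only |Q|, which is what the
  maximum modulus principle takes as input. It is applied on the open upper half disc; the edge
  follows by continuity. The radius \<open>s\<close> is fixed before \<open>W\<close> and
  \<open>k\<close>, so that one neighbourhood serves for all of them in the propagation.\<close>

lemma potential_unique_continuation:
  assumes frame: "oriented_frame e1 e2 e3" and small: "\<bar>n u0 \<bullet> e3\<bar> < 1"
  obtains s where "0 < s" "s \<le> r" "\<And>u. u \<in> ball u0 s \<Longrightarrow> \<bar>n u \<bullet> e3\<bar> < 1"
    "\<And>W k u. open W \<Longrightarrow> W \<noteq> {} \<Longrightarrow> W \<subseteq> ball u0 s \<inter> {u. u $ 2 > 0} \<Longrightarrow>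
      (\<And>u. u \<in> W \<Longrightarrow> artanh (n u \<bullet> e3) + c * (\<phi> u \<bullet> e3) = k) \<Longrightarrow>
      u \<in> ball u0 s \<inter> half_plane \<Longrightarrow> artanh (n u \<bullet> e3) + c * (\<phi> u \<bullet> e3) = k"
proof -
  obtain s \<zeta> \<zeta>' h Q m where s: "0 < s" "s \<le> r" "\<And>u. u \<in> ball u0 s \<Longrightarrow> \<bar>n u \<bullet> e3\<bar> < 1"
    and h: "homeomorphism (ball u0 s) (\<zeta> ` ball u0 s) \<zeta> h"
    and op: "\<And>W. open W \<Longrightarrow> W \<subseteq> ball u0 s \<Longrightarrow> open (\<zeta> ` W)"
    and \<zeta>': "\<And>u. u \<in> ball u0 s \<inter> half_plane \<Longrightarrow> (\<zeta> has_derivative \<zeta>' u) (at u)"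
    "\<And>u. u \<in> ball u0 s \<inter> half_plane \<Longrightarrow> inj (\<zeta>' u)"
    and Q': "\<And>u. u \<in> ball u0 s \<inter> half_plane \<Longrightarrow> (Q has_derivative (\<lambda>v. m u * \<zeta>' u v)) (at u)"
    and norm_Q: "\<And>u. u \<in> ball u0 s \<inter> half_plane \<Longrightarrow> cmod (Q u) = exp (artanh (n u \<bullet> e3) + c * (\<phi> u \<bullet> e3))"
    by (rule gauss_map_chart[OF assms, of c]) blast
  have up: "u \<in> ball u0 s \<inter> half_plane" if "u \<in> ball u0 s \<inter> {u. u $ 2 > 0}" for u
    using that by (auto simp: half_plane_def)
  have h_\<zeta>: "h (\<zeta> u) = u" if "u \<in> ball u0 s" for u using h that by (simp add: homeomorphism_apply1)
  have cont_\<zeta>: "continuous_on (ball u0 s) \<zeta>" using h by (simp add: homeomorphism_def)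
  let ?U = "ball u0 s \<inter> {u. u $ 2 > 0}"
  have "(\<lambda>z. Q (h z)) holomorphic_on \<zeta> ` ?U"
  proof (rule holomorphic_onI)
    fix z assume "z \<in> \<zeta> ` ?U"
    then obtain u where u: "u \<in> ?U" "z = \<zeta> u" by blast
    have "((\<lambda>z. Q (h z)) has_field_derivative m u) (at (\<zeta> u))"
      using u up by (intro holomorphic_in_coordinate[OF open_ball _ h op \<zeta>' Q']) auto
    then show "(\<lambda>z. Q (h z)) field_differentiable at z within \<zeta> ` ?U"
      using u field_differentiable_at_within field_differentiable_def by blast
  qed
  note hol = this
  have U: "open (\<zeta> ` ?U)" "connected (\<zeta> ` ?U)"
    using op[OF upper_half_disc(1)[OF s(1)]] connected_continuous_image[OF _ upper_half_disc(2)[OF s(1)], of \<zeta>]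
      continuous_on_subset[OF cont_\<zeta>] by auto
  have main: "artanh (n u \<bullet> e3) + c * (\<phi> u \<bullet> e3) = k"
    if W: "open W" "W \<noteq> {}" "W \<subseteq> ?U" and k: "\<And>u. u \<in> W \<Longrightarrow> artanh (n u \<bullet> e3) + c * (\<phi> u \<bullet> e3) = k"
      and u: "u \<in> ball u0 s \<inter> half_plane" for W k u
  proof -
    obtain w where w: "w \<in> W" using W by blast
    have norm_W: "cmod (Q x) = exp k" if "x \<in> W" for x
      using norm_Q[OF up] k[OF that] subsetD[OF W(3) that] by auto
    have "(\<lambda>z. Q (h z)) constant_on \<zeta> ` ?U"
    proof (rule maximum_modulus_principle[OF hol U])
      show "open (\<zeta> ` W)" "\<zeta> ` W \<subseteq> \<zeta> ` ?U" "\<zeta> w \<in> \<zeta> ` W"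
        using op[of W] W w by auto
      fix z assume "z \<in> \<zeta> ` W"
      then show "cmod (Q (h z)) \<le> cmod (Q (h (\<zeta> w)))"
        using W(3) w norm_W h_\<zeta> by (auto simp: subset_iff)
    qed
    then obtain q where q: "\<And>x. x \<in> ?U \<Longrightarrow> Q x = q"
      unfolding constant_on_def using h_\<zeta> by fastforce
    have "artanh (n x \<bullet> e3) + c * (\<phi> x \<bullet> e3) = k" if x: "x \<in> ?U" for x
    proof -
      have "cmod (Q x) = exp k" using q[OF x] q[OF subsetD[OF W(3) w]] norm_W[OF w] by simp
      then show ?thesis using norm_Q[OF up[OF x]] by simp
    qed
    then show ?thesis
      by (intro half_disc_limit[OF potential_continuous u]) (use u s in auto)
  qed
  show thesis by (rule that[OF s main])
qed

text \<open>Uniqueness for the Cauchy problem: \<open>Q\<close> extends by a constant across the boundary arc to a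
  function that is complex differentiable also on the arc, since \<open>m\<close> vanishes there.\<close>

lemma potential_Cauchy_uniqueness:
  assumes frame: "oriented_frame e1 e2 e3" and small: "\<bar>n u0 \<bullet> e3\<bar> < 1" and "u0 $ 2 = 0"
    and arc: "\<And>u. u \<in> B \<Longrightarrow> u $ 2 = 0 \<Longrightarrow>
      shape_op u (tangential (n u) e3) = - (c * (1 - (n u \<bullet> e3)\<^sup>2)) *\<^sub>R tangential (n u) e3"
  obtains s k where "0 < s" "s \<le> r" "\<And>u. u \<in> ball u0 s \<Longrightarrow> \<bar>n u \<bullet> e3\<bar> < 1"
    "\<And>u. u \<in> ball u0 s \<inter> half_plane \<Longrightarrow> artanh (n u \<bullet> e3) + c * (\<phi> u \<bullet> e3) = k"
proof -
  obtain s \<zeta> \<zeta>' h Q m where s: "0 < s" "s \<le> r" "\<And>u. u \<in> ball u0 s \<Longrightarrow> \<bar>n u \<bullet> e3\<bar> < 1"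
    and h: "homeomorphism (ball u0 s) (\<zeta> ` ball u0 s) \<zeta> h"
    and op: "\<And>W. open W \<Longrightarrow> W \<subseteq> ball u0 s \<Longrightarrow> open (\<zeta> ` W)"
    and \<zeta>': "\<And>u. u \<in> ball u0 s \<inter> half_plane \<Longrightarrow> (\<zeta> has_derivative \<zeta>' u) (at u)"
    "\<And>u. u \<in> ball u0 s \<inter> half_plane \<Longrightarrow> inj (\<zeta>' u)"
    and Q': "\<And>u. u \<in> ball u0 s \<inter> half_plane \<Longrightarrow> (Q has_derivative (\<lambda>v. m u * \<zeta>' u v)) (at u)"
    and m0: "\<And>u. u \<in> ball u0 s \<inter> half_plane \<Longrightarrow>
       shape_op u (tangential (n u) e3) = - (c * (1 - (n u \<bullet> e3)\<^sup>2)) *\<^sub>R tangential (n u) e3 \<Longrightarrow> m u = 0"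
    and norm_Q: "\<And>u. u \<in> ball u0 s \<inter> half_plane \<Longrightarrow> cmod (Q u) = exp (artanh (n u \<bullet> e3) + c * (\<phi> u \<bullet> e3))"
    by (rule gauss_map_chart[OF assms(1,2), of c]) blast
  have h_\<zeta>: "h (\<zeta> u) = u" if "u \<in> ball u0 s" for u using h that by (simp add: homeomorphism_apply1)
  have cont_\<zeta>: "continuous_on (ball u0 s) \<zeta>" using h by (simp add: homeomorphism_def)
  let ?A = "ball u0 s \<inter> {u. u $ 2 = 0}"
  have Q'0: "(Q has_derivative (\<lambda>v. 0)) (at u)" if "u \<in> ?A" for u
    using Q'[of u] m0[of u] arc[of u] that s by (auto simp: half_plane_def)
  have "convex ?A"
    using convex_hyperplane[of "axis 2 1 :: real^2" 0]
    by (intro convex_Int convex_ball) (simp add: inner_axis inner_commute)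
  then obtain q where q: "\<And>u. u \<in> ?A \<Longrightarrow> Q u = q"
    using has_derivative_zero_constant[of ?A Q] Q'0 has_derivative_at_withinI by blast
  define G where "G u = (if u $ 2 \<ge> 0 then Q u else q)" for u :: "real^2"
  have hol_at: "\<exists>d. ((\<lambda>z. G (h z)) has_field_derivative d) (at (\<zeta> u))" if u: "u \<in> ball u0 s" for u
  proof (cases "u $ 2" "0 :: real" rule: linorder_cases)
    case less
    let ?W = "ball u0 s \<inter> {u. u $ 2 < 0}"
    have W: "open ?W" by (intro open_Int open_ball open_halfspace_component_lt_cart)
    have "((\<lambda>z. G (h z)) has_field_derivative 0) (at (\<zeta> u))"
    proof (rule has_field_derivative_transform_within_open[where f = "\<lambda>z. q" and S = "\<zeta> ` ?W"])
      show "open (\<zeta> ` ?W)" using op[OF W] by auto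
      show "\<zeta> u \<in> \<zeta> ` ?W" using less u by auto
      show "q = G (h z)" if "z \<in> \<zeta> ` ?W" for z using that h_\<zeta> by (auto simp: G_def)
    qed auto
    then show ?thesis by blast
  next
    case greater
    let ?W = "ball u0 s \<inter> {u. u $ 2 > 0}"
    have W: "open ?W" by (intro open_Int open_ball open_halfspace_component_gt_cart)
    have "((\<lambda>z. Q (h z)) has_field_derivative m u) (at (\<zeta> u))"
      using u greater by (intro holomorphic_in_coordinate[OF open_ball _ h op \<zeta>' Q']) (auto simp: half_plane_def)
    then have "((\<lambda>z. G (h z)) has_field_derivative m u) (at (\<zeta> u))"
    proof (rule has_field_derivative_transform_within_open[where S = "\<zeta> ` ?W"])
      show "open (\<zeta> ` ?W)" using op[OF W] by auto
      show "\<zeta> u \<in> \<zeta> ` ?W" using greater u by auto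
      show "Q (h z) = G (h z)" if "z \<in> \<zeta> ` ?W" for z using that h_\<zeta> by (auto simp: G_def)
    qed
    then show ?thesis by blast
  next
    case equal
    then have uA: "u \<in> ?A" using u by auto
    \<comment> \<open>The derivative of \<open>G\<close> is 0 from both sides of the edge: from
      above because \<open>m u = 0\<close>, from below because \<open>G\<close> is the constant
      \<open>q = Q u\<close>.\<close>
    have 1: "(G has_derivative (\<lambda>v. 0)) (at u within {u. u $ 2 \<ge> 0})"
      by (rule has_derivative_transform[OF _ _ has_derivative_at_withinI[OF Q'0[OF uA]]])
         (use equal in \<open>auto simp: G_def\<close>)
    have 2: "(G has_derivative (\<lambda>v. 0)) (at u within {u. u $ 2 < 0})"
    proof -
      have "(G has_derivative (\<lambda>v. 0)) (at u within {u. u $ 2 < 0} \<union> {u})"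
        by (rule has_derivative_transform[of _ _ _ "\<lambda>_. q"]) (use equal q[OF uA] in \<open>auto simp: G_def\<close>)
      then show "(G has_derivative (\<lambda>v. 0)) (at u within {u. u $ 2 < 0})"
        using has_derivative_subset by blast
    qed
    have "(G has_derivative (\<lambda>v. 0)) (at u within {u. u $ 2 \<ge> 0} \<union> {u. u $ 2 < 0})"
      using 1 2 by (simp add: has_derivative_within Lim_within_Un)
    moreover have "{u :: real^2. u $ 2 \<ge> 0} \<union> {u. u $ 2 < 0} = UNIV" by auto
    ultimately have "(G has_derivative (\<lambda>v. 0 * \<zeta>' u v)) (at u)" by simp
    then have "((\<lambda>z. G (h z)) has_field_derivative 0) (at (\<zeta> u))"
      using u equal by (intro holomorphic_in_coordinate[OF open_ball _ h op \<zeta>']) (auto simp: half_plane_def)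
    then show ?thesis by blast
  qed
  \<comment> \<open>Holomorphy means complex differentiability at each point, so continuity of the
    derivative across the arc does not have to be proved.\<close>
  have hol: "(\<lambda>z. G (h z)) holomorphic_on \<zeta> ` ball u0 s"
    using hol_at unfolding field_differentiable_def[symmetric]
    by (intro holomorphic_onI) (auto intro: field_differentiable_at_within)
  let ?W = "ball u0 s \<inter> {u. u $ 2 < 0}"
  have "open ?W" by (intro open_Int open_ball open_halfspace_component_lt_cart)
  define w where "w = u0 - (s / 2) *\<^sub>R axis 2 1"
  have w: "w \<in> ?W" using s(1) \<open>u0 $ 2 = 0\<close> by (auto simp: w_def dist_norm axis_def norm_axis_1[unfolded axis_def])
  \<comment> \<open>\<open>G\<close> is constant on the lower half, so every point there is a local
    maximum of the modulus.\<close>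
  have "(\<lambda>z. G (h z)) constant_on \<zeta> ` ball u0 s"
  proof (rule maximum_modulus_principle[OF hol])
    show "open (\<zeta> ` ball u0 s)" "open (\<zeta> ` ?W)" using op \<open>open ?W\<close> by auto
    show "connected (\<zeta> ` ball u0 s)" using cont_\<zeta> by (intro connected_continuous_image) auto
    show "\<zeta> ` ?W \<subseteq> \<zeta> ` ball u0 s" "\<zeta> w \<in> \<zeta> ` ?W" using w by auto
    fix z assume "z \<in> \<zeta> ` ?W"
    then show "cmod (G (h z)) \<le> cmod (G (h (\<zeta> w)))"
      using h_\<zeta> w by (auto simp: G_def)
  qed
  then obtain q' where q': "\<And>x. x \<in> ball u0 s \<Longrightarrow> G x = q'"
    unfolding constant_on_def using h_\<zeta> by fastforce
  define k where "k = artanh (n u0 \<bullet> e3) + c * (\<phi> u0 \<bullet> e3)"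
  have "artanh (n u \<bullet> e3) + c * (\<phi> u \<bullet> e3) = k" if "u \<in> ball u0 s \<inter> half_plane" for u
  proof -
    have "u0 \<in> ball u0 s \<inter> half_plane" using s u0 by auto
    then have "Q u = Q u0" using q'[of u] q'[of u0] that by (auto simp: G_def half_plane_def)
    then show ?thesis using norm_Q[OF that] norm_Q[of u0] \<open>u0 \<in> ball u0 s \<inter> half_plane\<close> by (simp add: k_def)
  qed
  note main = this
  show thesis by (rule that[OF s main])
qed

end

section \<open>Free boundary charts\<close>

lemma local_param_image: "local_param S U \<phi> \<Longrightarrow> u \<in> U \<inter> half_plane \<Longrightarrow> \<phi> u \<in> S"
  by (auto simp: local_param_def dest!: openin_imp_subset)

lemma smooth_on_locally:
  assumes "smooth_on S f" "p \<in> S"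
  obtains W g where "open W" "p \<in> W" "\<And>k. Ck_on k g W" "\<And>x. x \<in> S \<inter> W \<Longrightarrow> g x = f x"
  using assms unfolding smooth_on_def by metis

text \<open>The normal field lives on \<open>S\<close> only. A local smooth extension
  \<open>M\<close> composed with \<open>\<phi>\<close> gives a smooth \<open>n\<close> on a full
  disc, and the derivative of \<open>N\<close> within \<open>S\<close> has to be matched with that
  of \<open>n\<close>.\<close>

lemma surface_chart_exists:
  assumes N: "unit_normal_field S N" and H: "minimal_surface S N"
    and param: "local_param S U \<phi>" and u0: "u0 \<in> U \<inter> half_plane"
  obtains r n \<phi>' n' \<phi>'' n'' where "ball u0 r \<subseteq> U" "surface_chart \<phi> n \<phi>' n' \<phi>'' n'' u0 r"
    "\<And>u. u \<in> ball u0 r \<inter> half_plane \<Longrightarrow> n u = N (\<phi> u)"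
    "\<And>u v. u \<in> ball u0 r \<inter> half_plane \<Longrightarrow> shape_operator S N (\<phi> u) (\<phi>' u v) = - n' u v"
proof -
  have U: "open U" and \<phi>: "smooth_on U \<phi>" using param by (auto simp: local_param_def)
  obtain W1 g where W1: "open W1" "u0 \<in> W1" "\<And>k. Ck_on k g W1" "\<And>x. x \<in> U \<inter> W1 \<Longrightarrow> g x = \<phi> x"
    using smooth_on_locally[OF \<phi>, of u0] u0 by auto
  obtain W2 M where W2: "open W2" "\<phi> u0 \<in> W2" "\<And>k. Ck_on k M W2" "\<And>x. x \<in> S \<inter> W2 \<Longrightarrow> M x = N x"
    using smooth_on_locally[of S N "\<phi> u0"] N local_param_image[OF param u0] by (auto simp: unit_normal_field_def)
  have V: "open (U \<inter> W1)" using U W1 by blast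
  have \<phi>V: "Ck_on k \<phi> (U \<inter> W1)" for k
    by (rule Ck_on_cong[OF V W1(4) Ck_on_subset[OF W1(3)]]) auto
  have "open (U \<inter> W1 \<inter> \<phi> -` W2)"
    using \<phi>V[of 0] V W2(1) by (intro continuous_open_preimage) auto
  moreover have "u0 \<in> U \<inter> W1 \<inter> \<phi> -` W2" using u0 W1 W2 by auto
  ultimately obtain r where r: "r > 0" "ball u0 r \<subseteq> U \<inter> W1 \<inter> \<phi> -` W2"
    using open_contains_ball by blast
  let ?B = "ball u0 r" and ?D = "ball u0 r \<inter> half_plane"
  define n where "n u = M (\<phi> u)" for u
  have \<phi>B: "Ck_on k \<phi> ?B" for k using Ck_on_subset[OF \<phi>V] r(2) by blast
  have nB: "Ck_on k n ?B" for k
    unfolding n_def using r(2) by (intro Ck_on_compose[OF open_ball W2(1) _ \<phi>B W2(3)]) auto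
  have C2: "(f has_derivative frechet_derivative f (at u)) (at u)"
    "((\<lambda>u. frechet_derivative f (at u) v) has_derivative
      frechet_derivative (\<lambda>u. frechet_derivative f (at u) v) (at u)) (at u)"
    "continuous_on ?B (\<lambda>u. frechet_derivative (\<lambda>u. frechet_derivative f (at u) v) (at u) w)"
    if f: "\<And>k. Ck_on k f ?B" and "u \<in> ?B" for f :: "real^2 \<Rightarrow> real^3" and u v w
  proof -
    have "Ck_on (Suc (Suc 0)) f ?B" by (rule f)
    then have 1: "Ck_on (Suc 0) (\<lambda>u. frechet_derivative f (at u) v) ?B" by simp
    show "(f has_derivative frechet_derivative f (at u)) (at u)"
      using Ck_on_Suc_D[OF f that(2)] .
    show "((\<lambda>u. frechet_derivative f (at u) v) has_derivative
      frechet_derivative (\<lambda>u. frechet_derivative f (at u) v) (at u)) (at u)"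
      using Ck_on_Suc_D[OF 1 that(2)] .
    show "continuous_on ?B (\<lambda>u. frechet_derivative (\<lambda>u. frechet_derivative f (at u) v) (at u) w)"
      using 1 by simp
  qed
  define \<phi>' where "\<phi>' u = frechet_derivative \<phi> (at u)" for u
  define n' where "n' u = frechet_derivative n (at u)" for u
  define \<phi>'' where "\<phi>'' u v = frechet_derivative (\<lambda>u. \<phi>' u v) (at u)" for u v
  define n'' where "n'' u v = frechet_derivative (\<lambda>u. n' u v) (at u)" for u v
  have UD: "u \<in> U \<inter> half_plane" if "u \<in> ?D" for u using that r(2) by auto
  have inS: "\<phi> u \<in> S \<inter> W2" if "u \<in> ?D" for u
    using local_param_image[OF param UD[OF that]] that r(2) by auto
  have nN: "n u = N (\<phi> u)" if "u \<in> ?D" for u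
    using inS[OF that] W2(4) by (simp add: n_def)
  have unit: "norm (n u) = 1" if "u \<in> ?D" for u
    using nN[OF that] inS[OF that] N by (simp add: unit_normal_field_def)
  have tang: "\<phi>' u v \<bullet> n u = 0" if "u \<in> ?D" for u v
  proof -
    have "\<phi>' u v \<in> tangent_plane S (\<phi> u)"
      unfolding tangent_plane_def \<phi>'_def using param UD[OF that] by blast
    then show ?thesis
      using N inS[OF that] nN[OF that] by (auto simp: unit_normal_field_def inner_commute[of _ "N _"])
  qed
  have n'_tang: "n' u v \<bullet> n u = 0" if "u \<in> ?D" for u v
    using unit_field_derivative_tangent[OF C2(1)[OF nB] that unit] that by (auto simp: n'_def)
  have shape: "shape_operator S N (\<phi> u) (\<phi>' u v) = - n' u v" "linear (frechet_derivative N (at (\<phi> u) within S))"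
    if u: "u \<in> ?D" for u v
  proof -
    define p where "p = \<phi> u"
    define N' where "N' = frechet_derivative N (at p within S)"
    have p: "p \<in> S \<inter> W2" using inS[OF u] by (simp add: p_def)
    obtain d where d: "d > 0" "ball p d \<subseteq> W2"
      using openE[OF W2(1) IntD2[OF p]] .
    have "(M has_derivative frechet_derivative M (at p)) (at p within S)"
      by (rule has_derivative_at_withinI[OF Ck_on_Suc_D[OF W2(3) IntD2[OF p]]])
    then have "(N has_derivative frechet_derivative M (at p)) (at p within S)"
    proof (rule has_derivative_transform_within[OF _ d(1)])
      show "p \<in> S" using p by blast
      show "M x = N x" if "x \<in> S" "dist x p < d" for x
        using W2(4)[of x] d(2) that by (simp add: subset_iff dist_commute)
    qed
    then have "N differentiable (at p within S)" by (rule differentiableI)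
    then have N': "(N has_derivative N') (at p within S)"
      by (simp only: frechet_derivative_works N'_def)
    then show "linear (frechet_derivative N (at (\<phi> u) within S))"
      unfolding N'_def p_def by (rule has_derivative_linear)
    have "((\<lambda>x. N (\<phi> x)) has_derivative (\<lambda>v. N' (\<phi>' u v))) (at u within ?D)"
    proof (rule has_derivative_in_compose[where f = \<phi> and g = N and f' = "\<phi>' u" and g' = N'])
      show "(\<phi> has_derivative \<phi>' u) (at u within ?D)"
        unfolding \<phi>'_def using u by (intro has_derivative_at_withinI[OF C2(1)[OF \<phi>B]]) blast
      show "(N has_derivative N') (at (\<phi> u) within \<phi> ` ?D)"
        unfolding p_def[symmetric] by (rule has_derivative_subset[OF N']) (use inS in blast)
    qed
    then have "(n has_derivative (\<lambda>v. N' (\<phi>' u v))) (at u within ?D)"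
      by (rule has_derivative_transform[OF u nN, rotated])
    moreover have "(n has_derivative n' u) (at u within ?D)"
      unfolding n'_def using u by (intro has_derivative_at_withinI[OF C2(1)[OF nB]]) blast
    \<comment> \<open>\<open>frechet_derivative N (at p within S)\<close> is a choice that is not
      determined in the normal direction. On tangent vectors the chain rule and uniqueness of
      derivatives on half discs pin it down.\<close>
    ultimately have eq: "(\<lambda>v. N' (\<phi>' u v)) = n' u"
      using u by (rule half_disc_derivative_unique)
    then have "N' (\<phi>' u v) = n' u v" by (rule fun_cong)
    then show "shape_operator S N (\<phi> u) (\<phi>' u v) = - n' u v"
      using nN[OF u] tangential_eq[OF n'_tang[OF u]]
      by (simp add: shape_operator_def N'_def p_def)
  qed
  have "surface_chart \<phi> n \<phi>' n' \<phi>'' n'' u0 r"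
  proof
    fix u assume u: "u \<in> ?D"
    define N' where "N' = frechet_derivative N (at (\<phi> u) within S)"
    have N': "linear N'" using shape(2)[OF u] by (simp add: N'_def)
    \<comment> \<open>Up to sign the map whose trace is \<open>mean_curvature\<close>; projecting
      the argument first removes the dependence on the choice behind \<open>N'\<close>.\<close>
    define L where "L x = tangential (n u) (N' (tangential (n u) x))" for x
    have lin_tang: "linear (tangential m)" for m
      by (intro linearI) (simp_all add: tangential_def inner_add_left algebra_simps)
    have L: "linear L"
      unfolding L_def using linear_compose[OF linear_compose[OF lin_tang N'] lin_tang] by (simp add: o_def)
    have Leq: "L x = - shape_operator S N (\<phi> u) (tangential (N (\<phi> u)) x)" for x
      by (simp add: L_def shape_operator_def N'_def nN[OF u])
    have "trace (matrix (\<lambda>x. - L x)) = 0"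
      using H inS[OF u] by (simp add: minimal_surface_def mean_curvature_def Leq)
    then have "trace (matrix L) = 0"
      by (simp add: trace_def matrix_def sum_negf)
    moreover have "L (n u) = 0"
      using unit[OF u] linear_0[OF N'] by (simp add: L_def tangential_def dot_square_norm)
    moreover have "L (\<phi>' u v) = n' u v" for v
      using Leq tangential_eq[OF tang[OF u, of v]] shape(1)[OF u, of v] nN[OF u] by simp
    ultimately show "\<exists>L. linear L \<and> trace (matrix L) = 0 \<and> L (n u) = 0 \<and> (\<forall>v. L (\<phi>' u v) = n' u v)"
      using L by blast
    show "inj (\<phi>' u)" using param UD[OF u] by (auto simp: local_param_def \<phi>'_def)
  next
    show "continuous_on ?B (\<lambda>u. \<phi>'' u v w)" for v w
      using C2(3)[OF \<phi>B, of u0] r by (simp add: \<phi>''_def \<phi>'_def)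
    show "continuous_on ?B (\<lambda>u. n'' u v w)" for v w
      using C2(3)[OF nB, of u0] r by (simp add: n''_def n'_def)
  qed (use r u0 C2(1,2)[OF \<phi>B] C2(1,2)[OF nB] unit tang in \<open>auto simp: \<phi>''_def \<phi>'_def n''_def n'_def\<close>)
  then show thesis
    using that r(2) nN shape(1) by blast
qed

lemma collar_contains:
  assumes c: "curve_in S p q c" and "curve_length c < \<epsilon>" and "p \<in> S" "q \<in> \<gamma>"
  shows "p \<in> collar S \<gamma> \<epsilon>"
proof -
  have len_ge: "curve_length c \<ge> 0" if "curve_in S p q c" for c q
    using that unfolding curve_length_def curve_in_def by (intro integral_nonneg) auto
  have "intrinsic_dist S p q \<le> curve_length c"
    unfolding intrinsic_dist_def using c len_ge
    by (intro cINF_lower) (auto intro!: bdd_belowI2[of _ 0])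
  \<comment> \<open>If no admissible curve joins \<open>p\<close> to \<open>q'\<close>, the
    intrinsic distance is \<open>Inf {}\<close>, an unspecified real number; the lower bound has to
    allow for it.\<close>
  moreover have "min 0 (Inf {}) \<le> intrinsic_dist S p q'" for q'
  proof (cases "{c. curve_in S p q' c} = {}")
    case True
    then show ?thesis by (simp add: intrinsic_dist_def)
  next
    case False
    then have "0 \<le> intrinsic_dist S p q'"
      unfolding intrinsic_dist_def using len_ge by (intro cINF_greatest) auto
    then show ?thesis by simp
  qed
  then have "(INF q\<in>\<gamma>. intrinsic_dist S p q) \<le> intrinsic_dist S p q"
    using \<open>q \<in> \<gamma>\<close> by (intro cINF_lower bdd_belowI2) auto
  ultimately show ?thesis using assms by (simp add: collar_def)
qed

text \<open>\<open>(p, c)\<close> and \<open>(q, d)\<close> are orthogonal to the same nonzero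
  vector \<open>(a, - b)\<close>, hence parallel. This removes the coefficients of the dependence,
  which vary from point to point without any regularity.\<close>

lemma dependent_pair_det:
  fixes a b c d p q :: real
  assumes "a \<noteq> 0 \<or> b \<noteq> 0" "a * p = b * c" "a * q = b * d"
  shows "p * d = q * c"
  using assms by (cases "a = 0") (auto, metis mult.assoc mult.commute mult_left_cancel)

section \<open>Collar neighbourhoods and boundary arcs in a chart\<close>

context surface_chart
begin

text \<open>The segment from \<open>u\<close> to \<open>u0\<close> maps to a curve in
  \<open>S\<close> of length at most \<open>K * norm (u0 - u)\<close>, where \<open>K\<close> bounds
  the derivative of \<open>\<phi>\<close>. This bounds the intrinsic distance by the distance in the
  chart.\<close>

lemma collar_in_chart:
  assumes S: "\<And>u. u \<in> D \<Longrightarrow> \<phi> u \<in> S" and "\<phi> u0 \<in> \<gamma>" and \<epsilon>: "\<epsilon> > 0"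
  obtains \<delta> where "0 < \<delta>" "\<delta> \<le> r" "\<And>u. u \<in> ball u0 \<delta> \<inter> half_plane \<Longrightarrow> \<phi> u \<in> collar S \<gamma> \<epsilon>"
proof -
  define h where "h u = (\<Sum>i\<in>Basis. norm (\<phi>' u i))" for u
  have \<phi>'_cont: "continuous_on B (\<lambda>u. \<phi>' u v)" for v
    using \<phi>'' by (auto intro!: continuous_at_imp_continuous_on has_derivative_continuous)
  have sub: "cball u0 (r / 2) \<subseteq> B" using r by auto
  have "compact (h ` cball u0 (r / 2))"
    unfolding h_def using continuous_on_subset[OF \<phi>'_cont sub]
    by (intro compact_continuous_image continuous_intros) auto
  then obtain K where K: "\<And>u. u \<in> cball u0 (r / 2) \<Longrightarrow> h u \<le> K" "K > 0"
    using compact_imp_bounded bounded_pos by (metis abs_le_D1 image_eqI real_norm_def)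
  have \<phi>'_le: "norm (\<phi>' u v) \<le> K * norm v" if u: "u \<in> cball u0 (r / 2)" for u v
  proof -
    have bl: "bounded_linear (\<phi>' u)" using \<phi>' sub u has_derivative_bounded_linear by blast
    have "norm (\<phi>' u v) \<le> onorm (\<phi>' u) * norm v" by (rule onorm[OF bl])
    also have "\<dots> \<le> K * norm v"
      using onorm_componentwise[OF bl] K(1)[OF u] by (intro mult_right_mono) (auto simp: h_def)
    finally show ?thesis .
  qed
  \<comment> \<open>\<open>r / 2\<close> keeps the segment in the compact disc on which
    \<open>K\<close> is a bound; the factor 2 makes \<open>K * \<delta> < \<epsilon>\<close>
    strict.\<close>
  define \<delta> where "\<delta> = min (r / 2) (\<epsilon> / (2 * K))"
  have \<delta>: "0 < \<delta>" "\<delta> \<le> r / 2" "K * \<delta> < \<epsilon>"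
    using r K(2) \<epsilon> by (auto simp: \<delta>_def min_def field_simps)
  have "\<phi> u \<in> collar S \<gamma> \<epsilon>" if u: "u \<in> ball u0 \<delta> \<inter> half_plane" for u
  proof -
    define l where "l t = u + t *\<^sub>R (u0 - u)" for t
    have l: "l t \<in> ball u0 \<delta> \<inter> half_plane" if "t \<in> {0..1}" for t
    proof -
      have "convex (ball u0 \<delta> \<inter> half_plane)" by (intro convex_Int convex_ball convex_half_plane)
      then have "(1 - t) *\<^sub>R u + t *\<^sub>R u0 \<in> ball u0 \<delta> \<inter> half_plane"
        using u u0 \<delta> that by (intro convexD_alt) auto
      then show ?thesis by (simp add: l_def algebra_simps)
    qed
    have l_B: "l t \<in> cball u0 (r / 2)" "l t \<in> D" if "t \<in> {0..1}" for t
      using l[OF that] \<delta> r by auto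
    have l_cont: "continuous_on {0..1} l" unfolding l_def by (intro continuous_intros)
    define c where "c t = \<phi> (l t)" for t
    have c': "(c has_vector_derivative \<phi>' (l t) (u0 - u)) (at t)" if "t \<in> {0..1}" for t
    proof -
      have "(c has_derivative (\<lambda>x. \<phi>' (l t) (x *\<^sub>R (u0 - u)))) (at t)"
        unfolding c_def using l_B[OF that]
        by (intro has_derivative_compose[where f = l and g = \<phi>, OF _ \<phi>']) (auto simp: l_def[abs_def] intro!: derivative_eq_intros)
      moreover have "\<phi>' (l t) (x *\<^sub>R (u0 - u)) = x *\<^sub>R \<phi>' (l t) (u0 - u)" for x
        using linear_\<phi>' l_B[OF that] by (simp add: linear_cmul)
      ultimately show ?thesis by (simp add: has_vector_derivative_def)
    qed
    have c'_cont: "continuous_on {0..1} (\<lambda>t. \<phi>' (l t) (u0 - u))"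
      using l_B by (intro continuous_on_compose2[OF \<phi>'_cont l_cont]) auto
    have vd: "vector_derivative c (at t) = \<phi>' (l t) (u0 - u)" if "t \<in> {0..1}" for t
      using c'[OF that] by (rule vector_derivative_at)
    have int: "(\<lambda>t. norm (\<phi>' (l t) (u0 - u))) integrable_on {0..1}"
      by (intro integrable_continuous_real continuous_intros c'_cont)
    have "curve_in S (\<phi> u) (\<phi> u0) c"
      unfolding curve_in_def
    proof (intro conjI)
      show "valid_path c"
        unfolding valid_path_def
        unfolding C1_differentiable_on_def
        by (intro C1_differentiable_imp_piecewise) (metis C1_differentiable_on_def c' c'_cont)
      show "(\<lambda>t. norm (vector_derivative c (at t))) integrable_on {0..1}"
        using int by (rule integrable_eq) (simp add: vd)
      show "path_image c \<subseteq> S" using S l_B by (auto simp: path_image_def c_def)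
    qed (auto simp: pathstart_def pathfinish_def c_def l_def)
    moreover have "curve_length c < \<epsilon>"
    proof -
      have "curve_length c = integral {0..1} (\<lambda>t. norm (\<phi>' (l t) (u0 - u)))"
        unfolding curve_length_def by (intro integral_cong) (simp add: vd)
      also have "\<dots> \<le> integral {0..1} (\<lambda>t::real. K * norm (u0 - u))"
        using int by (intro integral_le \<phi>'_le l_B) auto
      also have "\<dots> = K * norm (u0 - u)" by simp
      also have "\<dots> \<le> K * \<delta>" using u K(2) by (intro mult_left_mono) (auto simp: dist_norm)
      finally show ?thesis using \<delta>(3) by simp
    qed
    moreover have "u \<in> D" using u \<delta> r by auto
    ultimately show ?thesis
      using S \<open>\<phi> u0 \<in> \<gamma>\<close> by (intro collar_contains)
  qed
  moreover have "\<delta> \<le> r" using \<delta>(2) r by linarith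
  ultimately show thesis using \<delta>(1) that by blast
qed

lemma arc_constant:
  fixes f :: "real^2 \<Rightarrow> 'b::real_normed_vector"
  assumes "u0 $ 2 = 0"
    and f': "\<And>u. u \<in> B \<Longrightarrow> u $ 2 = 0 \<Longrightarrow> (f has_derivative f' u) (at u)"
    and zero: "\<And>u. u \<in> B \<Longrightarrow> u $ 2 = 0 \<Longrightarrow> f' u (axis 1 1) = 0"
    and u: "u \<in> B" "u $ 2 = 0"
  shows "f u = f u0"
proof -
  define l where "l t = u0 + t *\<^sub>R axis 1 1" for t
  have l: "l t \<in> B" "l t $ 2 = 0" if "t \<in> {-r<..<r}" for t
    using that assms(1) by (auto simp: l_def dist_norm axis_def norm_axis_1[unfolded axis_def])
  have "((\<lambda>t. f (l t)) has_derivative (\<lambda>h. 0)) (at t within {-r<..<r})" if t: "t \<in> {-r<..<r}" for t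
  proof -
    have "((\<lambda>t. f (l t)) has_derivative (\<lambda>x. f' (l t) (x *\<^sub>R axis 1 1))) (at t)"
      using l[OF t]
      by (intro has_derivative_compose[where f = l and g = f, OF _ f']) (auto simp: l_def[abs_def] intro!: derivative_eq_intros)
    moreover have "f' (l t) (x *\<^sub>R axis 1 1) = 0" for x
      using has_derivative_linear[OF f'[OF l[OF t]]] zero[OF l[OF t]] by (simp add: linear_cmul)
    ultimately show ?thesis using has_derivative_at_withinI by fastforce
  qed
  then have "\<exists>k. \<forall>t\<in>{-r<..<r}. f (l t) = k"
    by (intro has_derivative_zero_constant) auto
  then obtain k where k: "\<And>t. t \<in> {-r<..<r} \<Longrightarrow> f (l t) = k" by blast
  define t where "t = u $ 1 - u0 $ 1"
  have lt: "l t = u" using u assms(1) by (auto simp: l_def t_def vec_eq_iff forall_2 axis_def)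
  have "\<bar>t\<bar> \<le> norm (u - u0)" using component_le_norm_cart[of "u - u0" 1] by (simp add: t_def)
  also have "\<dots> < r" using u(1) by (simp add: dist_norm norm_minus_commute)
  finally have "t \<in> {-r<..<r}" by auto
  then show ?thesis using k[of t] k[of 0] r lt by (simp add: l_def)
qed

lemma arc_derivative_zero:
  fixes f :: "real^2 \<Rightarrow> 'b::real_normed_vector"
  assumes f': "(f has_derivative f') (at u)" and u: "u \<in> B" "u $ 2 = 0"
    and const: "\<And>u. u \<in> B \<Longrightarrow> u $ 2 = 0 \<Longrightarrow> f u = c"
  shows "f' (axis 1 1) = 0"
proof -
  define l where "l t = u + t *\<^sub>R axis 1 1" for t
  have "((\<lambda>t. f (l t)) has_derivative (\<lambda>x. f' (x *\<^sub>R axis 1 1))) (at 0)"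
    using f' by (intro has_derivative_compose[where f = l and g = f])
      (auto simp: l_def[abs_def] intro!: derivative_eq_intros)
  moreover have "((\<lambda>t. f (l t)) has_derivative (\<lambda>x. 0)) (at 0)"
  proof (rule has_derivative_transform_within_open)
    show "((\<lambda>_. c) has_derivative (\<lambda>x. 0)) (at (0::real))" by simp
    show "open (l -` B)"
      unfolding l_def by (intro open_vimage open_ball) (auto intro!: continuous_intros)
    show "0 \<in> l -` B" using u by (simp add: l_def)
    show "c = f (l t)" if "t \<in> l -` B" for t
      using const[of "l t"] that u by (simp add: l_def axis_def)
  qed
  ultimately have "(\<lambda>x. f' (x *\<^sub>R axis 1 1)) = (\<lambda>x. 0)" by (rule has_derivative_unique)
  from fun_cong[OF this, of 1] show ?thesis by simp
qed

lemma \<phi>'_coordinates: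
  assumes "u \<in> B" shows "\<phi>' u v = v $ 1 *\<^sub>R \<phi>' u (axis 1 1) + v $ 2 *\<^sub>R \<phi>' u (axis 2 1)"
proof -
  have "v = v $ 1 *\<^sub>R axis 1 1 + v $ 2 *\<^sub>R axis 2 1"
    by (simp add: vec_eq_iff forall_2 axis_def)
  then have "\<phi>' u v = \<phi>' u (v $ 1 *\<^sub>R axis 1 1 + v $ 2 *\<^sub>R axis 2 1)" by simp
  then show ?thesis using linear_\<phi>'[OF assms] by (simp add: linear_add linear_cmul)
qed

lemma tangent_orthogonal_zero:
  assumes "u \<in> D" "y \<bullet> n u = 0" "y \<bullet> \<phi>' u (axis 1 1) = 0" "y \<bullet> \<phi>' u (axis 2 1) = 0"
  shows "y = 0"
proof -
  obtain v where "y = \<phi>' u v" using tangent_surj assms(1,2) by blast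
  then have "y \<bullet> y = y \<bullet> (v $ 1 *\<^sub>R \<phi>' u (axis 1 1) + v $ 2 *\<^sub>R \<phi>' u (axis 2 1))"
    using \<phi>'_coordinates[of u v] assms(1) by simp
  then show ?thesis using assms(3,4) by (simp add: inner_add_right)
qed

end

text \<open>The assumption \<open>dependent\<close> is linear dependence of \<open>x\<^sup>T\<close> and \<open>A x\<^sup>T\<close>: these are the gradients of
  \<open>norm x ^ 2 / 2\<close> and, up to sign, of the support function \<open>x \<bullet> N\<close>.\<close>

locale free_boundary_chart = surface_chart +
  assumes u0_boundary: "u0 $ 2 = 0"
    and on_sphere: "\<And>u. u \<in> ball u0 r \<Longrightarrow> u $ 2 = 0 \<Longrightarrow> norm (\<phi> u) = 1"
    and orth: "\<And>u. u \<in> ball u0 r \<Longrightarrow> u $ 2 = 0 \<Longrightarrow> \<phi> u \<bullet> n u = 0"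
    and dependent: "\<And>u v w. u \<in> ball u0 r \<inter> half_plane \<Longrightarrow>
      (\<phi> u \<bullet> \<phi>' u v) * (\<phi> u \<bullet> n' u w) = (\<phi> u \<bullet> \<phi>' u w) * (\<phi> u \<bullet> n' u v)"
begin

abbreviation "X1 \<equiv> axis 1 1 :: real^2"
abbreviation "X2 \<equiv> axis 2 1 :: real^2"

lemma arc_D: "u \<in> B \<Longrightarrow> u $ 2 = 0 \<Longrightarrow> u \<in> D" by (simp add: half_plane_def)

text \<open>Differentiate |x|^2 = 1 and x . N = 0 along the edge. The second result is
  Joachimsthal's theorem: the position vector is a principal direction.\<close>

lemma arc_tangent:
  assumes u: "u \<in> B" "u $ 2 = 0"
  shows "\<phi> u \<bullet> \<phi>' u X1 = 0" "\<phi> u \<bullet> n' u X1 = 0"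
proof -
  have "((\<lambda>u. \<phi> u \<bullet> \<phi> u) has_derivative (\<lambda>v. \<phi> u \<bullet> \<phi>' u v + \<phi>' u v \<bullet> \<phi> u)) (at u)"
    using \<phi>'[OF u(1)] by (intro has_derivative_inner)
  from arc_derivative_zero[OF this u, of 1] show "\<phi> u \<bullet> \<phi>' u X1 = 0"
    using on_sphere by (simp add: dot_square_norm inner_commute)
  have "((\<lambda>u. \<phi> u \<bullet> n u) has_derivative (\<lambda>v. \<phi> u \<bullet> n' u v + \<phi>' u v \<bullet> n u)) (at u)"
    using \<phi>'[OF u(1)] n'[OF u(1)] by (intro has_derivative_inner)
  from arc_derivative_zero[OF this u orth] show "\<phi> u \<bullet> n' u X1 = 0"
    using tang[OF arc_D[OF u]] by simp
qed

lemma arc_conormal: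
  assumes u: "u \<in> B" "u $ 2 = 0" shows "\<phi> u \<bullet> \<phi>' u X2 \<noteq> 0"
proof
  assume "\<phi> u \<bullet> \<phi>' u X2 = 0"
  then have "\<phi> u = 0"
    using tangent_orthogonal_zero[OF arc_D[OF u] orth[OF u]] arc_tangent(1)[OF u] by blast
  then show False using on_sphere[OF u] by simp
qed

text \<open>On the arc, the eigenvalue mu of \<open>shape_op\<close> at the position vector, written
  as the quotient of the \<open>X2\<close>-derivatives of x . N and |x|^2 / 2. In this form it can
  be compared with the dependence relation.\<close>

definition "curv u = (\<phi> u \<bullet> n' u X2) / (\<phi> u \<bullet> \<phi>' u X2)"

text \<open>Differentiate the dependence relation in the transversal direction \<open>X2\<close> at
  a point of the arc. Since \<open>\<phi> u \<bullet> \<phi>' u X1\<close> and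
  \<open>\<phi> u \<bullet> n' u X1\<close> vanish there, what remains, after exchanging mixed
  derivatives, is the numerator of the derivative of \<open>curv\<close> along the arc.\<close>

lemma curv_constant:
  assumes "u \<in> B" "u $ 2 = 0" shows "curv u = curv u0"
proof -
  have pn': "((\<lambda>u. \<phi> u \<bullet> n' u v) has_derivative (\<lambda>w. \<phi> u \<bullet> n'' u v w + \<phi>' u w \<bullet> n' u v)) (at u)"
    and pp': "((\<lambda>u. \<phi> u \<bullet> \<phi>' u v) has_derivative (\<lambda>w. \<phi> u \<bullet> \<phi>'' u v w + \<phi>' u w \<bullet> \<phi>' u v)) (at u)"
    if "u \<in> B" for u v
    using \<phi>' n'' \<phi>'' that by (auto intro!: has_derivative_inner)
  define c' where "c' u w = ((\<phi> u \<bullet> n'' u X2 w + \<phi>' u w \<bullet> n' u X2) * (\<phi> u \<bullet> \<phi>' u X2)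
     - (\<phi> u \<bullet> n' u X2) * (\<phi> u \<bullet> \<phi>'' u X2 w + \<phi>' u w \<bullet> \<phi>' u X2)) / ((\<phi> u \<bullet> \<phi>' u X2) * (\<phi> u \<bullet> \<phi>' u X2))" for u w
  show ?thesis
  proof (rule arc_constant[OF u0_boundary _ _ assms, where f' = c'])
    fix u assume u: "u \<in> B" "u $ 2 = 0"
    show "(curv has_derivative c' u) (at u)"
      unfolding curv_def[abs_def] c'_def
      by (rule has_derivative_divide'[OF pn'[OF u(1)] pp'[OF u(1)] arc_conormal[OF u]])
    define F where "F x = (\<phi> x \<bullet> \<phi>' x X1) * (\<phi> x \<bullet> n' x X2) - (\<phi> x \<bullet> \<phi>' x X2) * (\<phi> x \<bullet> n' x X1)" for x
    define F' where "F' w = ((\<phi> u \<bullet> \<phi>' u X1) * (\<phi> u \<bullet> n'' u X2 w + \<phi>' u w \<bullet> n' u X2)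
       + (\<phi> u \<bullet> \<phi>'' u X1 w + \<phi>' u w \<bullet> \<phi>' u X1) * (\<phi> u \<bullet> n' u X2))
       - ((\<phi> u \<bullet> \<phi>' u X2) * (\<phi> u \<bullet> n'' u X1 w + \<phi>' u w \<bullet> n' u X1)
       + (\<phi> u \<bullet> \<phi>'' u X2 w + \<phi>' u w \<bullet> \<phi>' u X2) * (\<phi> u \<bullet> n' u X1))" for w
    have F: "(F has_derivative F') (at u)"
      unfolding F_def[abs_def] F'_def[abs_def]
      by (intro has_derivative_diff has_derivative_mult pn' pp' u(1))
    have "F' X2 = 0"
      by (rule half_disc_derivative_zero[OF F arc_D[OF u], of 0]) (simp add: F_def dependent)
    then have "(\<phi> u \<bullet> \<phi>'' u X1 X2 + \<phi>' u X2 \<bullet> \<phi>' u X1) * (\<phi> u \<bullet> n' u X2)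
       = (\<phi> u \<bullet> \<phi>' u X2) * (\<phi> u \<bullet> n'' u X1 X2 + \<phi>' u X2 \<bullet> n' u X1)"
      by (simp add: F'_def arc_tangent[OF u])
    then show "c' u X1 = 0"
      using second_form_sym[OF arc_D[OF u], of X2 X1] \<phi>''_sym[OF u(1), of X1 X2] n''_sym[OF u(1), of X1 X2]
      by (simp add: c'_def inner_commute[of "\<phi>' u X1" "\<phi>' u X2"] mult.commute)
  qed
qed

lemma shape_op_position:
  assumes u: "u \<in> B" "u $ 2 = 0" shows "shape_op u (\<phi> u) = curv u *\<^sub>R \<phi> u"
proof -
  note uD = arc_D[OF u]
  have "(shape_op u (\<phi> u) - curv u *\<^sub>R \<phi> u) = 0"
  proof (rule tangent_orthogonal_zero[OF uD])
    show "(shape_op u (\<phi> u) - curv u *\<^sub>R \<phi> u) \<bullet> n u = 0"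
      using shape_op_tang[OF uD] orth[OF u] by (simp add: inner_diff_left)
    show "(shape_op u (\<phi> u) - curv u *\<^sub>R \<phi> u) \<bullet> \<phi>' u X1 = 0"
      using arc_tangent[OF u] by (simp add: inner_diff_left shape_op_sym[OF uD] shape_op_\<phi>'[OF uD])
    show "(shape_op u (\<phi> u) - curv u *\<^sub>R \<phi> u) \<bullet> \<phi>' u X2 = 0"
      using arc_conormal[OF u] by (simp add: inner_diff_left shape_op_sym[OF uD] shape_op_\<phi>'[OF uD] curv_def)
  qed
  then show ?thesis by simp
qed

lemma shape_op_cross_position:
  assumes u: "u \<in> B" "u $ 2 = 0" shows "shape_op u (n u \<times> \<phi> u) = - curv u *\<^sub>R (n u \<times> \<phi> u)"
  using shape_op_cross[OF arc_D[OF u]] shape_op_position[OF u] by (simp add: cross_mult_right)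

lemma axis_vector_constant:
  assumes "u \<in> B" "u $ 2 = 0"
  shows "- curv u0 *\<^sub>R \<phi> u - n u = - curv u0 *\<^sub>R \<phi> u0 - n u0"
proof (rule arc_constant[OF u0_boundary _ _ assms, where f' = "\<lambda>u v. - curv u0 *\<^sub>R \<phi>' u v - n' u v"])
  fix u assume u: "u \<in> B" "u $ 2 = 0"
  note uD = arc_D[OF u]
  show "((\<lambda>u. - curv u0 *\<^sub>R \<phi> u - n u) has_derivative (\<lambda>v. - curv u0 *\<^sub>R \<phi>' u v - n' u v)) (at u)"
    by (intro has_derivative_diff has_derivative_scaleR_right \<phi>' n' u(1))
  have "\<phi>' u X1 = (\<phi>' u X1 \<bullet> (n u \<times> \<phi> u)) *\<^sub>R (n u \<times> \<phi> u)"
    using tangent_expansion[OF unit[OF uD] on_sphere[OF u] tang[OF uD, of X1]] arc_tangent(1)[OF u] orth[OF u]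
    by (simp add: inner_commute)
  then have "n' u X1 = - curv u *\<^sub>R \<phi>' u X1"
    using shape_op_cross_position[OF u] shape_op_\<phi>'[OF uD, of X1] linear_cmul[OF linear_shape_op[OF uD]]
    by (metis scaleR_left_commute)
  then show "- curv u0 *\<^sub>R \<phi>' u X1 - n' u X1 = 0" using curv_constant[OF u] by simp
qed

text \<open>\<open>e\<close> and \<open>c\<close> are the parameters of the catenoid with these
  Cauchy data, \<open>c = 0\<close> standing for the plane. The last conclusion places its axis
  through the origin.\<close>

lemma axis_exists:
  obtains e c where "norm e = 1" "\<bar>n u0 \<bullet> e\<bar> < 1"
    "\<And>u. u \<in> B \<Longrightarrow> u $ 2 = 0 \<Longrightarrow>
      shape_op u (tangential (n u) e) = - (c * (1 - (n u \<bullet> e)\<^sup>2)) *\<^sub>R tangential (n u) e"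
    "c \<noteq> 0 \<Longrightarrow> (c * (1 - (n u0 \<bullet> e)\<^sup>2)) *\<^sub>R (\<phi> u0 - (\<phi> u0 \<bullet> e) *\<^sub>R e) = n u0 - (n u0 \<bullet> e) *\<^sub>R e"
proof (cases "curv u0 = 0")
  case True
  have nconst: "n u = n u0" if "u \<in> B" "u $ 2 = 0" for u
    using axis_vector_constant[OF that] True by simp
  obtain e where e: "norm e = 1" "e \<bullet> n u0 = 0"
  proof -
    \<comment> \<open>For \<open>curv u0 = 0\<close> the differential of the normal vanishes on the
      arc, so any unit vector tangent at \<open>u0\<close> serves as \<open>e\<close>; the position
      vector is one.\<close>
    have "norm (\<phi> u0) = 1" "\<phi> u0 \<bullet> n u0 = 0" using on_sphere[of u0] orth[of u0] r u0_boundary by auto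
    then show thesis by (rule that)
  qed
  show thesis
  proof (rule that[of e 0])
    fix u assume u: "u \<in> B" "u $ 2 = 0"
    note uD = arc_D[OF u]
    have c0: "curv u = 0" using curv_constant[OF u] True by simp
    have en: "e \<bullet> n u = 0" using e nconst[OF u] by simp
    have "e = (e \<bullet> \<phi> u) *\<^sub>R \<phi> u + (e \<bullet> (n u \<times> \<phi> u)) *\<^sub>R (n u \<times> \<phi> u)"
      using tangent_expansion[OF unit[OF uD] on_sphere[OF u] en] orth[OF u]
      by (simp add: inner_commute[of "n u"] tangential_eq)
    then have "shape_op u e = shape_op u ((e \<bullet> \<phi> u) *\<^sub>R \<phi> u + (e \<bullet> (n u \<times> \<phi> u)) *\<^sub>R (n u \<times> \<phi> u))"
      by simp
    also have "\<dots> = 0"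
      using shape_op_position[OF u] shape_op_cross_position[OF u] c0 linear_shape_op[OF uD]
      by (simp add: linear_add linear_cmul)
    finally show "shape_op u (tangential (n u) e) = - (0 * (1 - (n u \<bullet> e)\<^sup>2)) *\<^sub>R tangential (n u) e"
      using en by (simp add: tangential_eq)
  qed (use e in \<open>auto simp: inner_commute\<close>)
next
  case False
  define \<mu> where "\<mu> = curv u0"
  define E where "E = - \<mu> *\<^sub>R \<phi> u0 - n u0"
  have E: "E = - \<mu> *\<^sub>R \<phi> u - n u" if "u \<in> B" "u $ 2 = 0" for u
    using axis_vector_constant[OF that] by (simp add: E_def \<mu>_def)
  have \<mu>: "\<mu> \<noteq> 0" using False by (simp add: \<mu>_def)
  have EE: "E \<bullet> E = 1 + \<mu>\<^sup>2"
  proof -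
    have "\<phi> u0 \<bullet> \<phi> u0 = 1" "n u0 \<bullet> n u0 = 1" "\<phi> u0 \<bullet> n u0 = 0"
      using on_sphere[of u0] orth[of u0] unit[OF u0_D] r u0_boundary by (simp_all add: dot_square_norm)
    then show ?thesis
      by (simp add: E_def inner_diff_left inner_diff_right inner_commute[of "n u0" "\<phi> u0"] power2_eq_square)
  qed
  define \<nu> where "\<nu> = norm E"
  have \<nu>2: "\<nu>\<^sup>2 = 1 + \<mu>\<^sup>2" using EE by (simp add: \<nu>_def dot_square_norm)
  have \<mu>2: "\<mu>\<^sup>2 > 0" using \<mu> by simp
  have \<nu>: "\<nu> > 1"
  proof (rule ccontr)
    assume "\<not> \<nu> > 1"
    then have "\<nu>\<^sup>2 \<le> 1" by (simp add: \<nu>_def power_le_one)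
    with \<nu>2 \<mu>2 show False by simp
  qed
  define e where "e = (1 / \<nu>) *\<^sub>R E"
  \<comment> \<open>Forced by the eigenvalue: \<open>tangential (n u) e\<close> is a multiple of the
    position vector, where \<open>shape_op\<close> has eigenvalue \<open>\<mu>\<close>. So
    \<open>c * (1 - (n u \<bullet> e)\<^sup>2) = - \<mu>\<close>, and here
    \<open>n u \<bullet> e = - 1 / \<nu>\<close> with
    \<open>\<nu>\<^sup>2 = 1 + \<mu>\<^sup>2\<close>.\<close>
  define c where "c = - (1 + \<mu>\<^sup>2) / \<mu>"
  have norm_e: "norm e = 1" using \<nu> by (auto simp: e_def \<nu>_def)
  have facts: "n u \<bullet> e = - 1 / \<nu>" "tangential (n u) e = (- \<mu> / \<nu>) *\<^sub>R \<phi> u" if u: "u \<in> B" "u $ 2 = 0" for u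
  proof -
    show ne: "n u \<bullet> e = - 1 / \<nu>"
      using orth[OF u] unit[OF arc_D[OF u]]
      by (simp add: e_def E[OF u] inner_diff_right dot_square_norm inner_commute[of "n u" "\<phi> u"])
    show "tangential (n u) e = (- \<mu> / \<nu>) *\<^sub>R \<phi> u"
      unfolding tangential_def inner_commute[of e] ne
      by (simp add: e_def E[OF u] scaleR_diff_right)
  qed
  have c_eq: "c * (1 - (n u \<bullet> e)\<^sup>2) = - \<mu>" if u: "u \<in> B" "u $ 2 = 0" for u
  proof -
    have "c * (1 - (n u \<bullet> e)\<^sup>2) = c * (1 - 1 / (1 + \<mu>\<^sup>2))"
      unfolding facts(1)[OF u] by (simp add: power_divide \<nu>2)
    also have "1 - 1 / (1 + \<mu>\<^sup>2) = \<mu>\<^sup>2 / (1 + \<mu>\<^sup>2)"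
    proof -
      have "1 + \<mu>\<^sup>2 \<noteq> 0" using \<mu>2 by linarith
      then show ?thesis by (simp add: diff_divide_eq_iff)
    qed
    also have "c * (\<mu>\<^sup>2 / (1 + \<mu>\<^sup>2)) = - \<mu>"
    proof -
      have "1 + \<mu>\<^sup>2 \<noteq> 0" using \<mu>2 by linarith
      then have "- (1 + \<mu>\<^sup>2) / \<mu> * (\<mu>\<^sup>2 / (1 + \<mu>\<^sup>2)) = - (\<mu>\<^sup>2 / \<mu>)"
        by (simp only: minus_divide_left[symmetric] times_divide_times_eq mult_minus_left) (simp add: mult.commute)
      then show ?thesis using \<mu> unfolding c_def by (simp add: power2_eq_square)
    qed
    finally show ?thesis .
  qed
  show thesis
  proof (rule that[OF norm_e])
    show "\<bar>n u0 \<bullet> e\<bar> < 1" using facts(1)[of u0] r u0_boundary \<nu> by simp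
    show "shape_op u (tangential (n u) e) = - (c * (1 - (n u \<bullet> e)\<^sup>2)) *\<^sub>R tangential (n u) e"
      if u: "u \<in> B" "u $ 2 = 0" for u
      unfolding c_eq[OF u] facts(2)[OF u] linear_cmul[OF linear_shape_op[OF arc_D[OF u]]]
        shape_op_position[OF u] curv_constant[OF u] \<mu>_def[symmetric]
      by simp
    have "\<mu> *\<^sub>R \<phi> u0 + n u0 = - \<nu> *\<^sub>R e" using \<nu> by (simp add: e_def E_def)
    then have n: "n u0 = - \<nu> *\<^sub>R e - \<mu> *\<^sub>R \<phi> u0" by (metis add_diff_cancel_left')
    have "n u0 - (n u0 \<bullet> e) *\<^sub>R e = - \<mu> *\<^sub>R (\<phi> u0 - (\<phi> u0 \<bullet> e) *\<^sub>R e)"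
      unfolding n using norm_e by (simp add: inner_diff_left dot_square_norm algebra_simps)
    then show "(c * (1 - (n u0 \<bullet> e)\<^sup>2)) *\<^sub>R (\<phi> u0 - (\<phi> u0 \<bullet> e) *\<^sub>R e) = n u0 - (n u0 \<bullet> e) *\<^sub>R e"
      using c_eq[of u0] r u0_boundary by simp
  qed
qed

end

section \<open>Charts on which the potential is constant\<close>

lemma tanh_artanh_real:
  fixes x :: real
  assumes "\<bar>x\<bar> < 1" shows "tanh (artanh x) = x"
proof -
  define q where "q = (1 + x) / (1 - x)"
  have q: "q > 0" using assms by (simp add: q_def)
  have "artanh x = ln (sqrt q)" using q by (simp add: artanh_def q_def ln_sqrt)
  then have "tanh (artanh x) = (q - 1) / (q + 1)" using q by (simp add: tanh_ln_real)
  also have "\<dots> = x"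
  proof -
    have "q - 1 = 2 * x / (1 - x)" "q + 1 = 2 / (1 - x)"
      using assms by (simp_all add: q_def field_simps)
    then show ?thesis using assms by simp
  qed
  finally show ?thesis .
qed

context surface_chart
begin

lemma subchart:
  assumes "0 < s" "s \<le> r" shows "surface_chart \<phi> n \<phi>' n' \<phi>'' n'' u0 s"
proof -
  have sub: "ball u0 s \<subseteq> B" using assms by auto
  show ?thesis
  proof
    show "continuous_on (ball u0 s) (\<lambda>u. \<phi>'' u v w)" "continuous_on (ball u0 s) (\<lambda>u. n'' u v w)" for v w
      using continuous_on_subset[OF _ sub] \<phi>''_cont n''_cont by blast+
  qed (use sub assms u0 \<phi>' \<phi>'' n' n'' unit tang inj shape in auto)
qed

context
  fixes e :: "real^3" and c k :: real
  assumes e: "norm e = 1" and small: "\<And>u. u \<in> D \<Longrightarrow> \<bar>n u \<bullet> e\<bar> < 1"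
    and pot: "\<And>u. u \<in> D \<Longrightarrow> artanh (n u \<bullet> e) + c * (\<phi> u \<bullet> e) = k"
begin

lemma normal_derivative_axis:
  assumes u: "u \<in> D" shows "n' u v \<bullet> e = - (c * (1 - (n u \<bullet> e)\<^sup>2)) * (\<phi>' u v \<bullet> e)"
proof -
  have d: "1 - (n u \<bullet> e)\<^sup>2 \<noteq> 0" using small[OF u] by (auto simp: power2_eq_1_iff)
  have uB: "u \<in> B" using u by simp
  have "(artanh has_derivative (*) (1 / (1 - (n u \<bullet> e)\<^sup>2))) (at (n u \<bullet> e))"
    using artanh_real_has_field_derivative[of "n u \<bullet> e" UNIV] small[OF u] by (auto simp: has_field_derivative_def)
  from has_derivative_compose[OF has_derivative_inner_left[OF n'[OF uB]] this]
  have "((\<lambda>u. artanh (n u \<bullet> e) + c * (\<phi> u \<bullet> e)) has_derivative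
      (\<lambda>v. 1 / (1 - (n u \<bullet> e)\<^sup>2) * (n' u v \<bullet> e) + c * (\<phi>' u v \<bullet> e))) (at u)"
    by (intro has_derivative_add has_derivative_mult_right has_derivative_inner_left \<phi>'[OF uB])
  from half_disc_derivative_zero[OF this u pot, of v]
  have "(n' u v \<bullet> e) / (1 - (n u \<bullet> e)\<^sup>2) = - c * (\<phi>' u v \<bullet> e)" by (simp add: eq_neg_iff_add_eq_0)
  then show ?thesis using d by (simp add: nonzero_divide_eq_eq mult.commute mult.left_commute)
qed

text \<open>Paired with \<open>e\<close>, the derivative of the normal is known in every direction
  from the potential. By symmetry of \<open>shape_op\<close> this makes
  \<open>tangential (n u) e\<close> an eigenvector, and anticommutation supplies the rest.\<close>

lemma normal_derivative:
  assumes u: "u \<in> D"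
  shows "n' u v = (c * (1 - (n u \<bullet> e)\<^sup>2)) *\<^sub>R \<phi>' u v - (2 * c * (\<phi>' u v \<bullet> e)) *\<^sub>R tangential (n u) e"
proof -
  have tan_e: "y \<bullet> tangential (n u) e = y \<bullet> e" if "y \<bullet> n u = 0" for y
    using that by (simp add: tangential_def inner_diff_right)
  have "shape_op u (tangential (n u) e) + (c * (1 - (n u \<bullet> e)\<^sup>2)) *\<^sub>R tangential (n u) e = 0" (is "?y = 0")
  proof -
    have yn: "?y \<bullet> n u = 0"
      using shape_op_tang[OF u] tangential_inner_self(2)[OF unit[OF u] e] by (simp add: inner_add_left)
    have "?y \<bullet> \<phi>' u v = 0" for v
    proof -
      have "?y \<bullet> \<phi>' u v = \<phi>' u v \<bullet> shape_op u (tangential (n u) e) + (c * (1 - (n u \<bullet> e)\<^sup>2)) * (\<phi>' u v \<bullet> tangential (n u) e)"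
        by (simp add: inner_add_right inner_commute[of _ "\<phi>' u v"])
      also have "\<phi>' u v \<bullet> shape_op u (tangential (n u) e) = n' u v \<bullet> e"
        by (simp only: shape_op_sym[OF u, symmetric] shape_op_\<phi>'[OF u] tan_e[OF n'_tang[OF u]])
      finally show ?thesis
        using normal_derivative_axis[OF u, of v] tan_e[OF tang[OF u]] by simp
    qed
    then show ?thesis using tangent_orthogonal_zero[OF u yn] by blast
  qed
  then have eig: "shape_op u (tangential (n u) e) = - (c * (1 - (n u \<bullet> e)\<^sup>2)) *\<^sub>R tangential (n u) e"
    by (simp add: eq_neg_iff_add_eq_0)
  have "(n u \<bullet> e)\<^sup>2 \<noteq> 1" using small[OF u] by (auto simp: power2_eq_1_iff)
  from anticommuting_eigen[OF linear_shape_op[OF u] unit[OF u] e tang[OF u] this shape_op_cross[OF u] eig]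
  show ?thesis by (simp add: shape_op_\<phi>'[OF u])
qed

lemma half_disc_constant:
  fixes f :: "real^2 \<Rightarrow> 'b::real_normed_vector"
  assumes "\<And>u. u \<in> D \<Longrightarrow> (f has_derivative f' u) (at u)" "\<And>u v. u \<in> D \<Longrightarrow> f' u v = 0" "u \<in> D"
  shows "f u = f u0"
proof -
  have "(f has_derivative (\<lambda>h. 0)) (at u within D)" if "u \<in> D" for u
  proof -
    have "f' u = (\<lambda>h. 0)" using assms(2)[OF that] by blast
    then show ?thesis using has_derivative_at_withinI[OF assms(1)[OF that]] by simp
  qed
  then have "\<exists>a. \<forall>u\<in>D. f u = a"
    by (intro has_derivative_zero_constant convex_Int convex_ball convex_half_plane)
  then show ?thesis using u0_D assms(3) by metis
qed

lemma planar_normal_constant: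
  assumes "c = 0" "u \<in> D" shows "n u = n u0"
  by (rule half_disc_constant[OF n' _ assms(2)]) (use normal_derivative assms(1) in auto)

lemma planar_height_constant:
  assumes "c = 0" "u \<in> D" shows "\<phi> u \<bullet> n u0 = \<phi> u0 \<bullet> n u0"
proof (rule half_disc_constant[OF _ _ assms(2), where f' = "\<lambda>u v. \<phi>' u v \<bullet> n u0"])
  show "((\<lambda>u. \<phi> u \<bullet> n u0) has_derivative (\<lambda>v. \<phi>' u v \<bullet> n u0)) (at u)" if "u \<in> D" for u
    using \<phi>' that by (intro has_derivative_inner_left) auto
  show "\<phi>' u v \<bullet> n u0 = 0" if "u \<in> D" for u v
    using tang[OF that] planar_normal_constant[OF assms(1) that] by metis
qed

text \<open>\<open>Y\<close> is the place of the axis: on a catenoid the component of the position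
  orthogonal to the axis, measured from it, is that of the normal divided by
  \<open>c * (1 - (n u \<bullet> e)\<^sup>2)\<close>.\<close>

lemma catenoid_axis_constant:
  assumes "c \<noteq> 0" "u \<in> D"
  defines "Y \<equiv> \<lambda>u. (\<phi> u - (\<phi> u \<bullet> e) *\<^sub>R e) - (inverse (1 - (n u \<bullet> e)\<^sup>2) / c) *\<^sub>R (n u - (n u \<bullet> e) *\<^sub>R e)"
  shows "Y u = Y u0"
proof (rule half_disc_constant[OF _ _ assms(2)])
  fix u assume u: "u \<in> D"
  have uB: "u \<in> B" using u by simp
  have d: "1 - (n u \<bullet> e)\<^sup>2 \<noteq> 0" using small[OF u] by (auto simp: power2_eq_1_iff)
  define Y' where "Y' v = (\<phi>' u v - (\<phi>' u v \<bullet> e) *\<^sub>R e)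
     - ((inverse (1 - (n u \<bullet> e)\<^sup>2) / c) *\<^sub>R (n' u v - (n' u v \<bullet> e) *\<^sub>R e)
     + ((- (inverse (1 - (n u \<bullet> e)\<^sup>2) * (- (2 * (n u \<bullet> e) * (n' u v \<bullet> e))) * inverse (1 - (n u \<bullet> e)\<^sup>2))) / c)
       *\<^sub>R (n u - (n u \<bullet> e) *\<^sub>R e))" for v
  have ne: "((\<lambda>u. n u \<bullet> e) has_derivative (\<lambda>v. n' u v \<bullet> e)) (at u)"
    by (intro has_derivative_inner_left n'[OF uB])
  have "((\<lambda>u. 1 - (n u \<bullet> e)\<^sup>2) has_derivative (\<lambda>v. - (2 * (n u \<bullet> e) * (n' u v \<bullet> e)))) (at u)"
    by (auto intro!: derivative_eq_intros n'[OF uB])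
  from Deriv.has_derivative_inverse[OF d this]
  have inv: "((\<lambda>u. inverse (1 - (n u \<bullet> e)\<^sup>2) / c) has_derivative
      (\<lambda>v. (- (inverse (1 - (n u \<bullet> e)\<^sup>2) * (- (2 * (n u \<bullet> e) * (n' u v \<bullet> e))) * inverse (1 - (n u \<bullet> e)\<^sup>2))) / c)) (at u)"
    by (rule bounded_linear.has_derivative[OF bounded_linear_divide])
  show "(Y has_derivative Y') (at u)"
    unfolding Y_def Y'_def[abs_def]
    by (intro has_derivative_diff has_derivative_scaleR inv has_derivative_scaleR_left has_derivative_inner_left n'[OF uB] \<phi>'[OF uB])
next
  fix u v assume u: "u \<in> D"
  define z where "z = n u \<bullet> e"
  define d where "d = 1 - z\<^sup>2"
  define p where "p = \<phi>' u v \<bullet> e"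
  have d: "d \<noteq> 0" using small[OF u] by (auto simp: power2_eq_1_iff d_def z_def)
  have ee: "e \<bullet> e = 1" using e by (simp add: dot_square_norm)
  have n'e: "n' u v \<bullet> e = - (c * d * p)"
    using normal_derivative_axis[OF u, of v] by (simp add: d_def z_def p_def)
  have n'eq: "n' u v = (c * d) *\<^sub>R \<phi>' u v - (2 * c * p) *\<^sub>R (e - z *\<^sub>R n u)"
    using normal_derivative[OF u, of v] by (simp add: d_def z_def p_def tangential_def inner_commute[of e])
  have "n' u v - (n' u v \<bullet> e) *\<^sub>R e = (c * d) *\<^sub>R \<phi>' u v - (2 * c * p) *\<^sub>R (e - z *\<^sub>R n u) + (c * d * p) *\<^sub>R e"
    unfolding n'e by (simp add: n'eq)
  also have "\<dots> = (c * d) *\<^sub>R (\<phi>' u v - p *\<^sub>R e) + (2 * c * p * z) *\<^sub>R (n u - z *\<^sub>R e)"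
    by (simp add: d_def vec_eq_iff algebra_simps power2_eq_square)
  finally have n'perp: "n' u v - (n' u v \<bullet> e) *\<^sub>R e = (c * d) *\<^sub>R (\<phi>' u v - p *\<^sub>R e) + (2 * c * p * z) *\<^sub>R (n u - z *\<^sub>R e)" .
  \<comment> \<open>The surplus multiple of \<open>n u - z *\<^sub>R e\<close> in this term is
    cancelled by the derivative of the factor \<open>inverse d\<close>, computed next.\<close>
  have 1: "(inverse d / c) *\<^sub>R (n' u v - (n' u v \<bullet> e) *\<^sub>R e)
      = (\<phi>' u v - p *\<^sub>R e) + (2 * p * z / d) *\<^sub>R (n u - z *\<^sub>R e)"
  proof -
    have "inverse d * inverse c * (c * d) = 1" "inverse d * inverse c * (2 * c * p * z) = 2 * p * z * inverse d"
      using d assms(1) by (simp_all add: field_simps)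
    then show ?thesis unfolding n'perp by (simp only: scaleR_add_right divide_inverse scaleR_scaleR scaleR_one)
  qed
  have 2: "(- (inverse d * (- (2 * z * (n' u v \<bullet> e))) * inverse d)) / c = - (2 * p * z / d)"
    unfolding n'e using d assms(1) by (simp add: field_simps)
  show "(\<phi>' u v - (\<phi>' u v \<bullet> e) *\<^sub>R e)
     - ((inverse (1 - (n u \<bullet> e)\<^sup>2) / c) *\<^sub>R (n' u v - (n' u v \<bullet> e) *\<^sub>R e)
     + ((- (inverse (1 - (n u \<bullet> e)\<^sup>2) * (- (2 * (n u \<bullet> e) * (n' u v \<bullet> e))) * inverse (1 - (n u \<bullet> e)\<^sup>2))) / c)
       *\<^sub>R (n u - (n u \<bullet> e) *\<^sub>R e)) = 0"
    unfolding z_def[symmetric] d_def[symmetric] 1 2 p_def[symmetric] by simp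
qed

end

end

lemma openin_chart_image:
  assumes "local_param S U \<phi>" "ball u0 s \<subseteq> U"
  shows "openin (top_of_set S) (\<phi> ` (ball u0 s \<inter> half_plane))"
proof -
  obtain \<psi> where h: "homeomorphism (U \<inter> half_plane) (\<phi> ` (U \<inter> half_plane)) \<phi> \<psi>"
    and o: "openin (top_of_set S) (\<phi> ` (U \<inter> half_plane))"
    using assms(1) by (auto simp: local_param_def)
  have "ball u0 s \<inter> half_plane = (U \<inter> half_plane) \<inter> ball u0 s" using assms(2) by auto
  then have "openin (top_of_set (U \<inter> half_plane)) (ball u0 s \<inter> half_plane)"
    by (simp add: openin_open_Int)
  from homeomorphism_imp_open_map[OF h this] o show ?thesis by (rule openin_trans)
qed

section \<open>Propagation along the surface\<close>

locale minimal_embedded =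
  fixes S :: "(real^3) set" and N :: "real^3 \<Rightarrow> real^3"
  assumes surface: "embedded_surface S" and compact: "compact S" and connected: "connected S"
    and normal: "unit_normal_field S N" and minimal: "minimal_surface S N"
begin

lemma N_norm: "p \<in> S \<Longrightarrow> norm (N p) = 1"
  using normal by (simp add: unit_normal_field_def)

lemma N_continuous: "continuous_on S N"
  unfolding continuous_on_eq_continuous_within
proof
  fix p assume p: "p \<in> S"
  obtain W g where W: "open W" "p \<in> W" "\<And>k. Ck_on k g W" "\<And>x. x \<in> S \<inter> W \<Longrightarrow> g x = N x"
    using smooth_on_locally[of S N p] normal p by (auto simp: unit_normal_field_def)
  have "continuous_on W g" using W(3)[of 0] by simp
  then have "continuous (at p within S) g"
    using W(1,2) by (simp add: continuous_on_eq_continuous_at continuous_at_imp_continuous_at_within)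
  moreover obtain d where "d > 0" "ball p d \<subseteq> W" using W(1,2) open_contains_ball by blast
  ultimately show "continuous (at p within S) N"
    using W(4) p by (intro continuous_transform_within[of p S g d N]) (auto simp: subset_iff dist_commute)
qed

lemma chart_at:
  assumes "p \<in> S"
  obtains U \<phi> u0 r n \<phi>' n' \<phi>'' n'' where "local_param S U \<phi>" "\<phi> u0 = p" "ball u0 r \<subseteq> U"
    "surface_chart \<phi> n \<phi>' n' \<phi>'' n'' u0 r"
    "\<And>u. u \<in> ball u0 r \<inter> half_plane \<Longrightarrow> n u = N (\<phi> u)"
    "p \<notin> surface_boundary S \<Longrightarrow> u0 $ 2 > 0"
proof -
  obtain U \<phi> u0 where U: "local_param S U \<phi>" "u0 \<in> U \<inter> half_plane" "\<phi> u0 = p"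
    using surface assms by (auto simp: embedded_surface_def)
  obtain r n \<phi>' n' \<phi>'' n'' where r: "ball u0 r \<subseteq> U" "surface_chart \<phi> n \<phi>' n' \<phi>'' n'' u0 r"
    "\<And>u. u \<in> ball u0 r \<inter> half_plane \<Longrightarrow> n u = N (\<phi> u)"
    using surface_chart_exists[OF normal minimal U(1,2)] by metis
  have "u0 $ 2 > 0" if "p \<notin> surface_boundary S"
  proof (rule ccontr)
    assume "\<not> u0 $ 2 > 0"
    then have "u0 $ 2 = 0" using U(2) by (simp add: half_plane_def)
    then have "p \<in> surface_boundary S" using U by (auto simp: surface_boundary_def)
    with that show False by blast
  qed
  with U r that show thesis by blast
qed

text \<open>Outside the open interval from -1 to 1 the value of \<open>artanh\<close> carries no
  information, hence the first conjunct.\<close>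

definition potential_eq :: "real^3 \<Rightarrow> real \<Rightarrow> real \<Rightarrow> real^3 \<Rightarrow> bool" where
  "potential_eq e c k q \<longleftrightarrow> \<bar>N q \<bullet> e\<bar> < 1 \<and> artanh (N q \<bullet> e) + c * (q \<bullet> e) = k"

lemma potential_eq_global:
  assumes frame: "oriented_frame e1 e2 e" and "p \<in> S"
    and start: "openin (top_of_set S) T0" "p \<in> T0" "\<And>q. q \<in> T0 \<Longrightarrow> potential_eq e c k q"
    and "q \<in> S"
  shows "potential_eq e c k q"
proof -
  \<comment> \<open>Required on a neighbourhood, since unique continuation starts from a nonempty
    open set.\<close>
  define P where "P q \<longleftrightarrow> (\<exists>T. openin (top_of_set S) T \<and> q \<in> T \<and> (\<forall>x\<in>T. potential_eq e c k x))" for q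
  have ne: "norm e = 1" using frame by (simp add: oriented_frame_def norm_eq_sqrt_inner)
  obtain K where K: "K > 0" "\<And>x. x \<in> S \<Longrightarrow> norm x \<le> K"
    using compact_imp_bounded[OF compact] by (auto simp: bounded_pos)
  \<comment> \<open>Where the potential is \<open>k\<close>, |artanh (N . e)| is at most
    \<open>\<bar>k\<bar> + \<bar>c\<bar> * K\<close>, so |N . e| is at most \<open>M\<close>, and
    \<open>M < 1\<close>.\<close>
  define M where "M = tanh (\<bar>k\<bar> + \<bar>c\<bar> * K)"
  have "P q"
  proof (rule connected_induction_simple[OF connected \<open>p \<in> S\<close> \<open>q \<in> S\<close>])
    show "P p" using start by (auto simp: P_def)
    fix a assume a: "a \<in> S"
    show "\<exists>T. openin (top_of_set S) T \<and> a \<in> T \<and> (\<forall>x\<in>T. \<forall>y\<in>T. P x \<longrightarrow> P y)"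
    proof (cases "\<bar>N a \<bullet> e\<bar> < 1")
      case True
      obtain U \<phi> u0 r n \<phi>' n' \<phi>'' n'' where U: "local_param S U \<phi>" "\<phi> u0 = a" "ball u0 r \<subseteq> U"
        and ch: "surface_chart \<phi> n \<phi>' n' \<phi>'' n'' u0 r"
        and nN: "\<And>u. u \<in> ball u0 r \<inter> half_plane \<Longrightarrow> n u = N (\<phi> u)"
        by (rule chart_at[OF a]) blast
      interpret surface_chart \<phi> n \<phi>' n' \<phi>'' n'' u0 r by (rule ch)
      have "\<bar>n u0 \<bullet> e\<bar> < 1" using True nN[OF u0_D] U(2) by simp
      note small = this
      obtain s where s: "0 < s" "s \<le> r" "\<And>u. u \<in> ball u0 s \<Longrightarrow> \<bar>n u \<bullet> e\<bar> < 1"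
        and uc: "\<And>W k u. open W \<Longrightarrow> W \<noteq> {} \<Longrightarrow> W \<subseteq> ball u0 s \<inter> {u. u $ 2 > 0} \<Longrightarrow>
          (\<And>u. u \<in> W \<Longrightarrow> artanh (n u \<bullet> e) + c * (\<phi> u \<bullet> e) = k) \<Longrightarrow>
          u \<in> ball u0 s \<inter> half_plane \<Longrightarrow> artanh (n u \<bullet> e) + c * (\<phi> u \<bullet> e) = k"
        by (rule potential_unique_continuation[OF frame small, of c]) blast
      have sub: "ball u0 s \<subseteq> ball u0 r" using s by auto
      have nN': "N (\<phi> u) = n u" if "u \<in> ball u0 s \<inter> half_plane" for u
        using nN[of u] that sub by auto
      let ?T = "\<phi> ` (ball u0 s \<inter> half_plane)"
      have oT: "openin (top_of_set S) ?T" using openin_chart_image[OF U(1)] sub U(3) by blast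
      have "P y" if x: "x \<in> ?T" "P x" and y: "y \<in> ?T" for x y
      proof -
        obtain T where T: "openin (top_of_set S) T" "x \<in> T" "\<And>z. z \<in> T \<Longrightarrow> potential_eq e c k z"
          using x(2) by (auto simp: P_def)
        obtain O1 where O1: "open O1" "T = S \<inter> O1" using T(1) by (auto simp: openin_open)
        obtain u where u: "u \<in> ball u0 s \<inter> half_plane" "x = \<phi> u" using x(1) by blast
        have \<phi>_cont: "continuous_on (ball u0 s) \<phi>"
          by (rule continuous_on_subset[OF has_derivative_continuous_on[OF has_derivative_at_withinI[OF \<phi>']] sub])
        define V where "V = ball u0 s \<inter> \<phi> -` O1"
        have V: "open V" unfolding V_def using \<phi>_cont O1(1) by (intro continuous_open_preimage) auto
        have "u \<in> V" using u T(2) O1(2) by (auto simp: V_def)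
        \<comment> \<open>Even if \<open>x\<close> is a boundary point, moving upwards in the chart
          leads to interior points at which the potential is known.\<close>
        define W where "W = V \<inter> {u. u $ 2 > 0}"
        have "open W" unfolding W_def by (intro open_Int V open_halfspace_component_gt_cart)
        moreover have "W \<noteq> {}"
        proof -
          obtain d where d: "d > 0" "ball u d \<subseteq> V" using V \<open>u \<in> V\<close> open_contains_ball by blast
          have "u + (d / 2) *\<^sub>R axis 2 1 \<in> ball u d \<inter> {u. u $ 2 > 0}"
            using d(1) u(1) by (auto simp: half_plane_def dist_norm axis_def norm_axis_1[unfolded axis_def])
          with d(2) show ?thesis unfolding W_def by blast
        qed
        moreover have "W \<subseteq> ball u0 s \<inter> {u. u $ 2 > 0}" by (auto simp: W_def V_def)
        moreover have "artanh (n w \<bullet> e) + c * (\<phi> w \<bullet> e) = k" if "w \<in> W" for w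
        proof -
          have w: "w \<in> ball u0 r \<inter> half_plane" "\<phi> w \<in> O1" using that sub by (auto simp: W_def V_def half_plane_def)
          then have "\<phi> w \<in> T" using O1(2) local_param_image[OF U(1)] U(3) by auto
          then show ?thesis using T(3) nN[OF w(1)] by (auto simp: potential_eq_def)
        qed
        ultimately have "artanh (n w \<bullet> e) + c * (\<phi> w \<bullet> e) = k" if "w \<in> ball u0 s \<inter> half_plane" for w
          using uc that by blast
        then have "\<forall>z\<in>?T. potential_eq e c k z"
          using s(3) nN' by (auto simp: potential_eq_def)
        then show "P y" using oT y by (auto simp: P_def)
      qed
      moreover have "a \<in> ?T" using U(2) u0 s(1) by auto
      ultimately show ?thesis using oT by blast
    next
      case False
      have "M < \<bar>N a \<bullet> e\<bar>" using False tanh_real_lt_1[of "\<bar>k\<bar> + \<bar>c\<bar> * K"] by (simp add: M_def)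
      define T where "T = S \<inter> (\<lambda>q. \<bar>N q \<bullet> e\<bar>) -` {M<..}"
      have "openin (top_of_set S) T"
        unfolding T_def by (intro continuous_openin_preimage_gen continuous_intros N_continuous)
      moreover have "a \<in> T" using a \<open>M < \<bar>N a \<bullet> e\<bar>\<close> by (simp add: T_def)
      moreover have "\<not> P x" if "x \<in> T" for x
      proof
        assume "P x"
        then have "potential_eq e c k x" by (auto simp: P_def)
        then have small: "\<bar>N x \<bullet> e\<bar> < 1" and ar: "artanh (N x \<bullet> e) = k - c * (x \<bullet> e)"
          by (auto simp: potential_eq_def)
        have "x \<in> S" using that by (simp add: T_def)
        have "\<bar>c * (x \<bullet> e)\<bar> \<le> \<bar>c\<bar> * K"
          using Cauchy_Schwarz_ineq2[of x e] ne K(2)[OF \<open>x \<in> S\<close>] by (auto simp: abs_mult intro!: mult_left_mono)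
        then have "\<bar>artanh (N x \<bullet> e)\<bar> \<le> \<bar>k\<bar> + \<bar>c\<bar> * K" unfolding ar by linarith
        then have "tanh \<bar>artanh (N x \<bullet> e)\<bar> \<le> M" unfolding M_def by (simp only: tanh_real_le_iff)
        then have "\<bar>N x \<bullet> e\<bar> \<le> M" by (simp add: tanh_artanh_real[OF small])
        then show False using that by (simp add: T_def)
      qed
      ultimately show ?thesis by blast
    qed
  qed
  then show ?thesis by (auto simp: P_def)
qed

lemma potential_eq_rigidity:
  assumes ne: "norm e = 1" and pot: "\<And>q. q \<in> S \<Longrightarrow> potential_eq e c k q" and p: "p \<in> S" and q: "q \<in> S"
  defines "Y \<equiv> \<lambda>q. (q - (q \<bullet> e) *\<^sub>R e) - (inverse (1 - (N q \<bullet> e)\<^sup>2) / c) *\<^sub>R (N q - (N q \<bullet> e) *\<^sub>R e)"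
  shows "c = 0 \<Longrightarrow> N q = N p \<and> q \<bullet> N q = p \<bullet> N p" "c \<noteq> 0 \<Longrightarrow> Y q = Y p"
proof -
  have chart: "\<exists>T. openin (top_of_set S) T \<and> a \<in> T \<and>
     (\<forall>x\<in>T. (c = 0 \<longrightarrow> (N x, x \<bullet> N x) = (N a, a \<bullet> N a)) \<and> (c \<noteq> 0 \<longrightarrow> Y x = Y a))" if a: "a \<in> S" for a
  proof -
    obtain U \<phi> u0 r n \<phi>' n' \<phi>'' n'' where U: "local_param S U \<phi>" "\<phi> u0 = a" "ball u0 r \<subseteq> U"
      and ch: "surface_chart \<phi> n \<phi>' n' \<phi>'' n'' u0 r"
      and nN: "\<And>u. u \<in> ball u0 r \<inter> half_plane \<Longrightarrow> n u = N (\<phi> u)"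
      by (rule chart_at[OF a]) blast
    interpret surface_chart \<phi> n \<phi>' n' \<phi>'' n'' u0 r by (rule ch)
    have inS: "\<phi> u \<in> S" if "u \<in> D" for u using that local_param_image[OF U(1)] U(3) by auto
    have sm: "\<bar>n u \<bullet> e\<bar> < 1" and pt: "artanh (n u \<bullet> e) + c * (\<phi> u \<bullet> e) = k" if "u \<in> D" for u
      using pot[OF inS[OF that]] nN[OF that] by (auto simp: potential_eq_def)
    have "openin (top_of_set S) (\<phi> ` D)" using openin_chart_image[OF U(1)] U(3) by blast
    moreover have "a \<in> \<phi> ` D" using u0_D U(2) by blast
    moreover have "(N (\<phi> u), \<phi> u \<bullet> N (\<phi> u)) = (N a, a \<bullet> N a)" if "c = 0" "u \<in> D" for u
      using planar_normal_constant[OF ne sm pt that] planar_height_constant[OF ne sm pt that] nN[OF that(2)] nN[OF u0_D] U(2)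
      by simp
    moreover have "Y (\<phi> u) = Y a" if "c \<noteq> 0" "u \<in> D" for u
      using catenoid_axis_constant[OF ne sm pt that] nN[OF that(2)] nN[OF u0_D] U(2) by (simp add: Y_def)
    ultimately show ?thesis by blast
  qed
  show "N q = N p \<and> q \<bullet> N q = p \<bullet> N p" if "c = 0"
  proof -
    have "(\<lambda>q. (N q, q \<bullet> N q)) constant_on S"
    proof (rule locally_constant_imp_constant[OF connected])
      fix a assume "a \<in> S"
      from chart[OF this] obtain T where "openin (top_of_set S) T" "a \<in> T"
        "\<forall>x\<in>T. (c = 0 \<longrightarrow> (N x, x \<bullet> N x) = (N a, a \<bullet> N a)) \<and> (c \<noteq> 0 \<longrightarrow> Y x = Y a)"
        by (elim exE conjE)
      with that show "\<exists>T. openin (top_of_set S) T \<and> a \<in> T \<and> (\<forall>x\<in>T. (N x, x \<bullet> N x) = (N a, a \<bullet> N a))"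
        by (intro exI[of _ T]) blast
    qed
    then obtain y where "\<And>q. q \<in> S \<Longrightarrow> (N q, q \<bullet> N q) = y" unfolding constant_on_def by blast
    from this[OF q] this[OF p] show ?thesis by auto
  qed
  show "Y q = Y p" if "c \<noteq> 0"
  proof -
    have "Y constant_on S"
    proof (rule locally_constant_imp_constant[OF connected])
      fix a assume "a \<in> S"
      from chart[OF this] obtain T where "openin (top_of_set S) T" "a \<in> T"
        "\<forall>x\<in>T. (c = 0 \<longrightarrow> (N x, x \<bullet> N x) = (N a, a \<bullet> N a)) \<and> (c \<noteq> 0 \<longrightarrow> Y x = Y a)"
        by (elim exE conjE)
      with that show "\<exists>T. openin (top_of_set S) T \<and> a \<in> T \<and> (\<forall>x\<in>T. Y x = Y a)"
        by (intro exI[of _ T]) blast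
    qed
    then obtain y where "\<And>q. q \<in> S \<Longrightarrow> Y q = y" unfolding constant_on_def by blast
    from this[OF q] this[OF p] show ?thesis by simp
  qed
qed

end

locale collar_surface = minimal_embedded +
  fixes \<gamma> :: "(real^3) set" and \<epsilon> :: real
  assumes free: "free_boundary S N" and component: "\<gamma> \<in> components (surface_boundary S)"
    and \<epsilon>: "\<epsilon> > 0" and collar: "\<And>x. x \<in> collar S \<gamma> \<epsilon> \<Longrightarrow>
      linearly_dependent_pair (tangential (N x) x) (shape_operator S N x (tangential (N x) x))"
begin

text \<open>Everything starts at one point of \<open>\<gamma>\<close>. The collar contains a half
  disc chart around it, the Cauchy data there determine axis, \<open>c\<close> and potential, and
  connectedness of \<open>S\<close> carries them over the surface.\<close>

lemma planar_or_catenoidal: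
  obtains (planar) m where "norm m = 1" "\<And>q. q \<in> S \<Longrightarrow> N q = m" "\<And>q. q \<in> S \<Longrightarrow> q \<bullet> m = 0"
  | (catenoidal) e c k where "norm e = 1" "c \<noteq> 0" "\<And>q. q \<in> S \<Longrightarrow> potential_eq e c k q"
    "\<And>q. q \<in> S \<Longrightarrow> (c * (1 - (N q \<bullet> e)\<^sup>2)) *\<^sub>R (q - (q \<bullet> e) *\<^sub>R e) = N q - (N q \<bullet> e) *\<^sub>R e"
proof -
  obtain p where p: "p \<in> \<gamma>" using in_components_nonempty[OF component] by blast
  then have pb: "p \<in> surface_boundary S" using in_components_subset[OF component] by blast
  then obtain U \<phi> u0 where U: "local_param S U \<phi>" "u0 \<in> U" "u0 $ 2 = 0" "\<phi> u0 = p"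
    by (auto simp: surface_boundary_def)
  have u0: "u0 \<in> U \<inter> half_plane" using U by (simp add: half_plane_def)
  obtain r n \<phi>' n' \<phi>'' n'' where rad: "ball u0 r \<subseteq> U" "surface_chart \<phi> n \<phi>' n' \<phi>'' n'' u0 r"
    "\<And>u. u \<in> ball u0 r \<inter> half_plane \<Longrightarrow> n u = N (\<phi> u)"
    and A: "\<And>u v. u \<in> ball u0 r \<inter> half_plane \<Longrightarrow> shape_operator S N (\<phi> u) (\<phi>' u v) = - n' u v"
    using surface_chart_exists[OF normal minimal U(1) u0] by metis
  interpret ch: surface_chart \<phi> n \<phi>' n' \<phi>'' n'' u0 r by (rule rad(2))
  have inS: "\<phi> u \<in> S" if "u \<in> ball u0 r \<inter> half_plane" for u
    using that local_param_image[OF U(1)] rad(1) by auto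
  have bd: "\<phi> u \<in> surface_boundary S" if "u \<in> ball u0 r" "u $ 2 = 0" for u
    unfolding surface_boundary_def using that U(1) rad(1) by blast
  obtain \<delta> where \<delta>: "0 < \<delta>" "\<delta> \<le> r" "\<And>u. u \<in> ball u0 \<delta> \<inter> half_plane \<Longrightarrow> \<phi> u \<in> collar S \<gamma> \<epsilon>"
    using ch.collar_in_chart[OF inS _ \<epsilon>, of \<gamma>] p U(4) by metis
  have sub: "ball u0 \<delta> \<subseteq> ball u0 r" using \<delta> by auto
  interpret free_boundary_chart \<phi> n \<phi>' n' \<phi>'' n'' u0 \<delta>
  proof (intro free_boundary_chart.intro ch.subchart \<delta> free_boundary_chart_axioms.intro U(3))
    fix u assume "u \<in> ball u0 \<delta>" "u $ 2 = 0"
    then have u: "u \<in> ball u0 r" "u $ 2 = 0" "u \<in> ball u0 r \<inter> half_plane" using sub by (auto simp: half_plane_def)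
    show "norm (\<phi> u) = 1" "\<phi> u \<bullet> n u = 0"
      using bd[OF u(1,2)] free rad(3)[OF u(3)]
      by (auto simp: free_boundary_def orthogonal_def inner_commute subset_iff)
  next
    fix u v w assume u\<delta>: "u \<in> ball u0 \<delta> \<inter> half_plane"
    then have u: "u \<in> ball u0 r \<inter> half_plane" using sub by auto
    let ?x = "tangential (n u) (\<phi> u)"
    have nn: "n u \<bullet> n u = 1" using ch.unit[OF u] by (simp add: dot_square_norm)
    have xn: "?x \<bullet> n u = 0" using nn by (simp add: tangential_def inner_diff_left)
    obtain z where z: "?x = \<phi>' u z" using ch.tangent_surj[OF u xn] by blast
    have "linearly_dependent_pair ?x (shape_operator S N (\<phi> u) ?x)"
      using collar[OF \<delta>(3)[OF u\<delta>]] rad(3)[OF u] by simp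
    then obtain a b where ab: "a \<noteq> 0 \<or> b \<noteq> 0" "a *\<^sub>R ?x = b *\<^sub>R n' u z"
      unfolding linearly_dependent_pair_def z A[OF u] by auto
    have x: "\<phi> u \<bullet> y = ?x \<bullet> y" if "y \<bullet> n u = 0" for y
      using that by (simp add: tangential_def inner_diff_left inner_commute[of "n u"])
    \<comment> \<open>Symmetry of the second fundamental form moves the derivative of the normal
      from \<open>z\<close> to \<open>y\<close>. Dependence of the two vectors thus becomes
      dependence of the differentials of |x|^2 / 2 and x . N.\<close>
    have *: "a * (\<phi> u \<bullet> \<phi>' u y) = b * (\<phi> u \<bullet> n' u y)" for y
    proof -
      have "a * (\<phi> u \<bullet> \<phi>' u y) = (a *\<^sub>R ?x) \<bullet> \<phi>' u y" using x[OF ch.tang[OF u]] by simp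
      also have "\<dots> = b * (n' u z \<bullet> \<phi>' u y)" using ab(2) by simp
      also have "n' u z \<bullet> \<phi>' u y = \<phi>' u z \<bullet> n' u y"
        using ch.second_form_sym[OF u, of y z] by (simp add: inner_commute)
      also have "\<dots> = \<phi> u \<bullet> n' u y" using x[OF ch.n'_tang[OF u]] z by simp
      finally show ?thesis .
    qed
    show "(\<phi> u \<bullet> \<phi>' u v) * (\<phi> u \<bullet> n' u w) = (\<phi> u \<bullet> \<phi>' u w) * (\<phi> u \<bullet> n' u v)"
      using dependent_pair_det[OF ab(1) *[of v] *[of w]] .
  qed
  obtain e c where e: "norm e = 1" "\<bar>n u0 \<bullet> e\<bar> < 1"
    and arc: "\<And>u. u \<in> ball u0 \<delta> \<Longrightarrow> u $ 2 = 0 \<Longrightarrow>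
      shape_op u (tangential (n u) e) = - (c * (1 - (n u \<bullet> e)\<^sup>2)) *\<^sub>R tangential (n u) e"
    and rel: "c \<noteq> 0 \<Longrightarrow> (c * (1 - (n u0 \<bullet> e)\<^sup>2)) *\<^sub>R (\<phi> u0 - (\<phi> u0 \<bullet> e) *\<^sub>R e) = n u0 - (n u0 \<bullet> e) *\<^sub>R e"
    by (rule axis_exists) blast
  obtain e1 e2 where frame: "oriented_frame e1 e2 e" using oriented_frame_exists[OF e(1)] by metis
  obtain s k where s: "0 < s" "s \<le> \<delta>" "\<And>u. u \<in> ball u0 s \<Longrightarrow> \<bar>n u \<bullet> e\<bar> < 1"
    "\<And>u. u \<in> ball u0 s \<inter> half_plane \<Longrightarrow> artanh (n u \<bullet> e) + c * (\<phi> u \<bullet> e) = k"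
    by (rule potential_Cauchy_uniqueness[OF frame e(2) U(3) arc], assumption, assumption, rule that)
  have subs: "ball u0 s \<subseteq> ball u0 r" using s(2) \<delta>(2) by auto
  let ?T = "\<phi> ` (ball u0 s \<inter> half_plane)"
  have pS: "p \<in> S" using inS[of u0] ch.u0_D U(4) by auto
  have "openin (top_of_set S) ?T" using openin_chart_image[OF U(1)] subs rad(1) by blast
  moreover have "p \<in> ?T" using U(3,4) s(1) by (auto simp: half_plane_def)
  moreover have "N (\<phi> u) = n u" if "u \<in> ball u0 s \<inter> half_plane" for u
    using rad(3)[of u] that subs by auto
  then have "potential_eq e c k q" if "q \<in> ?T" for q
    using that s by (auto simp: potential_eq_def)
  ultimately have pot: "potential_eq e c k q" if "q \<in> S" for q
    using potential_eq_global[OF frame pS _ _ _ that] by blast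
  \<comment> \<open>Orthogonality at this one point puts the plane through the origin in the planar
    case.\<close>
  have Np: "N p \<bullet> p = 0" using free pb by (simp add: free_boundary_def orthogonal_def)
  show thesis
  proof (cases "c = 0")
    case True
    show thesis
    proof (rule planar[of "N p"])
      show "norm (N p) = 1" using N_norm[OF pS] .
      show "N q = N p" "q \<bullet> N p = 0" if "q \<in> S" for q
        using potential_eq_rigidity(1)[OF e(1) pot pS that True] Np by (auto simp: inner_commute)
    qed
  next
    case False
    have small: "1 - (N q \<bullet> e)\<^sup>2 \<noteq> 0" if "q \<in> S" for q
      using pot[OF that] by (auto simp: potential_eq_def power2_eq_1_iff)
    have "n u0 = N p" using rad(3)[OF ch.u0_D] U(4) by simp
    then have relp: "(c * (1 - (N p \<bullet> e)\<^sup>2)) *\<^sub>R (p - (p \<bullet> e) *\<^sub>R e) = N p - (N p \<bullet> e) *\<^sub>R e"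
      using rel[OF False] U(4) by simp
    have flip: "(inverse d / c) *\<^sub>R x = y \<longleftrightarrow> (c * d) *\<^sub>R y = x" if "d \<noteq> 0" for d and x y :: "real^3"
    proof -
      have "inverse d / c * (c * d) = 1" "(c * d) * (inverse d / c) = 1"
        using that False by (simp_all add: field_simps)
      then show ?thesis by (metis scaleR_one scaleR_scaleR)
    qed
    have "(inverse (1 - (N p \<bullet> e)\<^sup>2) / c) *\<^sub>R (N p - (N p \<bullet> e) *\<^sub>R e) = p - (p \<bullet> e) *\<^sub>R e"
      using flip[OF small[OF pS]] relp by blast
    then have "(inverse (1 - (N q \<bullet> e)\<^sup>2) / c) *\<^sub>R (N q - (N q \<bullet> e) *\<^sub>R e) = q - (q \<bullet> e) *\<^sub>R e" if "q \<in> S" for q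
      using potential_eq_rigidity(2)[OF e(1) pot pS that False] by simp
    then have "(c * (1 - (N q \<bullet> e)\<^sup>2)) *\<^sub>R (q - (q \<bullet> e) *\<^sub>R e) = N q - (N q \<bullet> e) *\<^sub>R e" if "q \<in> S" for q
      using flip[OF small[OF that]] that by blast
    then show thesis using catenoidal[OF e(1) False pot] by blast
  qed
qed

end

section \<open>Identification of the surface\<close>

lemma rotation_matrix_inner:
  fixes R :: "real^3^3"
  assumes "rotation_matrix R"
  shows "(R *v x) \<bullet> (R *v y) = x \<bullet> y" "norm (R *v x) = norm x" "surj ((*v) R)"
proof -
  have R: "orthogonal_transformation ((*v) R)"
    using assms by (simp add: rotation_matrix_def orthogonal_transformation_matrix)
  then show "(R *v x) \<bullet> (R *v y) = x \<bullet> y" by (simp add: orthogonal_transformation_def)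
  show "norm (R *v x) = norm x" using R by (rule orthogonal_transformation_norm)
  show "surj ((*v) R)" using R by (rule orthogonal_transformation_surj)
qed

lemma oriented_frame_eqI:
  assumes "oriented_frame e1 e2 e3" "x \<bullet> e1 = y \<bullet> e1" "x \<bullet> e2 = y \<bullet> e2" "x \<bullet> e3 = y \<bullet> e3"
  shows "x = y"
  using oriented_frame_expansion[OF assms(1), of x] oriented_frame_expansion[OF assms(1), of y] assms(2-4)
  by simp

lemma connected_subset_of_clopen:
  assumes "connected C" "closed T" "C \<inter> interior T \<noteq> {}" "C \<inter> T \<subseteq> interior T"
  shows "C \<subseteq> T"
proof (rule ccontr)
  assume "\<not> C \<subseteq> T"
  then have "C - T \<noteq> {}" by blast
  moreover have "C \<inter> T \<noteq> {}" using assms(3) interior_subset by blast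
  ultimately have "C \<inter> frontier T \<noteq> {}" using connected_Int_frontier[OF assms(1)] by blast
  then show False using assms(2,4) by (auto simp: frontier_def)
qed

lemma interior_scale:
  fixes z :: complex
  assumes "z \<in> interior T"
  obtains \<epsilon> where "\<epsilon> > 0" "\<epsilon> < 1" "(1 + \<epsilon>) *\<^sub>R z \<in> T" "(1 - \<epsilon>) *\<^sub>R z \<in> T"
proof -
  obtain d where d: "d > 0" "ball z d \<subseteq> T" using assms by (auto simp: mem_interior)
  define \<epsilon> where "\<epsilon> = min (1 / 2) (d / (2 * (norm z + 1)))"
  have \<epsilon>: "\<epsilon> > 0" "\<epsilon> < 1" using d by (auto simp: \<epsilon>_def add_nonneg_pos)
  have "\<epsilon> * norm z < d"
  proof -
    have "\<epsilon> * norm z \<le> d / (2 * (norm z + 1)) * norm z"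
      by (intro mult_right_mono) (auto simp: \<epsilon>_def)
    also have "\<dots> < d" using d(1) by (simp add: divide_simps add_nonneg_pos)
    finally show ?thesis .
  qed
  then have "(1 + \<epsilon>) *\<^sub>R z \<in> ball z d" "(1 - \<epsilon>) *\<^sub>R z \<in> ball z d"
    using \<epsilon>(1) by (simp_all add: dist_norm scaleR_add_left scaleR_diff_left)
  with d(2) \<epsilon> that show thesis by blast
qed

lemma boundary_subset: "surface_boundary S \<subseteq> S"
  by (auto simp: surface_boundary_def half_plane_def intro!: local_param_image)

section \<open>Injective images of the surface in the plane, and the flat case\<close>

context minimal_embedded
begin

text \<open>\<open>\<Theta>\<close> will be an orthogonal projection for the disk and a polar map
  for the catenoid. By invariance of domain only points of \<open>surface_boundary S\<close> can be
  mapped to the frontier of the image.\<close>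

lemma chart_image_open:
  fixes \<Theta> :: "real^3 \<Rightarrow> complex"
  assumes U: "local_param S U \<phi>" and \<Theta>: "continuous_on S \<Theta>" "inj_on \<Theta> S"
  shows "open (\<Theta> ` \<phi> ` (U \<inter> {u. u $ 2 > 0}))" "\<phi> ` (U \<inter> {u. u $ 2 > 0}) \<subseteq> S"
proof -
  obtain \<psi> where h: "homeomorphism (U \<inter> half_plane) (\<phi> ` (U \<inter> half_plane)) \<phi> \<psi>"
    using U by (auto simp: local_param_def)
  let ?V = "U \<inter> {u. u $ 2 > 0}"
  have sub: "?V \<subseteq> U \<inter> half_plane" by (auto simp: half_plane_def)
  show inS: "\<phi> ` ?V \<subseteq> S" using local_param_image[OF U] sub by blast
  have cont: "continuous_on ?V \<phi>" using h sub by (auto simp: homeomorphism_def intro: continuous_on_subset)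
  have inj: "inj_on \<phi> ?V"
    by (rule inj_on_inverseI[of _ \<psi>]) (use sub in \<open>auto intro!: homeomorphism_apply1[OF h]\<close>)
  have "open ((\<Theta> \<circ> \<phi>) ` ?V)"
  proof (rule invariance_of_domain_gen)
    show "open ?V"
      using U by (intro open_Int open_halfspace_component_gt_cart) (auto simp: local_param_def)
    show "continuous_on ?V (\<Theta> \<circ> \<phi>)"
      by (intro continuous_on_compose cont continuous_on_subset[OF \<Theta>(1) inS])
    show "inj_on (\<Theta> \<circ> \<phi>) ?V"
      by (intro comp_inj_on inj inj_on_subset[OF \<Theta>(2) inS])
  qed auto
  then show "open (\<Theta> ` \<phi> ` ?V)" by (simp add: image_comp)
qed

lemma interior_point_image:
  fixes \<Theta> :: "real^3 \<Rightarrow> complex"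
  assumes \<Theta>: "continuous_on S \<Theta>" "inj_on \<Theta> S" and p: "p \<in> S" "p \<notin> surface_boundary S"
  shows "\<Theta> p \<in> interior (\<Theta> ` S)"
proof -
  obtain U \<phi> u0 where U: "local_param S U \<phi>" "u0 \<in> U \<inter> half_plane" "\<phi> u0 = p"
    using surface p by (auto simp: embedded_surface_def)
  have "u0 $ 2 \<noteq> 0" using p U by (auto simp: surface_boundary_def)
  then have "u0 \<in> U \<inter> {u. u $ 2 > 0}" using U(2) by (auto simp: half_plane_def)
  then show ?thesis
    using chart_image_open[OF U(1) \<Theta>] U(3)
    by (intro interiorI[of "\<Theta> ` \<phi> ` (U \<inter> {u. u $ 2 > 0})"]) auto
qed

lemma image_interior_nonempty:
  fixes \<Theta> :: "real^3 \<Rightarrow> complex"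
  assumes \<Theta>: "continuous_on S \<Theta>" "inj_on \<Theta> S" and p: "p \<in> S"
  shows "interior (\<Theta> ` S) \<noteq> {}"
proof -
  obtain U \<phi> u0 where U: "local_param S U \<phi>" "u0 \<in> U \<inter> half_plane" "\<phi> u0 = p"
    using surface p by (auto simp: embedded_surface_def)
  have "open U" using U(1) by (simp add: local_param_def)
  then obtain d where d: "d > 0" "ball u0 d \<subseteq> U" using U(2) open_contains_ball by blast
  have "u0 + (d / 2) *\<^sub>R axis 2 1 \<in> ball u0 d \<inter> {u. u $ 2 > 0}"
    using d(1) U(2) by (auto simp: half_plane_def dist_norm axis_def norm_axis_1[unfolded axis_def])
  then have "u0 + (d / 2) *\<^sub>R axis 2 1 \<in> U \<inter> {u. u $ 2 > 0}" using d(2) by blast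
  then show ?thesis
    using chart_image_open[OF U(1) \<Theta>]
      interior_maximal[of "\<Theta> ` \<phi> ` (U \<inter> {u. u $ 2 > 0})" "\<Theta> ` S"] by blast
qed

text \<open>The projection of \<open>S\<close> to the plane is closed. Within the open unit disk it
  is also open, since \<open>surface_boundary S\<close> lies on the unit circle; so it fills the
  disk.\<close>

lemma flat_disk:
  assumes free: "free_boundary S N" and "p \<in> S" and m: "norm m = 1" and plane: "\<And>q. q \<in> S \<Longrightarrow> q \<bullet> m = 0"
  shows "\<exists>R :: real^3^3. rotation_matrix R \<and> S = (*v) R ` equatorial_disk"
proof -
  obtain R :: "real^3^3" where R: "rotation_matrix R" "R *v axis 3 1 = m"
    and frame: "oriented_frame (R *v axis 1 1) (R *v axis 2 1) m"
    using oriented_frame_exists[OF m] by blast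
  define e1 e2 where e12: "e1 = R *v axis 1 1" "e2 = R *v axis 2 1"
  note frame = frame[folded e12]
  define \<Theta> where "\<Theta> q = Complex (q \<bullet> e1) (q \<bullet> e2)" for q
  have norm_\<Theta>: "norm (\<Theta> q) = norm q" if "q \<bullet> m = 0" for q
    using oriented_frame_inner[OF frame, of q q] that
    by (simp add: \<Theta>_def complex_norm norm_eq_sqrt_inner[of q] power2_eq_square)
  have inj: "x = y" if "\<Theta> x = \<Theta> y" "x \<bullet> m = 0" "y \<bullet> m = 0" for x y
    using that oriented_frame_eqI[OF frame, of x y] by (simp add: \<Theta>_def)
  have cont: "continuous_on S \<Theta>" unfolding \<Theta>_def Complex_eq by (intro continuous_intros)
  have inj_S: "inj_on \<Theta> S" using inj plane by (auto intro!: inj_onI)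
  have ball: "S \<subseteq> cball 0 1" and bd: "surface_boundary S \<subseteq> sphere 0 1"
    using free by (auto simp: free_boundary_def)
  let ?T = "\<Theta> ` S"
  have cl: "closed ?T" using compact_continuous_image[OF cont compact] compact_imp_closed by blast
  have T: "?T \<subseteq> cball 0 1" using ball norm_\<Theta> plane by (auto simp: subset_iff)
  have "interior ?T \<subseteq> ball 0 1" using interior_mono[OF T] by simp
  then have "ball 0 1 \<inter> interior ?T \<noteq> {}" using image_interior_nonempty[OF cont inj_S \<open>p \<in> S\<close>] by blast
  moreover have "ball 0 1 \<inter> ?T \<subseteq> interior ?T"
  proof
    fix z assume "z \<in> ball 0 1 \<inter> ?T"
    then obtain q where q: "q \<in> S" "z = \<Theta> q" "norm q < 1" using norm_\<Theta> plane by auto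
    then have "q \<notin> surface_boundary S" using bd by auto
    then show "z \<in> interior ?T" using interior_point_image[OF cont inj_S q(1)] q(2) by simp
  qed
  ultimately have "ball 0 1 \<subseteq> ?T" using connected_subset_of_clopen[OF connected_ball cl] by blast
  then have "closure (ball (0::complex) 1) \<subseteq> ?T" by (rule closure_minimal[OF _ cl])
  then have cb: "cball 0 1 \<subseteq> ?T" by simp
  have S: "S = {q. norm q \<le> 1 \<and> q \<bullet> m = 0}"
  proof
    show "S \<subseteq> {q. norm q \<le> 1 \<and> q \<bullet> m = 0}" using ball plane by auto
    show "{q. norm q \<le> 1 \<and> q \<bullet> m = 0} \<subseteq> S"
    proof clarify
      fix q assume q: "norm q \<le> 1" "q \<bullet> m = 0"
      then have "\<Theta> q \<in> ?T" using cb norm_\<Theta>[OF q(2)] by auto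
      then obtain q' where "q' \<in> S" "\<Theta> q' = \<Theta> q" by force
      then show "q \<in> S" using inj[of q' q] plane q by auto
    qed
  qed
  have coord: "(R *v x) \<bullet> m = x $ 3" for x
    using rotation_matrix_inner(1)[OF R(1), of x "axis 3 1"] R(2) by (simp add: inner_axis)
  have "S = (*v) R ` equatorial_disk"
  proof
    show "(*v) R ` equatorial_disk \<subseteq> S"
      unfolding S by (auto simp: equatorial_disk_def coord rotation_matrix_inner(2)[OF R(1)])
    show "S \<subseteq> (*v) R ` equatorial_disk"
    proof
      fix q assume q: "q \<in> S"
      obtain x where x: "q = R *v x" using rotation_matrix_inner(3)[OF R(1)] by (metis surjD)
      with q have "x \<in> equatorial_disk"
        unfolding S by (auto simp: equatorial_disk_def coord rotation_matrix_inner(2)[OF R(1)])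
      with x show "q \<in> (*v) R ` equatorial_disk" by blast
    qed
  qed
  with R(1) show ?thesis by blast
qed

end

section \<open>Heights of free boundary circles on a catenoid\<close>

lemma free_boundary_root_unique:
  fixes a b k :: real
  assumes a: "(a + k) * tanh a = 1" and b: "(b + k) * tanh b = 1" and "a < b"
  shows "a < 0 \<and> 0 < b"
proof -
  have nz: "a \<noteq> 0" "b \<noteq> 0" using a b by auto
  have "tanh a < tanh b" using \<open>a < b\<close> by simp
  \<comment> \<open>The equation reads a + k = coth a. As coth decreases on each half line, two
    solutions lie on different sides of 0.\<close>
  have eq: "a + k = 1 / tanh a" "b + k = 1 / tanh b"
    using a b nz by (simp_all add: nonzero_eq_divide_eq)
  show ?thesis
  proof (rule ccontr)
    assume "\<not> (a < 0 \<and> 0 < b)"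
    then have "0 < tanh a * tanh b" using nz \<open>a < b\<close> by (auto simp: zero_less_mult_iff)
    then have "1 / tanh b < 1 / tanh a"
      using \<open>tanh a < tanh b\<close> by (intro divide_strict_left_mono) (simp_all add: mult.commute)
    then show False using eq \<open>a < b\<close> by linarith
  qed
qed

lemma sinh_gt_self:
  fixes x :: real assumes "x > 0" shows "x < sinh x"
proof -
  have "sinh 0 - 0 < sinh x - x"
  proof (rule DERIV_pos_imp_increasing_open[OF assms, of "\<lambda>x. sinh x - x"])
    show "\<exists>y. ((\<lambda>x. sinh x - x) has_real_derivative y) (at z) \<and> 0 < y" if "0 < z" "z < x" for z :: real
      using that cosh_real_strict_mono[of 0 z]
      by (intro exI[of _ "cosh z - 1"]) (auto intro!: derivative_eq_intros)
  qed (auto intro!: continuous_intros)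
  then show ?thesis by simp
qed

text \<open>Two free boundary circles on one catenoid lie symmetrically: since \<open>cosh\<^sup>2 / sinh = sinh + 1 / sinh\<close> takes the
  same value at \<open>-a\<close> and \<open>b\<close>, either \<open>sinh b = sinh (-a)\<close> or the two values of \<open>sinh\<close> are reciprocal;
  in the latter case \<open>b - a = coth b + coth (-a)\<close> contradicts \<open>coth b = cosh b * sinh (-a) > -a\<close>.\<close>

lemma free_boundary_roots_symmetric:
  fixes a b k c :: real
  assumes a: "(a + k) * tanh a = 1" and b: "(b + k) * tanh b = 1" and "a < 0" "0 < b"
    and na: "(cosh a)\<^sup>2 + (a + k)\<^sup>2 = c\<^sup>2" and nb: "(cosh b)\<^sup>2 + (b + k)\<^sup>2 = c\<^sup>2"
  shows "k = 0" "a = - t0" "b = t0" "\<bar>c\<bar> = t0 * cosh t0"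
proof -
  define s where "s = sinh (- a)"
  define t where "t = sinh b"
  have pos: "s > 0" "t > 0" using assms by (simp_all add: s_def t_def)
  have ch: "(cosh a)\<^sup>2 = 1 + s\<^sup>2" "(cosh b)\<^sup>2 = 1 + t\<^sup>2"
    by (simp_all add: s_def t_def cosh_square_eq)
  have chp: "cosh a > 1" "cosh b > 1"
    using cosh_real_strict_mono[of 0 b] cosh_real_strict_mono[of 0 "- a"] assms by auto
  have eqa: "(a + k) * s = - cosh a"
  proof -
    have "(a + k) * sinh a = cosh a" using a chp by (simp add: tanh_def field_simps)
    then show ?thesis by (simp add: s_def)
  qed
  have eqb: "(b + k) * t = cosh b" using b chp by (simp add: tanh_def field_simps t_def)
  have ca: "c\<^sup>2 * s\<^sup>2 = (1 + s\<^sup>2)\<^sup>2"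
  proof -
    have "c\<^sup>2 * s\<^sup>2 = (cosh a)\<^sup>2 * s\<^sup>2 + ((a + k) * s)\<^sup>2"
      unfolding na[symmetric] power_mult_distrib by (rule distrib_right)
    then have "c\<^sup>2 * s\<^sup>2 = (1 + s\<^sup>2) * s\<^sup>2 + (1 + s\<^sup>2)" by (simp only: eqa power2_minus ch)
    then show ?thesis by (simp add: power2_eq_square algebra_simps)
  qed
  have cb: "c\<^sup>2 * t\<^sup>2 = (1 + t\<^sup>2)\<^sup>2"
  proof -
    have "c\<^sup>2 * t\<^sup>2 = (cosh b)\<^sup>2 * t\<^sup>2 + ((b + k) * t)\<^sup>2"
      unfolding nb[symmetric] power_mult_distrib by (rule distrib_right)
    then have "c\<^sup>2 * t\<^sup>2 = (1 + t\<^sup>2) * t\<^sup>2 + (1 + t\<^sup>2)" by (simp only: eqb ch)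
    then show ?thesis by (simp add: power2_eq_square algebra_simps)
  qed
  have csa: "\<bar>c\<bar> * s = 1 + s\<^sup>2" and csb: "\<bar>c\<bar> * t = 1 + t\<^sup>2"
  proof -
    have "(\<bar>c\<bar> * s)\<^sup>2 = (1 + s\<^sup>2)\<^sup>2" "(\<bar>c\<bar> * t)\<^sup>2 = (1 + t\<^sup>2)\<^sup>2"
      using ca cb by (simp_all add: power_mult_distrib)
    then show "\<bar>c\<bar> * s = 1 + s\<^sup>2" "\<bar>c\<bar> * t = 1 + t\<^sup>2"
      using pos by (simp_all add: power2_eq_iff_nonneg)
  qed
  have "(1 + s\<^sup>2) * t = (1 + t\<^sup>2) * s"
    unfolding csa[symmetric] csb[symmetric] by simp
  then have "(t - s) * (1 - s * t) = 0" by (simp add: power2_eq_square algebra_simps)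
  moreover have "s * t \<noteq> 1"
  proof
    assume st: "s * t = 1"
    have "b + k = (b + k) * t * s" using st by (simp add: mult.assoc mult.commute[of t])
    then have "b + k = cosh b * s" using eqb by simp
    moreover have "a + k = (a + k) * s * t" using st by simp
    then have "a + k = - (cosh a * t)" using eqa by simp
    moreover have "cosh b * s > s" "cosh a * t > t" using chp pos by simp_all
    moreover have "s > - a" "t > b" using sinh_gt_self[of "- a"] sinh_gt_self[of b] assms by (simp_all add: s_def t_def)
    ultimately show False by linarith
  qed
  ultimately have "s = t" by simp
  then have ab: "- a = b" unfolding s_def t_def by (simp only: sinh_real_eq_iff)
  have "(a + k) + (b + k) = 0"
  proof -
    have "((a + k) + (b + k)) * t = 0"
    proof -
      have "cosh b = cosh a" unfolding ab[symmetric] by simp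
      with eqa[unfolded \<open>s = t\<close>] eqb have "(a + k) * t + (b + k) * t = 0" by linarith
      then show ?thesis by (simp only: distrib_right)
    qed
    then show ?thesis using pos by simp
  qed
  then show k: "k = 0" using ab by simp
  have "b * tanh b = 1" using b k by simp
  then show bt: "b = t0" using t0_exists_unique t0 \<open>0 < b\<close> by blast
  then show "a = - t0" using ab by simp
  have "b * t = cosh b" using eqb k by simp
  have "\<bar>c\<bar> * t = (cosh b)\<^sup>2" using csb ch by simp
  also have "\<dots> = (b * cosh b) * t" using \<open>b * t = cosh b\<close> by (simp add: power2_eq_square)
  finally show "\<bar>c\<bar> = t0 * cosh t0" using pos bt by simp
qed

context minimal_embedded
begin

text \<open>\<open>rel\<close> together with |N| = 1 gives the equation of the catenoid. The
  open-closed argument of the flat case, now in an annulus, shows that \<open>S\<close> is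
  everything between two boundary circles.\<close>

lemma catenoid_piece:
  assumes free: "free_boundary S N" and "p0 \<in> S" and e: "norm e = 1" and c: "c \<noteq> 0"
    and pot: "\<And>q. q \<in> S \<Longrightarrow> potential_eq e c k q"
    and rel: "\<And>q. q \<in> S \<Longrightarrow> (c * (1 - (N q \<bullet> e)\<^sup>2)) *\<^sub>R (q - (q \<bullet> e) *\<^sub>R e) = N q - (N q \<bullet> e) *\<^sub>R e"
  shows "\<exists>R :: real^3^3. rotation_matrix R \<and> S = (*v) R ` critical_catenoid"
proof -
  obtain R :: "real^3^3" where R: "rotation_matrix R" "R *v axis 3 1 = e"
    and frame: "oriented_frame (R *v axis 1 1) (R *v axis 2 1) e"
    using oriented_frame_exists[OF e] by blast
  define e1 e2 where e12: "e1 = R *v axis 1 1" "e2 = R *v axis 2 1"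
  note frame = frame[folded e12]
  note fr = frame[unfolded oriented_frame_def]
  \<comment> \<open>The parameter of the catenoid: constant potential gives N . e = - tanh tau, and
    the radius turns out to be cosh tau / |c|.\<close>
  define \<tau> where "\<tau> q = c * (q \<bullet> e) - k" for q
  have height: "q \<bullet> e = (\<tau> q + k) / c" for q using c by (simp add: \<tau>_def)
  have Ne: "N q \<bullet> e = - tanh (\<tau> q)" if "q \<in> S" for q
  proof -
    have "N q \<bullet> e = tanh (artanh (N q \<bullet> e))" using pot[OF that] by (simp add: potential_eq_def tanh_artanh_real)
    also have "artanh (N q \<bullet> e) = - \<tau> q" using pot[OF that] by (simp add: potential_eq_def \<tau>_def)
    finally show ?thesis by simp
  qed
  have sech: "1 - (tanh x)\<^sup>2 = 1 / (cosh x)\<^sup>2" for x :: real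
  proof -
    have "(cosh x)\<^sup>2 \<noteq> 0" by simp
    then have "1 - (sinh x)\<^sup>2 / (cosh x)\<^sup>2 = ((cosh x)\<^sup>2 - (sinh x)\<^sup>2) / (cosh x)\<^sup>2"
      by (simp add: diff_divide_distrib)
    then show ?thesis by (simp only: tanh_def power_divide hyperbolic_pythagoras)
  qed
  have N12: "N q \<bullet> e1 = c / (cosh (\<tau> q))\<^sup>2 * (q \<bullet> e1)" "N q \<bullet> e2 = c / (cosh (\<tau> q))\<^sup>2 * (q \<bullet> e2)" if "q \<in> S" for q
    using arg_cong[OF rel[OF that], of "\<lambda>x. x \<bullet> e1"] arg_cong[OF rel[OF that], of "\<lambda>x. x \<bullet> e2"] fr
    by (simp_all add: Ne[OF that] sech inner_diff_left inner_add_left inner_commute[of e e1] inner_commute[of e e2])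
  have radius: "(q \<bullet> e1)\<^sup>2 + (q \<bullet> e2)\<^sup>2 = (cosh (\<tau> q) / c)\<^sup>2" if "q \<in> S" for q
  proof -
    have ch: "cosh (\<tau> q) \<noteq> 0" by simp
    have "(N q \<bullet> e1)\<^sup>2 + (N q \<bullet> e2)\<^sup>2 = 1 / (cosh (\<tau> q))\<^sup>2"
      using oriented_frame_inner[OF frame, of "N q" "N q"] N_norm[OF that] sech[of "\<tau> q"]
      by (simp add: Ne[OF that] dot_square_norm power2_eq_square)
    then have "(c / (cosh (\<tau> q))\<^sup>2)\<^sup>2 * ((q \<bullet> e1)\<^sup>2 + (q \<bullet> e2)\<^sup>2) = 1 / (cosh (\<tau> q))\<^sup>2"
      unfolding N12[OF that] by (simp only: power_mult_distrib distrib_left)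
    moreover have "(q \<bullet> e1)\<^sup>2 + (q \<bullet> e2)\<^sup>2
        = ((cosh (\<tau> q))\<^sup>2 / c)\<^sup>2 * ((c / (cosh (\<tau> q))\<^sup>2)\<^sup>2 * ((q \<bullet> e1)\<^sup>2 + (q \<bullet> e2)\<^sup>2))"
      using ch c by (simp add: power_mult_distrib[symmetric] mult.assoc[symmetric])
    ultimately have "(q \<bullet> e1)\<^sup>2 + (q \<bullet> e2)\<^sup>2 = ((cosh (\<tau> q))\<^sup>2 / c)\<^sup>2 * (1 / (cosh (\<tau> q))\<^sup>2)" by simp
    also have "\<dots> = (cosh (\<tau> q) / c)\<^sup>2" using ch by (simp add: power2_eq_square)
    finally show ?thesis .
  qed
  define w where "w q = Complex (q \<bullet> e1) (q \<bullet> e2)" for q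
  have norm_w: "norm (w q) = cosh (\<tau> q) / \<bar>c\<bar>" if "q \<in> S" for q
    unfolding w_def complex_norm complex.sel radius[OF that] by (simp add: real_sqrt_abs)
  \<comment> \<open>Polar image of the catenoid, with modulus exp tau and the argument of
    \<open>w q\<close>: heights become radii, and \<open>S\<close> becomes part of an
    annulus.\<close>
  define \<Theta> where "\<Theta> q = (exp (\<tau> q) * \<bar>c\<bar> / cosh (\<tau> q)) *\<^sub>R w q" for q
  have norm_\<Theta>: "norm (\<Theta> q) = exp (\<tau> q)" if "q \<in> S" for q
    using c by (simp add: \<Theta>_def norm_w[OF that])
  have cont: "continuous_on S \<Theta>"
    unfolding \<Theta>_def w_def \<tau>_def Complex_eq by (intro continuous_intros) auto
  have eqI: "x = y" if "\<tau> x = \<tau> y" "w x = w y" for x y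
    using that c oriented_frame_eqI[OF frame, of x y] by (simp add: w_def \<tau>_def)
  have inj: "inj_on \<Theta> S"
  proof (rule inj_onI)
    fix x y assume xy: "x \<in> S" "y \<in> S" "\<Theta> x = \<Theta> y"
    then have "\<tau> x = \<tau> y" using norm_\<Theta> by (metis exp_inj_iff)
    moreover from this have "w x = w y" using xy(3) c by (simp add: \<Theta>_def)
    ultimately show "x = y" by (rule eqI)
  qed
  \<comment> \<open>Orthogonality to the sphere and |q| = 1, written in terms of tau.\<close>
  have bd: "(\<tau> q + k) * tanh (\<tau> q) = 1" "(cosh (\<tau> q))\<^sup>2 + (\<tau> q + k)\<^sup>2 = c\<^sup>2"
    if q: "q \<in> surface_boundary S" for q
  proof -
    have qS: "q \<in> S" using q boundary_subset by blast
    have "q \<bullet> N q = 0" using free q by (auto simp: free_boundary_def orthogonal_def inner_commute)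
    define A where "A = c / (cosh (\<tau> q))\<^sup>2"
    have "0 = (q \<bullet> e1) * (A * (q \<bullet> e1)) + (q \<bullet> e2) * (A * (q \<bullet> e2)) + (\<tau> q + k) / c * - tanh (\<tau> q)"
      using oriented_frame_inner[OF frame, of q "N q"] \<open>q \<bullet> N q = 0\<close>
      by (simp only: N12[OF qS] Ne[OF qS] height[of q] A_def)
    moreover have "(q \<bullet> e1) * (A * (q \<bullet> e1)) + (q \<bullet> e2) * (A * (q \<bullet> e2)) = A * ((q \<bullet> e1)\<^sup>2 + (q \<bullet> e2)\<^sup>2)"
      by (simp add: power2_eq_square distrib_left mult.left_commute)
    ultimately have "A * ((q \<bullet> e1)\<^sup>2 + (q \<bullet> e2)\<^sup>2) = (\<tau> q + k) / c * tanh (\<tau> q)" by simp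
    then have "c / (cosh (\<tau> q))\<^sup>2 * ((q \<bullet> e1)\<^sup>2 + (q \<bullet> e2)\<^sup>2) = (\<tau> q + k) / c * tanh (\<tau> q)"
      by (simp only: A_def)
    then have "1 / c = (\<tau> q + k) / c * tanh (\<tau> q)"
      unfolding radius[OF qS] using c by (simp add: power_divide power2_eq_square)
    then show "(\<tau> q + k) * tanh (\<tau> q) = 1" using c by simp
    have "norm q = 1" using free q by (auto simp: free_boundary_def)
    then have "(cosh (\<tau> q) / c)\<^sup>2 + ((\<tau> q + k) / c)\<^sup>2 = 1"
      using oriented_frame_inner[OF frame, of q q] radius[OF qS] height[of q]
      by (simp add: dot_square_norm power2_eq_square)
    then show "(cosh (\<tau> q))\<^sup>2 + (\<tau> q + k)\<^sup>2 = c\<^sup>2" using c by (simp add: power_divide field_simps)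
  qed
  have \<tau>_cont: "continuous_on S \<tau>" unfolding \<tau>_def by (intro continuous_intros)
  obtain b where b: "b \<in> S" "\<And>q. q \<in> S \<Longrightarrow> \<tau> q \<le> \<tau> b"
    using continuous_attains_sup[OF compact _ \<tau>_cont] \<open>p0 \<in> S\<close> by blast
  obtain a where a: "a \<in> S" "\<And>q. q \<in> S \<Longrightarrow> \<tau> a \<le> \<tau> q"
    using continuous_attains_inf[OF compact _ \<tau>_cont] \<open>p0 \<in> S\<close> by blast
  let ?T = "\<Theta> ` S"
  let ?C = "{z :: complex. exp (\<tau> a) < norm (z - 0) \<and> norm (z - 0) < exp (\<tau> b)}"
  have T: "exp (\<tau> a) \<le> norm z \<and> norm z \<le> exp (\<tau> b)" if "z \<in> ?T" for z
    using that a(2) b(2) norm_\<Theta> by auto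
  \<comment> \<open>An interior point can be moved radially in both directions within
    \<open>?T\<close>, so its modulus is not extremal.\<close>
  have intT: "interior ?T \<subseteq> ?C"
  proof
    fix z assume z: "z \<in> interior ?T"
    then have "z \<in> ?T" using interior_subset by blast
    then have "norm z > 0" using T[of z] exp_gt_zero[of "\<tau> a"] by linarith
    obtain \<epsilon> where \<epsilon>: "\<epsilon> > 0" "\<epsilon> < 1" "(1 + \<epsilon>) *\<^sub>R z \<in> ?T" "(1 - \<epsilon>) *\<^sub>R z \<in> ?T"
      using interior_scale[OF z] by blast
    have "norm z < (1 + \<epsilon>) * norm z" "(1 - \<epsilon>) * norm z < norm z"
      using \<epsilon> \<open>norm z > 0\<close> by (simp_all add: algebra_simps)
    then show "z \<in> ?C" using T[OF \<epsilon>(3)] T[OF \<epsilon>(4)] \<epsilon> by auto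
  qed
  \<comment> \<open>The extreme heights are attained on the boundary, as all other points of
    \<open>S\<close> have interior images.\<close>
  have aB: "a \<in> surface_boundary S" and bB: "b \<in> surface_boundary S"
  proof -
    have "\<Theta> a \<notin> interior ?T" "\<Theta> b \<notin> interior ?T"
      using intT norm_\<Theta>[OF a(1)] norm_\<Theta>[OF b(1)] by auto
    then show "a \<in> surface_boundary S" "b \<in> surface_boundary S"
      using interior_point_image[OF cont inj a(1)] interior_point_image[OF cont inj b(1)] by blast+
  qed
  obtain z0 where z0: "z0 \<in> interior ?T" using image_interior_nonempty[OF cont inj \<open>p0 \<in> S\<close>] by blast
  then have "z0 \<in> ?C" using intT by (rule subsetD[rotated])
  then have "exp (\<tau> a) < exp (\<tau> b)" using less_trans by blast
  then have "\<tau> a < \<tau> b" by simp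
  from free_boundary_root_unique[OF bd(1)[OF aB] bd(1)[OF bB] this]
  have "\<tau> a < 0" "0 < \<tau> b" by auto
  from free_boundary_roots_symmetric[OF bd(1)[OF aB] bd(1)[OF bB] this bd(2)[OF aB] bd(2)[OF bB]]
  have vals: "k = 0" "\<tau> a = - t0" "\<tau> b = t0" "\<bar>c\<bar> = t0 * cosh t0" .
  \<comment> \<open>There is at most one root of each sign. So boundary points occur at the two
    extreme heights only, and none is mapped into the open annulus.\<close>
  have root: "x = \<tau> a \<or> x = \<tau> b" if "(x + k) * tanh x = 1" for x
    using free_boundary_root_unique[OF that bd(1)[OF aB]] free_boundary_root_unique[OF bd(1)[OF aB] that]
      free_boundary_root_unique[OF that bd(1)[OF bB]] free_boundary_root_unique[OF bd(1)[OF bB] that]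
      \<open>\<tau> a < 0\<close> \<open>0 < \<tau> b\<close> by linarith
  have cl: "closed ?T" using compact_continuous_image[OF cont compact] compact_imp_closed by blast
  have C: "?C \<subseteq> ?T"
  proof (rule connected_subset_of_clopen[OF _ cl])
    show "connected ?C" using connected_annulus(1)[of "exp (\<tau> a)" "0 :: complex" "exp (\<tau> b)"] by simp
    show "?C \<inter> interior ?T \<noteq> {}" using z0 \<open>z0 \<in> ?C\<close> by blast
    show "?C \<inter> ?T \<subseteq> interior ?T"
    proof
      fix z assume z: "z \<in> ?C \<inter> ?T"
      then obtain q where q: "q \<in> S" "z = \<Theta> q" by blast
      then have "\<tau> a < \<tau> q" "\<tau> q < \<tau> b" using z norm_\<Theta>[OF q(1)] by auto
      then have "q \<notin> surface_boundary S" using root[OF bd(1), of q] by linarith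
      then show "z \<in> interior ?T" using interior_point_image[OF cont inj q(1)] q(2) by simp
    qed
  qed
  define G where "G t \<theta> = (cosh t / \<bar>c\<bar> * cos \<theta>) *\<^sub>R e1 + (cosh t / \<bar>c\<bar> * sin \<theta>) *\<^sub>R e2 + (t / c) *\<^sub>R e" for t \<theta>
  have G: "G t \<theta> \<bullet> e1 = cosh t / \<bar>c\<bar> * cos \<theta>" "G t \<theta> \<bullet> e2 = cosh t / \<bar>c\<bar> * sin \<theta>" "G t \<theta> \<bullet> e = t / c" for t \<theta>
    using fr by (simp_all add: G_def inner_add_left inner_commute[of e2 e1] inner_commute[of e e1] inner_commute[of e e2])
  have Gw: "w (G t \<theta>) = (cosh t / \<bar>c\<bar>) *\<^sub>R cis \<theta>" "\<tau> (G t \<theta>) = t" for t \<theta>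
    using c vals(1) by (simp_all add: w_def G complex_eq_iff \<tau>_def)
  have G_open: "G t \<theta> \<in> S" if "t \<in> {-t0<..<t0}" for t \<theta>
  proof -
    have "exp t *\<^sub>R cis \<theta> \<in> ?C" using that vals by simp
    then have "exp t *\<^sub>R cis \<theta> \<in> ?T" by (rule subsetD[OF C])
    then obtain q where q: "q \<in> S" "\<Theta> q = exp t *\<^sub>R cis \<theta>" by (auto elim!: imageE)
    then have "exp (\<tau> q) = exp t" using norm_\<Theta>[OF q(1)] by simp
    then have \<tau>q: "\<tau> q = t" by simp
    have "(exp t * \<bar>c\<bar> / cosh t) *\<^sub>R w q = (exp t * \<bar>c\<bar> / cosh t) *\<^sub>R ((cosh t / \<bar>c\<bar>) *\<^sub>R cis \<theta>)"
      using q(2) c by (simp add: \<Theta>_def \<tau>q)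
    then have "w q = (cosh t / \<bar>c\<bar>) *\<^sub>R cis \<theta>" using c by (subst (asm) scaleR_cancel_left) simp
    then have "q = G t \<theta>" by (intro eqI) (simp_all add: Gw \<tau>q)
    then show ?thesis using q(1) by simp
  qed
  \<comment> \<open>The two boundary circles are limits of the part already found, and
    \<open>S\<close> is closed.\<close>
  have G_S: "G t \<theta> \<in> S" if "t \<in> {-t0..t0}" for t \<theta>
  proof -
    have "closed ((\<lambda>t. G t \<theta>) -` S)"
      unfolding G_def by (intro closed_vimage compact_imp_closed compact continuous_intros) (use c in auto)
    then have "closure {-t0<..<t0} \<subseteq> (\<lambda>t. G t \<theta>) -` S"
      using G_open by (intro closure_minimal) auto
    then show ?thesis using that t0(1) by (auto simp: closure_greaterThanLessThan)
  qed
  have S_G: "\<exists>\<theta>. q = G (\<tau> q) \<theta>" "\<tau> q \<in> {-t0..t0}" if "q \<in> S" for q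
  proof -
    have "w q = (cosh (\<tau> q) / \<bar>c\<bar>) *\<^sub>R cis (Arg (w q))"
      using norm_w[OF that] by (metis rcis_cmod_Arg rcis_def scaleR_conv_of_real)
    then have "q = G (\<tau> q) (Arg (w q))" by (intro eqI) (simp_all add: Gw)
    then show "\<exists>\<theta>. q = G (\<tau> q) \<theta>" by blast
    show "\<tau> q \<in> {-t0..t0}" using a(2)[OF that] b(2)[OF that] vals by simp
  qed
  define X where "X t \<theta> = (1 / (t0 * cosh t0)) *\<^sub>R (vector [cosh t * cos \<theta>, cosh t * sin \<theta>, t] :: real^3)" for t \<theta>
  \<comment> \<open>The height of \<open>G t \<theta>\<close> is \<open>t / c\<close>, that of the
    model a positive multiple of \<open>t\<close>, so for negative \<open>c\<close> the parameter
    changes sign. The scales agree because |c| = t0 cosh t0.\<close>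
  have RX: "R *v X t \<theta> = G (sgn c * t) \<theta>" for t \<theta>
  proof (rule oriented_frame_eqI[OF frame])
    have in1: "(R *v x) \<bullet> e1 = x $ 1" "(R *v x) \<bullet> e2 = x $ 2" "(R *v x) \<bullet> e = x $ 3" for x
      using rotation_matrix_inner(1)[OF R(1), of x "axis 1 1"] rotation_matrix_inner(1)[OF R(1), of x "axis 2 1"]
        rotation_matrix_inner(1)[OF R(1), of x "axis 3 1"] R(2) by (simp_all add: inner_axis e12)
    have ch: "cosh (sgn c * t) = cosh t" using c by (cases "c > 0") auto
    show "(R *v X t \<theta>) \<bullet> e1 = G (sgn c * t) \<theta> \<bullet> e1" "(R *v X t \<theta>) \<bullet> e2 = G (sgn c * t) \<theta> \<bullet> e2"
      unfolding in1 G ch vals(4) by (simp_all add: X_def)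
    have "sgn c * t / c = t / \<bar>c\<bar>" using c by (cases "c > 0") auto
    then show "(R *v X t \<theta>) \<bullet> e = G (sgn c * t) \<theta> \<bullet> e"
      unfolding in1 G vals(4) by (simp add: X_def)
  qed
  have sg: "sgn c * t \<in> {-t0..t0} \<longleftrightarrow> \<bar>t\<bar> \<le> t0" for t
    using c by (cases "c > 0") auto
  have "S = (*v) R ` critical_catenoid"
  proof
    show "(*v) R ` critical_catenoid \<subseteq> S"
      unfolding critical_catenoid_def X_def[symmetric] using G_S sg by (auto simp: RX)
    show "S \<subseteq> (*v) R ` critical_catenoid"
    proof
      fix q assume q: "q \<in> S"
      obtain \<theta> where \<theta>: "q = G (\<tau> q) \<theta>" using S_G(1)[OF q] by blast
      have "sgn c * (sgn c * \<tau> q) = \<tau> q" using c by (cases "c > 0") auto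
      then have "q = R *v X (sgn c * \<tau> q) \<theta>" using \<theta> by (simp only: RX)
      moreover have "\<bar>sgn c * \<tau> q\<bar> \<le> t0"
        using S_G(2)[OF q] c by (auto simp: abs_mult abs_sgn_eq)
      ultimately show "q \<in> (*v) R ` critical_catenoid"
        unfolding critical_catenoid_def X_def[symmetric] by blast
    qed
  qed
  with R(1) show ?thesis by blast
qed

end

theorem theoremB:
  fixes S \<gamma> :: "(real^3) set" and N :: "real^3 \<Rightarrow> real^3"
  assumes "embedded_surface S" and "compact S" and "connected S"
    and "unit_normal_field S N"
    and "minimal_surface S N"
    and "free_boundary S N"
    and "\<gamma> \<in> components (surface_boundary S)"
    and "\<exists>\<epsilon>>0. \<forall>x\<in>collar S \<gamma> \<epsilon>.
           linearly_dependent_pair (tangential (N x) x)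
             (shape_operator S N x (tangential (N x) x))"
  shows "\<exists>R :: real^3^3. rotation_matrix R \<and>
           (S = (*v) R ` equatorial_disk \<or> S = (*v) R ` critical_catenoid)"
proof -
  obtain \<epsilon> where \<epsilon>: "\<epsilon> > 0" "\<And>x. x \<in> collar S \<gamma> \<epsilon> \<Longrightarrow>
      linearly_dependent_pair (tangential (N x) x) (shape_operator S N x (tangential (N x) x))"
    using assms(8) by blast
  interpret collar_surface S N \<gamma> \<epsilon>
    using assms \<epsilon> by unfold_locales
  obtain p where "p \<in> S"
    using in_components_nonempty[OF component] in_components_subset[OF component] boundary_subset by blast
  show ?thesis
  proof (rule planar_or_catenoidal)
    fix m :: "real^3" assume "norm m = 1" "\<And>q. q \<in> S \<Longrightarrow> q \<bullet> m = 0"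
    from flat_disk[OF free \<open>p \<in> S\<close> this] show ?thesis by blast
  next
    fix e c k assume "norm e = 1" "c \<noteq> 0" "\<And>q. q \<in> S \<Longrightarrow> potential_eq e c k q"
      "\<And>q. q \<in> S \<Longrightarrow> (c * (1 - (N q \<bullet> e)\<^sup>2)) *\<^sub>R (q - (q \<bullet> e) *\<^sub>R e) = N q - (N q \<bullet> e) *\<^sub>R e"
    from catenoid_piece[OF free \<open>p \<in> S\<close> this] show ?thesis by blast
  qed
qed

end
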